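(* Let $(X,X_0)$ be a pair of Hausdorff spaces. Suppose that $(X,X_0)$ and some compact pair have the same H-shape. Then $C\check H^*(X,X_0)$ satisfies the exactness property: the sequence of H-shape cohomology groups $$\cdots\to C\check H^{q-1}(X_0)\xrightarrow{\ \delta\ }C\check H^q(X,X_0)\to C\check H^q(X)\to C\check H^q(X_0)\xrightarrow{\ \delta\ }C\check H^{q+1}(X,X_0)\to\cdots$$ is exact.
   Context: Pairs $(X,X_0)$ consist of Hausdorff spaces $X_0\subset X$; $(Y,Y_0)\subset(X,X_0)$ means $Y\subset X$, $Y_0\subset X_0$. A compact pair is a pair $(K,K_0)$ with $K$, $K_0$ compact Hausdorff. **H-shape.** A shape map $f:(K,K_0)\to(L,L_0)$ of compact pairs assigns to every pair $(Q,Q_0)$ of the homotopy type of a CW pair and every homotopy class $\eta:(L,L_0)\to(Q,Q_0)$ a homotopy class $f(\eta):(K,K_0)\to(Q,Q_0)$, such that whenever $\eta':(L,L_0)\to(Q',Q_0')$ and $\xi:(Q,Q_0)\to(Q',Q_0')$ are homotopy classes (with $(Q',Q'_0)$ also of the homotopy type of a CW pair) with $\xi\eta=\eta'$, one has $\xi f(\eta)=f(\eta')$. A continuous map of compact pairs induces a shape map by precomposition. A CS$^2$-system $X^*=\{(X_\lambda,X_{0\lambda}),p_{\lambda\lambda'},\Lambda\}$ is a direct system of compact pairs and shape maps $p_{\lambda\lambda'}:(X_\lambda,X_{0\lambda})\to(X_{\lambda'},X_{0\lambda'})$, $\lambda\le\lambda'$, over a directed set. A CS$^2$-morphism $F=(f_\lambda,f):X^*\to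 Y^*=\{(Y_\mu,Y_{0\mu}),q_{\mu\mu'},M\}$ is an increasing function $f:\Lambda\to M$ with shape maps $f_\lambda:(X_\lambda,X_{0\lambda})\to(Y_{f(\lambda)},Y_{0f(\lambda)})$ such that $q_{f(\lambda)f(\lambda')}f_\lambda=f_{\lambda'}p_{\lambda\lambda'}$ for $\lambda\le\lambda'$. $F\simeq G$ if for each $\lambda$ there is $\mu\ge f(\lambda),g(\lambda)$ with $q_{f(\lambda)\mu}f_\lambda=q_{g(\lambda)\mu}g_\lambda$. $X^*$, $Y^*$ have the same homotopy type if there are morphisms $F:X^*\to Y^*$, $G:Y^*\to X^*$ with $GF\simeq1_{X^*}$, $FG\simeq1_{Y^*}$. Let $c(X,X_0)$ be the set of compact pairs $(K,K_0)\subset(X,X_0)$ directed by inclusion and $C(X,X_0)$ the CS$^2$-system of these pairs with inclusion shape maps. $(X,X_0)$ and $(Y,Y_0)$ have the same H-shape if $C(X,X_0)$ and $C(Y,Y_0)$ have the same homotopy type. **H-shape cohomology.** Fix an abelian coefficient group. For $q\in\mathbb N$, $C\check H^q(X,X_0)=\varprojlim\check H^q(K,K_0)$, the inverse limit, over $(K,K_0)\in c(X,X_0)$, of Čech cohomology groups with the homomorphisms induced by inclusions; $C\check H^q(X)=C\check H^q(X,\emptyset)$. The maps in the sequence are the inverse limits over $(K,K_0)\in c(X,X_0)$ of the maps in the Čech cohomology sequences of the compact pairs $(K,K_0)$. *)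

theory Defs
  imports "HOL-Analysis.Analysis" "HOL-Algebra.Exact_Sequence" "HOL-Algebra.Product_Groups"
begin

section \<open>Pairs of spaces and homotopy classes\<close>

type_synonym 'a spair = "'a topology \<times> 'a set"

definition hausdorff_pair :: "'a spair \<Rightarrow> bool" where
  "hausdorff_pair P \<longleftrightarrow> Hausdorff_space (fst P) \<and> snd P \<subseteq> topspace (fst P)"

definition compact_pair :: "'a spair \<Rightarrow> bool" where
  "compact_pair P \<longleftrightarrow> hausdorff_pair P \<and> compact_space (fst P) \<and> compactin (fst P) (snd P)"

definition pair_map :: "'a spair \<Rightarrow> 'b spair \<Rightarrow> ('a \<Rightarrow> 'b) \<Rightarrow> bool" where
  "pair_map P Q f \<longleftrightarrow> continuous_map (fst P) (fst Q) f \<and> f ` snd P \<subseteq> snd Q"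

definition pair_homotopic :: "'a spair \<Rightarrow> 'b spair \<Rightarrow> ('a \<Rightarrow> 'b) \<Rightarrow> ('a \<Rightarrow> 'b) \<Rightarrow> bool" where
  "pair_homotopic P Q = homotopic_with (\<lambda>h. h ` snd P \<subseteq> snd Q) (fst P) (fst Q)"

text \<open>A homotopy class is the set of all its representatives. Values outside the underlying
  space play no role: a class contains every function that agrees on \<open>topspace (fst P)\<close> with
  one of its members.\<close>

definition hclass :: "'a spair \<Rightarrow> 'b spair \<Rightarrow> ('a \<Rightarrow> 'b) \<Rightarrow> ('a \<Rightarrow> 'b) set" where
  "hclass P Q f = {g. pair_homotopic P Q f g}"

definition hclasses :: "'a spair \<Rightarrow> 'b spair \<Rightarrow> ('a \<Rightarrow> 'b) set set" where
  "hclasses P Q = {hclass P Q f | f. pair_map P Q f}"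

definition hcomp :: "'a spair \<Rightarrow> 'c spair \<Rightarrow> ('b \<Rightarrow> 'c) set \<Rightarrow> ('a \<Rightarrow> 'b) set \<Rightarrow> ('a \<Rightarrow> 'c) set" where
  "hcomp P R \<xi> \<eta> = (\<Union>g\<in>\<xi>. \<Union>f\<in>\<eta>. hclass P R (g \<circ> f))"

definition pair_homotopy_equivalent :: "'a spair \<Rightarrow> 'b spair \<Rightarrow> bool" where
  "pair_homotopy_equivalent P Q \<longleftrightarrow>
     (\<exists>f g. pair_map P Q f \<and> pair_map Q P g \<and>
        pair_homotopic P P (g \<circ> f) id \<and> pair_homotopic Q Q (f \<circ> g) id)"


section \<open>CW pairs\<close>

definition disc :: "nat \<Rightarrow> (nat \<Rightarrow> real) topology" where
  "disc n = subtopology (Euclidean_space n) {x. (\<Sum>i<n. (x i)\<^sup>2) \<le> 1}"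

definition open_disc :: "nat \<Rightarrow> (nat \<Rightarrow> real) set" where
  "open_disc n = {x \<in> topspace (disc n). (\<Sum>i<n. (x i)\<^sup>2) < 1}"

definition characteristic_map ::
    "'a topology \<Rightarrow> 'a set set \<Rightarrow> ('a set \<Rightarrow> nat) \<Rightarrow> 'a set \<Rightarrow> ((nat \<Rightarrow> real) \<Rightarrow> 'a) \<Rightarrow> bool" where
  "characteristic_map X E d e \<Phi> \<longleftrightarrow>
     continuous_map (disc (d e)) X \<Phi> \<and>
     homeomorphic_map (subtopology (disc (d e)) (open_disc (d e))) (subtopology X e) \<Phi> \<and>
     \<Phi> ` (topspace (disc (d e)) - open_disc (d e)) \<subseteq> \<Union>{e' \<in> E. d e' < d e}"

text \<open>\<open>E\<close> is the set of open cells and \<open>d\<close> their dimension; the last two conjuncts are closure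
  finiteness and the weak topology.\<close>

definition cw_structure :: "'a topology \<Rightarrow> 'a set set \<Rightarrow> ('a set \<Rightarrow> nat) \<Rightarrow> bool" where
  "cw_structure X E d \<longleftrightarrow>
     Hausdorff_space X \<and> pairwise disjnt E \<and> \<Union>E = topspace X \<and>
     (\<forall>e\<in>E. \<exists>\<Phi>. characteristic_map X E d e \<Phi>) \<and>
     (\<forall>e\<in>E. finite {e' \<in> E. e' \<inter> X closure_of e \<noteq> {}}) \<and>
     (\<forall>A \<subseteq> topspace X. (\<forall>e\<in>E. closedin X (A \<inter> X closure_of e)) \<longrightarrow> closedin X A)"

definition cw_pair :: "'a spair \<Rightarrow> bool" where
  "cw_pair P \<longleftrightarrow>
     (\<exists>E d E0. cw_structure (fst P) E d \<and> E0 \<subseteq> E \<and> snd P = \<Union>E0 \<and>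
        (\<forall>e\<in>E0. fst P closure_of e \<subseteq> \<Union>E0))"

text \<open>Looking for the CW pair on the same type of points as \<open>Q\<close> is no restriction for a type
  of at least the cardinality of the continuum: a CW pair homotopy equivalent to \<open>Q\<close> contains
  one with at most as many cells as \<open>Q\<close> has points (or countably many).\<close>

definition cw_type :: "'q spair \<Rightarrow> bool" where
  "cw_type Q \<longleftrightarrow> hausdorff_pair Q \<and> (\<exists>P :: 'q spair. cw_pair P \<and> pair_homotopy_equivalent Q P)"

text \<open>HOL cannot quantify over all pairs \<open>(Q, Q\<^sub>0)\<close> in one formula, so in a shape map they
  range over the pairs on a type \<open>'q\<close>. The types used for \<open>'q\<close> are those of the
  following form. They contain \<open>nat \<Rightarrow> real\<close>, hence copies of all finite CW pairs. As
  the pairs mapped into \<open>(Q, Q\<^sub>0)\<close> are compact, every homotopy class in question factors through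
  a finite CW pair, so that all these types give the same shape maps; the parameter \<open>'u\<close> allows
  for \<open>Q\<close> of any size.\<close>

type_synonym 'u cw_universe = "(nat \<Rightarrow> real) + 'u"


section \<open>Shape maps\<close>

text \<open>\<open>('a, 'b, 'q) shape_map\<close> is for shape maps from a pair on \<open>'a\<close> to a pair on \<open>'b\<close>; so it sends
  \<open>(Q, \<eta>)\<close>, with \<open>\<eta>\<close> a class of maps out of the \<open>'b\<close>-pair, to a class of maps out of the
  \<open>'a\<close>-pair. The value \<open>{}\<close>, which is not a homotopy class, is prescribed outside the domain,
  so that equality of shape maps is equality of functions.\<close>

type_synonym ('a, 'b, 'q) shape_map = "'q spair \<Rightarrow> ('b \<Rightarrow> 'q) set \<Rightarrow> ('a \<Rightarrow> 'q) set"

definition is_shape_map :: "'a spair \<Rightarrow> 'b spair \<Rightarrow> ('a, 'b, 'q) shape_map \<Rightarrow> bool" where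
  "is_shape_map K L f \<longleftrightarrow>
     (\<forall>Q \<eta>. cw_type Q \<and> \<eta> \<in> hclasses L Q \<longrightarrow> f Q \<eta> \<in> hclasses K Q) \<and>
     (\<forall>Q \<eta>. \<not> (cw_type Q \<and> \<eta> \<in> hclasses L Q) \<longrightarrow> f Q \<eta> = {}) \<and>
     (\<forall>Q Q' \<eta> \<eta>' \<xi>. cw_type Q \<and> cw_type Q' \<and>
        \<eta> \<in> hclasses L Q \<and> \<eta>' \<in> hclasses L Q' \<and> \<xi> \<in> hclasses Q Q' \<and>
        hcomp L Q' \<xi> \<eta> = \<eta>' \<longrightarrow> hcomp K Q' \<xi> (f Q \<eta>) = f Q' \<eta>')"

definition shape_comp ::
    "('b, 'c, 'q) shape_map \<Rightarrow> ('a, 'b, 'q) shape_map \<Rightarrow> ('a, 'c, 'q) shape_map" where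
  "shape_comp g f = (\<lambda>Q \<eta>. f Q (g Q \<eta>))"

definition shape_of_map :: "'a spair \<Rightarrow> 'b spair \<Rightarrow> ('a \<Rightarrow> 'b) \<Rightarrow> ('a, 'b, 'q) shape_map" where
  "shape_of_map K L \<phi> = (\<lambda>Q \<eta>. if cw_type Q \<and> \<eta> \<in> hclasses L Q
                               then hcomp K Q \<eta> (hclass K L \<phi>) else {})"

definition shape_id :: "'a spair \<Rightarrow> ('a, 'a, 'q) shape_map" where
  "shape_id K = (\<lambda>Q \<eta>. if cw_type Q \<and> \<eta> \<in> hclasses K Q then \<eta> else {})"


section \<open>CS2-systems and H-shape\<close>

record ('l, 'a, 'q) cs2 =
  cs2_index :: "'l set"
  cs2_le :: "'l \<Rightarrow> 'l \<Rightarrow> bool"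
  cs2_pair :: "'l \<Rightarrow> 'a spair"
  cs2_bond :: "'l \<Rightarrow> 'l \<Rightarrow> ('a, 'a, 'q) shape_map"

definition cs2_system :: "('l, 'a, 'q) cs2 \<Rightarrow> bool" where
  "cs2_system S \<longleftrightarrow>
     cs2_index S \<noteq> {} \<and>
     (\<forall>l\<in>cs2_index S. cs2_le S l l) \<and>
     (\<forall>l\<in>cs2_index S. \<forall>m\<in>cs2_index S. \<forall>n\<in>cs2_index S.
        cs2_le S l m \<and> cs2_le S m n \<longrightarrow> cs2_le S l n) \<and>
     (\<forall>l\<in>cs2_index S. \<forall>m\<in>cs2_index S. \<exists>n\<in>cs2_index S. cs2_le S l n \<and> cs2_le S m n) \<and>
     (\<forall>l\<in>cs2_index S. compact_pair (cs2_pair S l)) \<and>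
     (\<forall>l\<in>cs2_index S. \<forall>m\<in>cs2_index S. cs2_le S l m \<longrightarrow>
        is_shape_map (cs2_pair S l) (cs2_pair S m) (cs2_bond S l m)) \<and>
     (\<forall>l\<in>cs2_index S. cs2_bond S l l = shape_id (cs2_pair S l)) \<and>
     (\<forall>l\<in>cs2_index S. \<forall>m\<in>cs2_index S. \<forall>n\<in>cs2_index S. cs2_le S l m \<and> cs2_le S m n \<longrightarrow>
        shape_comp (cs2_bond S m n) (cs2_bond S l m) = cs2_bond S l n)"

type_synonym ('l, 'a, 'm, 'b, 'q) cs2_mor = "('l \<Rightarrow> 'm) \<times> ('l \<Rightarrow> ('a, 'b, 'q) shape_map)"

definition cs2_morphism ::
    "('l, 'a, 'q) cs2 \<Rightarrow> ('m, 'b, 'q) cs2 \<Rightarrow> ('l, 'a, 'm, 'b, 'q) cs2_mor \<Rightarrow> bool" where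
  "cs2_morphism S T F \<longleftrightarrow>
     fst F \<in> cs2_index S \<rightarrow> cs2_index T \<and>
     (\<forall>l\<in>cs2_index S. is_shape_map (cs2_pair S l) (cs2_pair T (fst F l)) (snd F l)) \<and>
     (\<forall>l\<in>cs2_index S. \<forall>m\<in>cs2_index S. cs2_le S l m \<longrightarrow>
        cs2_le T (fst F l) (fst F m) \<and>
        shape_comp (cs2_bond T (fst F l) (fst F m)) (snd F l) =
        shape_comp (snd F m) (cs2_bond S l m))"

definition cs2_homotopic ::
    "('l, 'a, 'q) cs2 \<Rightarrow> ('m, 'b, 'q) cs2 \<Rightarrow>
     ('l, 'a, 'm, 'b, 'q) cs2_mor \<Rightarrow> ('l, 'a, 'm, 'b, 'q) cs2_mor \<Rightarrow> bool" where
  "cs2_homotopic S T F G \<longleftrightarrow>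
     (\<forall>l\<in>cs2_index S. \<exists>m\<in>cs2_index T. cs2_le T (fst F l) m \<and> cs2_le T (fst G l) m \<and>
        shape_comp (cs2_bond T (fst F l) m) (snd F l) =
        shape_comp (cs2_bond T (fst G l) m) (snd G l))"

definition cs2_comp ::
    "('m, 'b, 'n, 'c, 'q) cs2_mor \<Rightarrow> ('l, 'a, 'm, 'b, 'q) cs2_mor \<Rightarrow>
     ('l, 'a, 'n, 'c, 'q) cs2_mor" where
  "cs2_comp G F = (fst G \<circ> fst F, \<lambda>l. shape_comp (snd G (fst F l)) (snd F l))"

definition cs2_id :: "('l, 'a, 'q) cs2 \<Rightarrow> ('l, 'a, 'l, 'a, 'q) cs2_mor" where
  "cs2_id S = (id, \<lambda>l. shape_id (cs2_pair S l))"

definition cs2_homotopy_type_eq :: "('l, 'a, 'q) cs2 \<Rightarrow> ('m, 'b, 'q) cs2 \<Rightarrow> bool" where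
  "cs2_homotopy_type_eq S T \<longleftrightarrow>
     (\<exists>F G. cs2_morphism S T F \<and> cs2_morphism T S G \<and>
        cs2_homotopic S S (cs2_comp G F) (cs2_id S) \<and>
        cs2_homotopic T T (cs2_comp F G) (cs2_id T))"

text \<open>A member \<open>(K, K\<^sub>0)\<close> of \<open>compact_subpairs P\<close> is a pair of subsets; \<open>subpair P (K, K\<^sub>0)\<close>
  is the corresponding pair of spaces.\<close>

definition compact_subpairs :: "'a spair \<Rightarrow> ('a set \<times> 'a set) set" where
  "compact_subpairs P =
     {(K, K0). compactin (fst P) K \<and> compactin (fst P) K0 \<and> K0 \<subseteq> K \<and> K0 \<subseteq> snd P}"

definition subpair_le :: "'a set \<times> 'a set \<Rightarrow> 'a set \<times> 'a set \<Rightarrow> bool" where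
  "subpair_le C D \<longleftrightarrow> fst C \<subseteq> fst D \<and> snd C \<subseteq> snd D"

definition subpair :: "'a spair \<Rightarrow> 'a set \<times> 'a set \<Rightarrow> 'a spair" where
  "subpair P C = (subtopology (fst P) (fst C), snd C)"

definition C_system :: "'a spair \<Rightarrow> ('a set \<times> 'a set, 'a, 'q) cs2" where
  "C_system P =
     \<lparr>cs2_index = compact_subpairs P, cs2_le = subpair_le, cs2_pair = subpair P,
      cs2_bond = (\<lambda>C D. shape_of_map (subpair P C) (subpair P D) id)\<rparr>"

lemma hclass_eq_iff:
  assumes "pair_map P Q f"
  shows "hclass P Q f = hclass P Q g \<longleftrightarrow> pair_homotopic P Q f g"
proof
  have "pair_homotopic P Q f f"
    using assms by (simp add: pair_homotopic_def pair_map_def)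
  then show "pair_homotopic P Q f g" if "hclass P Q f = hclass P Q g"
    using that homotopic_with_sym unfolding hclass_def pair_homotopic_def by blast
next
  show "hclass P Q f = hclass P Q g" if "pair_homotopic P Q f g"
    using that homotopic_with_sym homotopic_with_trans unfolding hclass_def pair_homotopic_def
    by blast
qed

lemma hclass_self: "pair_map P Q f \<Longrightarrow> f \<in> hclass P Q f"
  by (simp add: hclass_def pair_homotopic_def pair_map_def)

lemma pair_map_comp: "pair_map P Q f \<Longrightarrow> pair_map Q R g \<Longrightarrow> pair_map P R (g \<circ> f)"
  unfolding pair_map_def by (auto intro: continuous_map_compose)

lemma pair_homotopic_comp:
  assumes "pair_homotopic P Q f f'" "pair_homotopic Q R g g'"
  shows "pair_homotopic P R (g \<circ> f) (g' \<circ> f')"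
proof -
  have c: "continuous_map (fst Q) (fst R) g" "g ` snd Q \<subseteq> snd R" "continuous_map (fst P) (fst Q) f'"
      "f' ` snd P \<subseteq> snd Q"
    using assms homotopic_with_imp_continuous_maps homotopic_with_imp_property
    unfolding pair_homotopic_def by blast+
  have f: "homotopic_with (\<lambda>h. h ` snd P \<subseteq> snd R) (fst P) (fst R) (g \<circ> f) (g \<circ> f')"
    using c by (intro homotopic_with_compose_continuous_map_left[OF assms(1)[unfolded pair_homotopic_def]]) (auto simp: image_subset_iff)
  have "homotopic_with (\<lambda>h. h ` snd P \<subseteq> snd R) (fst P) (fst R) (g \<circ> f') (g' \<circ> f')"
    using c by (intro homotopic_with_compose_continuous_map_right[OF assms(2)[unfolded pair_homotopic_def]]) (auto simp: image_subset_iff)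
  then show ?thesis
    using f homotopic_with_trans unfolding pair_homotopic_def by blast
qed

lemma hcomp_hclass:
  assumes "pair_map P Q f" "pair_map Q R g"
  shows "hcomp P R (hclass Q R g) (hclass P Q f) = hclass P R (g \<circ> f)"
proof -
  have "hclass P R (g' \<circ> f') = hclass P R (g \<circ> f)"
    if "g' \<in> hclass Q R g" "f' \<in> hclass P Q f" for g' f'
    using that pair_homotopic_comp[of P Q f f' R g g'] hclass_eq_iff[of P R "g \<circ> f" "g' \<circ> f'"]
      pair_map_comp[OF assms] by (simp add: hclass_def[of Q R g] hclass_def[of P Q f])
  then show ?thesis
    unfolding hcomp_def using hclass_self[OF assms(1)] hclass_self[OF assms(2)] by blast
qed

lemma hclass_in_hclasses: "pair_map P Q f \<Longrightarrow> hclass P Q f \<in> hclasses P Q"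
  by (auto simp: hclasses_def)

lemma empty_not_hclass: "{} \<notin> hclasses P Q"
  unfolding hclasses_def using hclass_self by blast

lemma shape_of_map_shape_map:
  assumes "pair_map K L \<phi>"
  shows "is_shape_map K L (shape_of_map K L \<phi>)"
  unfolding is_shape_map_def
proof (intro conjI allI impI; (elim conjE)?)
  fix Q \<eta> assume "cw_type Q" "\<eta> \<in> hclasses L Q"
  then show "shape_of_map K L \<phi> Q \<eta> \<in> hclasses K Q"
    using assms
    by (auto simp: shape_of_map_def hclasses_def[of L] hcomp_hclass intro!: hclass_in_hclasses pair_map_comp)
next
  fix Q \<eta> assume "\<not> (cw_type Q \<and> \<eta> \<in> hclasses L Q)"
  then show "shape_of_map K L \<phi> Q \<eta> = {}" by (auto simp: shape_of_map_def)
next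
  fix Q Q' \<eta> \<eta>' \<xi>
  assume a: "cw_type Q" "cw_type Q'" "\<eta> \<in> hclasses L Q" "\<eta>' \<in> hclasses L Q'"
    "\<xi> \<in> hclasses Q Q'" "hcomp L Q' \<xi> \<eta> = \<eta>'"
  obtain f g where fg: "pair_map L Q f" "\<eta> = hclass L Q f" "pair_map Q Q' g" "\<xi> = hclass Q Q' g"
    using a by (auto simp: hclasses_def)
  show "hcomp K Q' \<xi> (shape_of_map K L \<phi> Q \<eta>) = shape_of_map K L \<phi> Q' \<eta>'"
    using a(1-5) fg assms unfolding a(6)[symmetric]
    by (simp add: shape_of_map_def hcomp_hclass pair_map_comp o_assoc)
qed

lemma shape_of_map_id: "shape_of_map K K id = shape_id K"
proof -
  have "pair_map K K id" by (simp add: pair_map_def)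
  then show ?thesis
    by (auto simp: shape_of_map_def shape_id_def hclasses_def hcomp_hclass fun_eq_iff)
qed

lemma shape_of_map_comp:
  assumes "pair_map K L \<phi>" "pair_map L M \<psi>"
  shows "shape_comp (shape_of_map L M \<psi>) (shape_of_map K L \<phi>) = shape_of_map K M (\<psi> \<circ> \<phi>)"
proof -
  have "shape_of_map K L \<phi> Q (shape_of_map L M \<psi> Q \<eta>) = shape_of_map K M (\<psi> \<circ> \<phi>) Q \<eta>" for Q :: "'d spair" and \<eta>
  proof (cases "cw_type Q \<and> \<eta> \<in> hclasses M Q")
    case True
    then obtain f where f: "pair_map M Q f" "\<eta> = hclass M Q f" by (auto simp: hclasses_def)
    have "hclass L Q (f \<circ> \<psi>) \<in> hclasses L Q"
      using f assms by (intro hclass_in_hclasses pair_map_comp)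
    then show ?thesis
      using f True assms by (simp add: shape_of_map_def hcomp_hclass pair_map_comp o_assoc)
  next
    case False
    then show ?thesis by (auto simp: shape_of_map_def empty_not_hclass)
  qed
  then show ?thesis by (auto simp: shape_comp_def)
qed

lemma subpair_incl: "subpair_le C D \<Longrightarrow> pair_map (subpair P C) (subpair P D) id"
  unfolding pair_map_def subpair_def subpair_le_def
  by (auto simp: continuous_map_in_subtopology continuous_map_from_subtopology)

lemma cs2_system_C_system:
  assumes "hausdorff_pair P"
  shows "cs2_system (C_system P :: ('a set \<times> 'a set, 'a, 'q) cs2)"
proof -
  have "compact_pair (subpair P C)" if "C \<in> compact_subpairs P" for C
    using that assms
    by (auto simp: compact_subpairs_def compact_pair_def hausdorff_pair_def subpair_def
        compactin_subspace compact_space_subtopology Hausdorff_space_subtopology subtopology_subtopology inf_absorb2)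
  moreover have "\<exists>E\<in>compact_subpairs P. subpair_le C E \<and> subpair_le D E"
    if "C \<in> compact_subpairs P" "D \<in> compact_subpairs P" for C D
    using that by (intro bexI[of _ "(fst C \<union> fst D, snd C \<union> snd D)"])
      (auto simp: compact_subpairs_def subpair_le_def intro: compactin_Un)
  moreover have "({}, {}) \<in> compact_subpairs P" by (simp add: compact_subpairs_def)
  ultimately show ?thesis
    unfolding cs2_system_def C_system_def cs2.simps
    by (intro conjI)
      (blast, simp add: subpair_le_def, force simp: subpair_le_def, blast, blast,
       blast intro: shape_of_map_shape_map subpair_incl, simp add: shape_of_map_id,
       metis shape_of_map_comp subpair_incl comp_id)
qed

definition same_H_shape :: "'q itself \<Rightarrow> 'a spair \<Rightarrow> 'b spair \<Rightarrow> bool" where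
  "same_H_shape _ P R \<longleftrightarrow>
     cs2_homotopy_type_eq (C_system P :: ('a set \<times> 'a set, 'a, 'q) cs2) (C_system R)"


section \<open>Cohomology of simplicial pairs\<close>

text \<open>A simplicial complex is given as its set of simplices, i.e. of finite nonempty vertex sets.
  We use ordered cochains with values in the abelian group \<open>'g\<close>: a \<open>q\<close>-cochain of the pair
  \<open>(N, M)\<close> is a function on lists of \<open>q + 1\<close> vertices, repetitions allowed, which span a simplex
  of \<open>N\<close>; it vanishes on the simplices of \<open>M\<close>, and is extended by \<open>0\<close> to all other lists.
  As the empty set is not a simplex, there are no nonzero cochains for negative \<open>q\<close>.\<close>

definition cochains ::
    "'v set set \<times> 'v set set \<Rightarrow> int \<Rightarrow> ('v list \<Rightarrow> 'g::ab_group_add) set" where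
  "cochains NM q =
     {c. \<forall>s. c s \<noteq> 0 \<longrightarrow> int (length s) = q + 1 \<and> set s \<in> fst NM \<and> set s \<notin> snd NM}"

definition coboundary :: "'v set set \<Rightarrow> ('v list \<Rightarrow> 'g::ab_group_add) \<Rightarrow> 'v list \<Rightarrow> 'g" where
  "coboundary N c s =
     (if set s \<in> N
      then \<Sum>i<length s. (if even i then id else uminus) (c (take i s @ drop (Suc i) s))
      else 0)"

definition cocycle_group ::
    "'v set set \<times> 'v set set \<Rightarrow> int \<Rightarrow> ('v list \<Rightarrow> 'g::ab_group_add) monoid" where
  "cocycle_group NM q =
     \<lparr>carrier = {c \<in> cochains NM q. coboundary (fst NM) c = (\<lambda>s. 0)},
      monoid.mult = (\<lambda>c d s. c s + d s), one = (\<lambda>s. 0)\<rparr>"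

definition coboundaries ::
    "'v set set \<times> 'v set set \<Rightarrow> int \<Rightarrow> ('v list \<Rightarrow> 'g::ab_group_add) set" where
  "coboundaries NM q = coboundary (fst NM) ` cochains NM (q - 1)"

definition simp_cohomology ::
    "'v set set \<times> 'v set set \<Rightarrow> int \<Rightarrow> ('v list \<Rightarrow> 'g::ab_group_add) set monoid" where
  "simp_cohomology NM q = cocycle_group NM q Mod coboundaries NM q"

definition simp_class ::
    "'v set set \<times> 'v set set \<Rightarrow> int \<Rightarrow> ('v list \<Rightarrow> 'g::ab_group_add) \<Rightarrow> ('v list \<Rightarrow> 'g) set" where
  "simp_class NM q c = coboundaries NM q #>\<^bsub>cocycle_group NM q\<^esub> c"

text \<open>Homomorphism induced by a simplicial map \<open>p\<close> from the pair \<open>NM\<close> to another pair.\<close>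

definition pull_cochain ::
    "'v set set \<times> 'v set set \<Rightarrow> ('v \<Rightarrow> 'w) \<Rightarrow> ('w list \<Rightarrow> 'g::ab_group_add) \<Rightarrow> 'v list \<Rightarrow> 'g" where
  "pull_cochain NM p c s = (if set s \<in> fst NM then c (map p s) else 0)"

definition simp_induced ::
    "'v set set \<times> 'v set set \<Rightarrow> int \<Rightarrow> ('v \<Rightarrow> 'w) \<Rightarrow>
     ('w list \<Rightarrow> 'g::ab_group_add) set \<Rightarrow> ('v list \<Rightarrow> 'g) set" where
  "simp_induced NM q p x = (\<Union>c\<in>x. simp_class NM q (pull_cochain NM p c))"

text \<open>Connecting homomorphism from degree \<open>q\<close> of \<open>M\<close> to degree \<open>q + 1\<close> of \<open>(N, M)\<close>. The extension
  of a cochain of \<open>M\<close> to \<open>N\<close> is the extension by \<open>0\<close>, that is the same function.\<close>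

definition simp_delta ::
    "'v set set \<times> 'v set set \<Rightarrow> int \<Rightarrow>
     ('v list \<Rightarrow> 'g::ab_group_add) set \<Rightarrow> ('v list \<Rightarrow> 'g) set" where
  "simp_delta NM q x = (\<Union>c\<in>x. simp_class NM (q + 1) (coboundary (fst NM) c))"


section \<open>Cech cohomology of pairs\<close>

definition open_cover :: "'a topology \<Rightarrow> 'a set set \<Rightarrow> bool" where
  "open_cover T \<alpha> \<longleftrightarrow> (\<forall>U\<in>\<alpha>. openin T U) \<and> \<Union>\<alpha> = topspace T"

definition nerve :: "'a set set \<Rightarrow> 'a set \<Rightarrow> 'a set set set" where
  "nerve \<alpha> S = {\<sigma>. \<sigma> \<subseteq> \<alpha> \<and> finite \<sigma> \<and> \<sigma> \<noteq> {} \<and> \<Inter>\<sigma> \<inter> S \<noteq> {}}"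

definition nerve_pair :: "'a spair \<Rightarrow> 'a set set \<Rightarrow> 'a set set set \<times> 'a set set set" where
  "nerve_pair P \<alpha> = (nerve \<alpha> (topspace (fst P)), nerve \<alpha> (snd P))"

text \<open>\<open>projection f \<beta> \<alpha> p\<close>: the map \<open>p\<close> exhibits \<open>\<beta>\<close> as a refinement of the preimage of \<open>\<alpha>\<close>
  under \<open>f\<close>. For \<open>f = id\<close> these are the usual projections between covers of a space.\<close>

definition projection ::
    "('a \<Rightarrow> 'b) \<Rightarrow> 'a set set \<Rightarrow> 'b set set \<Rightarrow> ('a set \<Rightarrow> 'b set) \<Rightarrow> bool" where
  "projection f \<beta> \<alpha> p \<longleftrightarrow> (\<forall>V\<in>\<beta>. p V \<in> \<alpha> \<and> f ` V \<subseteq> p V)"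

text \<open>Cech cohomology is the direct limit of the cohomology groups of the nerve pairs over all open
  covers, directed by refinement. Its elements are equivalence classes of pairs \<open>(\<alpha>, x)\<close>, with \<open>x\<close> in
  the cohomology of the nerve pair of \<open>\<alpha>\<close>. Any two projections between the same covers are
  contiguous and so induce the same homomorphism.\<close>

type_synonym ('a, 'g) cech_class = "('a set set \<times> ('a set list \<Rightarrow> 'g) set) set"

definition cech_reps ::
    "int \<Rightarrow> 'a spair \<Rightarrow> ('a set set \<times> ('a set list \<Rightarrow> 'g::ab_group_add) set) set" where
  "cech_reps q P =
     {(\<alpha>, x). open_cover (fst P) \<alpha> \<and> x \<in> carrier (simp_cohomology (nerve_pair P \<alpha>) q)}"

definition cech_rel ::
    "int \<Rightarrow> 'a spair \<Rightarrow> ('a set set \<times> ('a set list \<Rightarrow> 'g::ab_group_add) set) rel" where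
  "cech_rel q P =
     {((\<alpha>, x), (\<beta>, y)). (\<alpha>, x) \<in> cech_reps q P \<and> (\<beta>, y) \<in> cech_reps q P \<and>
        (\<exists>\<gamma> p p'. open_cover (fst P) \<gamma> \<and> projection id \<gamma> \<alpha> p \<and> projection id \<gamma> \<beta> p' \<and>
           simp_induced (nerve_pair P \<gamma>) q p x = simp_induced (nerve_pair P \<gamma>) q p' y)}"

definition cech_cohomology :: "int \<Rightarrow> 'a spair \<Rightarrow> ('a, 'g::ab_group_add) cech_class monoid" where
  "cech_cohomology q P =
     \<lparr>carrier = cech_reps q P // cech_rel q P,
      monoid.mult = (\<lambda>A B. \<Union>{cech_rel q P `` {(\<gamma>, simp_induced (nerve_pair P \<gamma>) q p x
                          \<otimes>\<^bsub>simp_cohomology (nerve_pair P \<gamma>) q\<^esub> simp_induced (nerve_pair P \<gamma>) q p' y)}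
                 | \<alpha> x \<beta> y \<gamma> p p'. (\<alpha>, x) \<in> A \<and> (\<beta>, y) \<in> B \<and> open_cover (fst P) \<gamma> \<and>
                     projection id \<gamma> \<alpha> p \<and> projection id \<gamma> \<beta> p'}),
      one = cech_rel q P `` {({topspace (fst P)},
               \<one>\<^bsub>simp_cohomology (nerve_pair P {topspace (fst P)}) q\<^esub>)}\<rparr>"

text \<open>Homomorphism from the cohomology of \<open>R\<close> to that of \<open>P\<close> induced by a map \<open>f\<close> from \<open>P\<close> to \<open>R\<close>.
  The classes in the union all coincide.\<close>

definition cech_induced ::
    "int \<Rightarrow> 'a spair \<Rightarrow> 'b spair \<Rightarrow> ('a \<Rightarrow> 'b) \<Rightarrow>
     ('b, 'g::ab_group_add) cech_class \<Rightarrow> ('a, 'g) cech_class" where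
  "cech_induced q P R f A =
     \<Union>{cech_rel q P `` {(\<beta>, simp_induced (nerve_pair P \<beta>) q p x)}
       | \<alpha> x \<beta> p. (\<alpha>, x) \<in> A \<and> open_cover (fst P) \<beta> \<and> projection f \<beta> \<alpha> p}"

text \<open>Connecting homomorphism from degree \<open>q\<close> of \<open>A\<close> to degree \<open>q + 1\<close> of the pair \<open>P = (T, A)\<close>,
  \<open>A\<close> closed in \<open>T\<close>: a class of \<open>A\<close> comes from a cover \<open>\<beta>\<close> of \<open>A\<close>. Choose a cover \<open>\<alpha>\<close> of \<open>T\<close>
  whose trace on \<open>A\<close> refines \<open>\<beta>\<close>, so that the subcomplex \<open>nerve \<alpha> A\<close> is mapped to the nerve
  of \<open>\<beta>\<close>, and apply the connecting homomorphism of the nerve pair of \<open>\<alpha>\<close>. The classes in the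
  union again coincide.\<close>

definition cech_delta ::
    "int \<Rightarrow> 'a spair \<Rightarrow> ('a, 'g::ab_group_add) cech_class \<Rightarrow> ('a, 'g) cech_class" where
  "cech_delta q P A =
     \<Union>{cech_rel (q + 1) P `` {(\<alpha>, simp_delta (nerve_pair P \<alpha>) q
                                   (simp_induced (nerve \<alpha> (snd P), {}) q p y))}
       | \<beta> y \<alpha> p. (\<beta>, y) \<in> A \<and> open_cover (fst P) \<alpha> \<and>
           (\<forall>V\<in>\<alpha>. V \<inter> snd P \<noteq> {} \<longrightarrow> p V \<in> \<beta> \<and> V \<inter> snd P \<subseteq> p V)}"


section \<open>H-shape cohomology\<close>

type_synonym ('a, 'g) H_class = "'a set \<times> 'a set \<Rightarrow> ('a, 'g) cech_class"

definition H_cohomology :: "int \<Rightarrow> 'a spair \<Rightarrow> ('a, 'g::ab_group_add) H_class monoid" where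
  "H_cohomology q P =
     (product_group (compact_subpairs P) (\<lambda>C. cech_cohomology q (subpair P C)))
       \<lparr>carrier := {\<phi> \<in> \<Pi>\<^sub>E C\<in>compact_subpairs P. carrier (cech_cohomology q (subpair P C)).
          \<forall>C\<in>compact_subpairs P. \<forall>D\<in>compact_subpairs P. subpair_le C D \<longrightarrow>
            cech_induced q (subpair P C) (subpair P D) id (\<phi> D) = \<phi> C}\<rparr>"

text \<open>If \<open>R\<close> is a subpair of \<open>P\<close>, then the compact subpairs of \<open>R\<close> are among those of \<open>P\<close>, and the
  homomorphism from the cohomology of \<open>P\<close> to that of \<open>R\<close> is restriction of families. The lemmas
  below state that for the inclusions of \<open>(X, \<emptyset>)\<close> in \<open>(X, X\<^sub>0)\<close> and of \<open>X\<^sub>0\<close> in \<open>X\<close> this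
  is the limit of the Cech homomorphisms of the compact pairs \<open>(K, K\<^sub>0)\<close>.\<close>

definition H_restrict :: "'a spair \<Rightarrow> ('a, 'g::ab_group_add) H_class \<Rightarrow> ('a, 'g) H_class" where
  "H_restrict R \<phi> = restrict \<phi> (compact_subpairs R)"

definition H_delta ::
    "int \<Rightarrow> 'a spair \<Rightarrow> ('a, 'g::ab_group_add) H_class \<Rightarrow> ('a, 'g) H_class" where
  "H_delta q P \<psi> = (\<lambda>C\<in>compact_subpairs P. cech_delta q (subpair P C) (\<psi> (snd C, {})))"

lemma H_restrict_absolute:
  assumes "\<phi> \<in> carrier (H_cohomology q (X, X0))" "(K, K0) \<in> compact_subpairs (X, X0)"
  shows "H_restrict (X, {}) \<phi> (K, {}) =
    cech_induced q (subtopology X K, {}) (subtopology X K, K0) id (\<phi> (K, K0))"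
proof -
  have 1: "(K, {}) \<in> compact_subpairs (X, {})" "(K, {}) \<in> compact_subpairs (X, X0)"
    using assms(2) by (auto simp: compact_subpairs_def)
  have "cech_induced q (subpair (X, X0) (K, {})) (subpair (X, X0) (K, K0)) id (\<phi> (K, K0)) = \<phi> (K, {})"
    using assms 1 by (simp add: H_cohomology_def subpair_le_def)
  then show ?thesis using 1 by (simp add: H_restrict_def subpair_def)
qed

lemma H_restrict_subspace:
  assumes "\<psi> \<in> carrier (H_cohomology q (X, {}))" "(K, K0) \<in> compact_subpairs (X, X0)"
  shows "H_restrict (subtopology X X0, {}) \<psi> (K0, {}) =
    cech_induced q (subtopology X K0, {}) (subtopology X K, {}) id (\<psi> (K, {}))"
proof -
  have 1: "(K0, {}) \<in> compact_subpairs (subtopology X X0, {})"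
    "(K0, {}) \<in> compact_subpairs (X, {})" "(K, {}) \<in> compact_subpairs (X, {})" "K0 \<subseteq> K"
    using assms(2) by (auto simp: compact_subpairs_def compactin_subtopology)
  have "cech_induced q (subpair (X, {}) (K0, {})) (subpair (X, {}) (K, {})) id (\<psi> (K, {})) = \<psi> (K0, {})"
    using assms(1) 1 by (simp add: H_cohomology_def subpair_le_def)
  then show ?thesis using 1 by (simp add: H_restrict_def subpair_def)
qed

end

theory Submission
  imports Defs
begin

text \<open>The system of a compact pair has a largest member. Hence, if \<open>(X, X\<^sub>0)\<close> has the H-shape of a compact
  pair, there are a compact subpair \<open>L\<close> and compatible shape maps \<open>e\<^sub>C : C \<rightarrow> L\<close> from all compact subpairs
  which become the inclusions of \<open>C\<close> in a larger compact subpair. A Cech class of \<open>L\<close> comes from a simplicial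
  cocycle \<open>c\<close> along a map \<open>\<tau>\<close> from \<open>L\<close> into a finite polyhedral pair, and the classes of \<open>c\<close> along
  representatives of \<open>e\<^sub>C[\<tau>]\<close> form an element of the inverse limit. If the class of \<open>L\<close> is itself a
  member of a compatible family, this recovers the family. As \<open>e\<^sub>C[\<tau>]\<close> is a map of pairs, one and the same
  choice serves the pair, the space and the subspace, so preimages found in the exact Cech sequence
  of \<open>L\<close> extend to preimages in the limit.\<close>


section \<open>Simplicial cochains\<close>

text \<open>An inverse limit of exact sequences need not be exact: preimages on the individual
  compact pairs may not be choosable compatibly. Here one choice is made on \<open>L\<close> and
  carried to every \<open>C\<close>; naturality of the shape maps in \<open>C\<close> makes the
  results compatible. The carried family need not take the chosen class as its value at
  \<open>L\<close>, because the shape map of \<open>L\<close> itself is the identity only after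
  passing to a larger compact pair. Classes extending to that pair are reproduced, and this
  suffices: what must be reproduced is the given element of a kernel. Its value on the larger pair
  is represented by a map that the shape map of \<open>C\<close> sends to its own restriction to
  \<open>C\<close>. For this, the carried class has to depend on the Cech class on \<open>L\<close>
  alone, not on the polyhedron, map and cocycle representing it. Shape maps act on maps into CW
  pairs, while Cech groups are built from nerves. Finite polyhedra mediate: a finite cover gives a
  map into its nerve, and a map into a polyhedron gives the cover by preimages of open
  stars.\<close>

definition abstract_complex :: "'v set set \<Rightarrow> bool" where
  "abstract_complex N \<longleftrightarrow> {} \<notin> N \<and> (\<forall>\<sigma>\<in>N. finite \<sigma> \<and> (\<forall>\<tau>. \<tau> \<subseteq> \<sigma> \<and> \<tau> \<noteq> {} \<longrightarrow> \<tau> \<in> N))"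

definition simplicial_pair :: "'v set set \<times> 'v set set \<Rightarrow> bool" where
  "simplicial_pair NM \<longleftrightarrow>
     abstract_complex (fst NM) \<and> abstract_complex (snd NM) \<and> snd NM \<subseteq> fst NM"

definition simplicial_map ::
    "'v set set \<times> 'v set set \<Rightarrow> 'w set set \<times> 'w set set \<Rightarrow> ('v \<Rightarrow> 'w) \<Rightarrow> bool" where
  "simplicial_map NM NM' p \<longleftrightarrow>
     (\<forall>\<sigma>\<in>fst NM. p ` \<sigma> \<in> fst NM') \<and> (\<forall>\<sigma>\<in>snd NM. p ` \<sigma> \<in> snd NM')"

definition contiguous ::
    "'v set set \<times> 'v set set \<Rightarrow> 'w set set \<times> 'w set set \<Rightarrow> ('v \<Rightarrow> 'w) \<Rightarrow> ('v \<Rightarrow> 'w) \<Rightarrow> bool" where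
  "contiguous NM NM' p p' \<longleftrightarrow>
     (\<forall>\<sigma>\<in>fst NM. p ` \<sigma> \<union> p' ` \<sigma> \<in> fst NM') \<and> (\<forall>\<sigma>\<in>snd NM. p ` \<sigma> \<union> p' ` \<sigma> \<in> snd NM')"

abbreviation cocycles ::
    "'v set set \<times> 'v set set \<Rightarrow> int \<Rightarrow> ('v list \<Rightarrow> 'g::ab_group_add) set" where
  "cocycles NM q \<equiv> carrier (cocycle_group NM q)"

lemma cocycles_iff: "c \<in> cocycles NM q \<longleftrightarrow> c \<in> cochains NM q \<and> coboundary (fst NM) c = (\<lambda>s. 0)"
  by (simp add: cocycle_group_def)

lemma abstract_complex_face:
  "\<lbrakk>abstract_complex N; \<sigma> \<in> N; \<tau> \<subseteq> \<sigma>; \<tau> \<noteq> {}\<rbrakk> \<Longrightarrow> \<tau> \<in> N"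
  by (auto simp: abstract_complex_def)

lemma abstract_complex_not_empty: "abstract_complex N \<Longrightarrow> {} \<notin> N"
  by (simp add: abstract_complex_def)

lemma abstract_complex_empty [simp]: "abstract_complex {}"
  by (simp add: abstract_complex_def)

lemma contiguous_imp_simplicial:
  assumes "simplicial_pair NM" "simplicial_pair NM'" "contiguous NM NM' p p'"
  shows "simplicial_map NM NM' p" "simplicial_map NM NM' p'"
proof -
  have "r ` \<sigma> \<in> N'" if "r ` \<sigma> \<subseteq> p ` \<sigma> \<union> p' ` \<sigma>" "p ` \<sigma> \<union> p' ` \<sigma> \<in> N'" "\<sigma> \<in> N"
    "abstract_complex N" "abstract_complex N'" for r :: "'a \<Rightarrow> 'b" and \<sigma> N N'
    using that abstract_complex_face[of N' "p ` \<sigma> \<union> p' ` \<sigma>" "r ` \<sigma>"]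
    by (auto dest: abstract_complex_not_empty)
  with assms show "simplicial_map NM NM' p" "simplicial_map NM NM' p'"
    unfolding simplicial_map_def contiguous_def simplicial_pair_def by (metis Un_upper1 Un_upper2)+
qed

text \<open>The coboundary without truncation to a complex obeys a recursion on the list of vertices,
  from which the identities for cochains follow by induction.\<close>

definition cob :: "('v list \<Rightarrow> 'g::ab_group_add) \<Rightarrow> 'v list \<Rightarrow> 'g" where
  "cob c s = (\<Sum>i<length s. (if even i then id else uminus) (c (take i s @ drop (Suc i) s)))"

lemma coboundary_cob: "coboundary N c s = (if set s \<in> N then cob c s else 0)"
  by (simp add: coboundary_def cob_def)

lemma cob_Nil [simp]: "cob c [] = 0"
  by (simp add: cob_def)

text \<open>Omitting the head leaves \<open>s\<close>; omitting a later vertex keeps the head and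
  moves the index by one, which reverses the sign.\<close>

lemma cob_Cons: "cob c (v # s) = c s - cob (\<lambda>t. c (v # t)) s"
proof -
  have "cob c (v # s) = c s + (\<Sum>i<length s. (if even (Suc i) then id else uminus) (c (v # take i s @ drop (Suc i) s)))"
    by (simp add: cob_def sum.lessThan_Suc_shift del: sum.lessThan_Suc)
  also have "(\<Sum>i<length s. (if even (Suc i) then id else uminus) (c (v # take i s @ drop (Suc i) s)))
      = - cob (\<lambda>t. c (v # t)) s"
    unfolding cob_def sum_negf[symmetric] by (rule sum.cong) auto
  finally show ?thesis by simp
qed

lemma cob_diff: "cob (\<lambda>s. c s - d s) s = cob c s - cob d s"
  by (induction s arbitrary: c d) (simp_all add: cob_Cons)

lemma cob_add: "cob (\<lambda>s. c s + d s) s = cob c s + cob d s"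
  by (induction s arbitrary: c d) (simp_all add: cob_Cons)

lemma cob_zero [simp]: "cob (\<lambda>s. 0) s = 0"
  by (induction s) (simp_all add: cob_Cons)

text \<open>By the recursion the two terms \<open>cob c s\<close> cancel, and what remains is the
  claim for \<open>\<lambda>t. c (v # t)\<close>; hence the induction over all
  \<open>c\<close>.\<close>

lemma cob_cob: "cob (cob c) s = 0"
proof (induction s arbitrary: c)
  case (Cons v s)
  have "cob (\<lambda>t. cob c (v # t)) s = cob c s - cob (cob (\<lambda>t. c (v # t))) s"
    by (simp add: cob_Cons cob_diff)
  with Cons show ?case by (simp add: cob_Cons)
qed simp

lemma cob_map: "cob (\<lambda>t. c (map p t)) s = cob c (map p s)"
  by (induction s arbitrary: c) (simp_all add: cob_Cons)

lemma cob_cong: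
  assumes "\<And>t. \<lbrakk>set t \<subseteq> set s; length s = Suc (length t)\<rbrakk> \<Longrightarrow> c t = d t"
  shows "cob c s = cob d s"
  using assms
proof (induction s arbitrary: c d)
  case (Cons v s)
  have "cob (\<lambda>t. c (v # t)) s = cob (\<lambda>t. d (v # t)) s"
    by (rule Cons.IH) (rule Cons.prems, auto)
  moreover have "c s = d s" by (rule Cons.prems) auto
  ultimately show ?case by (simp add: cob_Cons)
qed simp

text \<open>The alternating sum of \<open>c\<close> over the lists p v_0, ..., p v_i, p' v_i, ...,
  p' v_n, that is \<open>c\<close> evaluated on the prism between the two images of the list. The
  recursion is parallel to \<open>cob_Cons\<close>.\<close>

primrec prism :: "('v \<Rightarrow> 'w) \<Rightarrow> ('v \<Rightarrow> 'w) \<Rightarrow> 'v list \<Rightarrow> ('w list \<Rightarrow> 'g::ab_group_add) \<Rightarrow> 'g" where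
  "prism p p' [] c = 0"
| "prism p p' (v # s) c = c (p v # p' v # map p' s) - prism p p' s (\<lambda>t. c (p v # t))"

lemma prism_diff: "prism p p' s (\<lambda>t. c t - d t) = prism p p' s c - prism p p' s d"
  by (induction s arbitrary: c d) simp_all

text \<open>After unfolding at the head, the terms \<open>cob ?E s\<close> and
  \<open>prism p p' s c\<close> cancel; the rest is the identity for \<open>?c\<close>.\<close>

lemma prism_homotopy:
  "cob (\<lambda>s. prism p p' s c) s + prism p p' s (cob c) = c (map p' s) - c (map p s)"
proof (induction s arbitrary: c)
  case (Cons v s)
  let ?c = "\<lambda>t. c (p v # t)" and ?E = "\<lambda>t. c (p v # p' v # map p' t)"
  have 1: "cob (\<lambda>s. prism p p' s c) (v # s) =
      prism p p' s c - (cob ?E s - cob (\<lambda>s. prism p p' s ?c) s)"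
    by (simp add: cob_Cons cob_diff)
  have "cob ?E s = cob (\<lambda>t. c (p v # p' v # t)) (map p' s)"
    using cob_map[of "\<lambda>t. c (p v # p' v # t)" p' s] by simp
  moreover have "prism p p' s (\<lambda>t. cob c (p v # t)) = prism p p' s c - prism p p' s (cob ?c)"
    by (simp add: cob_Cons prism_diff)
  moreover have "cob c (p v # p' v # map p' s) =
      c (p' v # map p' s) - (c (p v # map p' s) - cob (\<lambda>t. c (p v # p' v # t)) (map p' s))"
    by (simp add: cob_Cons)
  moreover have "prism p p' (v # s) (cob c) =
      cob c (p v # p' v # map p' s) - prism p p' s (\<lambda>t. cob c (p v # t))"
    by simp
  moreover have "cob (\<lambda>s. prism p p' s ?c) s =
      c (p v # map p' s) - c (p v # map p s) - prism p p' s (cob ?c)"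
    using Cons[of ?c] by (simp add: algebra_simps)
  ultimately show ?case
    unfolding 1 by simp
qed simp

lemma prism_cong:
  assumes "\<And>t. \<lbrakk>set t \<subseteq> p ` set s \<union> p' ` set s; length t = Suc (length s)\<rbrakk> \<Longrightarrow> c t = d t"
  shows "prism p p' s c = prism p p' s d"
  using assms
proof (induction s arbitrary: c d)
  case (Cons v s)
  have "prism p p' s (\<lambda>t. c (p v # t)) = prism p p' s (\<lambda>t. d (p v # t))"
    by (rule Cons.IH) (rule Cons.prems, auto)
  moreover have "c (p v # p' v # map p' s) = d (p v # p' v # map p' s)"
    by (rule Cons.prems) auto
  ultimately show ?case by simp
qed simp

lemma prism_zero: "prism p p' s (\<lambda>t. 0) = 0"
  by (induction s) simp_all


section \<open>Relative cochains, cocycles and coboundaries\<close>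

lemma cochainsD:
  assumes "c \<in> cochains NM q" "c s \<noteq> 0"
  shows "int (length s) = q + 1" "set s \<in> fst NM" "set s \<notin> snd NM"
  using assms by (auto simp: cochains_def)

lemma cochains_eq_0:
  "\<lbrakk>c \<in> cochains NM q; set s \<notin> fst NM \<or> set s \<in> snd NM \<or> int (length s) \<noteq> q + 1\<rbrakk> \<Longrightarrow> c s = 0"
  by (auto simp: cochains_def)

lemma cochains_Nil: "\<lbrakk>c \<in> cochains NM q; simplicial_pair NM\<rbrakk> \<Longrightarrow> c [] = 0"
  by (rule cochains_eq_0) (auto simp: simplicial_pair_def dest: abstract_complex_not_empty)

lemma cochains_zero [simp]: "(\<lambda>s. 0) \<in> cochains NM q"
  by (simp add: cochains_def)

lemma cochains_add: "\<lbrakk>c \<in> cochains NM q; d \<in> cochains NM q\<rbrakk> \<Longrightarrow> (\<lambda>s. c s + d s) \<in> cochains NM q"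
  unfolding cochains_def by (auto, (metis add_0)+)

lemma cochains_diff: "\<lbrakk>c \<in> cochains NM q; d \<in> cochains NM q\<rbrakk> \<Longrightarrow> (\<lambda>s. c s - d s) \<in> cochains NM q"
  unfolding cochains_def by (auto, (metis diff_0_right)+)

lemma coboundary_add:
  "coboundary N (\<lambda>s. c s + d s) = (\<lambda>s. coboundary N c s + coboundary N d s)"
  by (auto simp: coboundary_cob cob_add)

lemma coboundary_diff:
  "coboundary N (\<lambda>s. c s - d s) = (\<lambda>s. coboundary N c s - coboundary N d s)"
  by (auto simp: coboundary_cob cob_diff)

lemma coboundary_zero [simp]: "coboundary N (\<lambda>s. 0) = (\<lambda>s. 0)"
  by (auto simp: coboundary_cob)

text \<open>A nonzero value at \<open>s\<close> comes from a nonzero value at a facet. If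
  \<open>s\<close> spanned a simplex of the subcomplex, so would this facet, where \<open>c\<close>
  vanishes; the facet is nonempty because \<open>c []\<close> is zero.\<close>

lemma coboundary_cochains:
  assumes "simplicial_pair NM" "c \<in> cochains NM q"
  shows "coboundary (fst NM) c \<in> cochains NM (q + 1)"
  unfolding cochains_def
proof (intro CollectI allI impI)
  fix s
  assume "coboundary (fst NM) c s \<noteq> 0"
  then have s: "set s \<in> fst NM" and "cob c s \<noteq> cob (\<lambda>s. 0) s"
    by (auto simp: coboundary_cob split: if_splits)
  then obtain t where t: "set t \<subseteq> set s" "length s = Suc (length t)" "c t \<noteq> 0"
    using cob_cong[of s c "\<lambda>s. 0"] by blast
  have "set t \<noteq> {}"
    using cochains_Nil[OF assms(2,1)] t(3) by auto
  then have "set s \<notin> snd NM"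
    using cochainsD(3)[OF assms(2) t(3)] t(1) assms(1) abstract_complex_face
    unfolding simplicial_pair_def by metis
  then show "int (length s) = q + 1 + 1 \<and> set s \<in> fst NM \<and> set s \<notin> snd NM"
    using cochainsD(1)[OF assms(2) t(3)] t(2) s by simp
qed

text \<open>The list \<open>[]\<close> is the face of a one-vertex list but spans no simplex, so
  agreement there has to be required separately.\<close>

lemma coboundary_subcomplex:
  assumes "abstract_complex M" "c [] = 0" "d [] = 0" "\<And>s. set s \<in> M \<Longrightarrow> c s = d s" "set s \<in> M"
  shows "cob c s = cob d s"
proof (rule cob_cong)
  fix t assume "set t \<subseteq> set s"
  then show "c t = d t"
    using assms abstract_complex_face[of M "set s" "set t"] by (cases "t = []") auto
qed

lemma coboundary_coboundary:
  assumes "abstract_complex N"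
  shows "coboundary N (coboundary N c) = (\<lambda>s. 0)"
proof
  fix s
  show "coboundary N (coboundary N c) s = 0"
  proof (cases "set s \<in> N")
    case True
    have "cob (coboundary N c) s = cob (cob c) s"
      by (rule coboundary_subcomplex[OF assms])
        (use assms True in \<open>auto simp: coboundary_cob dest: abstract_complex_not_empty\<close>)
    then show ?thesis by (simp add: coboundary_cob cob_cob)
  qed (simp add: coboundary_cob)
qed

lemma cocycles_zero [simp]: "(\<lambda>s. 0) \<in> cocycles NM q"
  by (simp add: cocycles_iff)

lemma cocycles_add: "\<lbrakk>c \<in> cocycles NM q; d \<in> cocycles NM q\<rbrakk> \<Longrightarrow> (\<lambda>s. c s + d s) \<in> cocycles NM q"
  by (simp add: cocycles_iff cochains_add coboundary_add)

lemma cocycles_diff: "\<lbrakk>c \<in> cocycles NM q; d \<in> cocycles NM q\<rbrakk> \<Longrightarrow> (\<lambda>s. c s - d s) \<in> cocycles NM q"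
  by (simp add: cocycles_iff cochains_diff coboundary_diff)

lemma coboundariesI: "b \<in> cochains NM (q - 1) \<Longrightarrow> coboundary (fst NM) b \<in> coboundaries NM q"
  by (simp add: coboundaries_def)

lemma coboundaries_cocycles:
  assumes "simplicial_pair NM" "b \<in> coboundaries NM q"
  shows "b \<in> cocycles NM q"
proof -
  obtain a where "a \<in> cochains NM (q - 1)" "b = coboundary (fst NM) a"
    using assms(2) by (auto simp: coboundaries_def)
  then show ?thesis
    using coboundary_cochains[OF assms(1), of a "q - 1"] assms(1)
    by (simp add: cocycles_iff simplicial_pair_def coboundary_coboundary)
qed

lemma coboundaries_zero [simp]: "(\<lambda>s. 0) \<in> coboundaries NM q"
  using coboundariesI[of "\<lambda>s. 0" NM q] by simp

lemma coboundaries_add: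
  "\<lbrakk>c \<in> coboundaries NM q; d \<in> coboundaries NM q\<rbrakk> \<Longrightarrow> (\<lambda>s. c s + d s) \<in> coboundaries NM q"
  unfolding coboundaries_def
  by (auto simp flip: coboundary_add intro!: imageI cochains_add)

lemma coboundaries_diff:
  "\<lbrakk>c \<in> coboundaries NM q; d \<in> coboundaries NM q\<rbrakk> \<Longrightarrow> (\<lambda>s. c s - d s) \<in> coboundaries NM q"
  unfolding coboundaries_def
  by (auto simp flip: coboundary_diff intro!: imageI cochains_diff)

section \<open>Pullback along simplicial maps and contiguity\<close>

lemma pull_cochains:
  assumes "simplicial_map NM NM' p" "c \<in> cochains NM' q"
  shows "pull_cochain NM p c \<in> cochains NM q"
  using assms by (auto simp: cochains_def pull_cochain_def simplicial_map_def)

lemma pull_coboundary: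
  assumes "simplicial_pair NM" "simplicial_map NM NM' p" "c [] = 0"
  shows "coboundary (fst NM) (pull_cochain NM p c) = pull_cochain NM p (coboundary (fst NM') c)"
proof
  fix s
  show "coboundary (fst NM) (pull_cochain NM p c) s = pull_cochain NM p (coboundary (fst NM') c) s"
  proof (cases "set s \<in> fst NM")
    case True
    have "cob (pull_cochain NM p c) s = cob (\<lambda>t. c (map p t)) s"
      by (rule coboundary_subcomplex[of "fst NM"])
        (use assms True in \<open>auto simp: pull_cochain_def simplicial_pair_def\<close>)
    then show ?thesis
      using True assms by (auto simp: coboundary_cob cob_map pull_cochain_def simplicial_map_def)
  qed (simp add: coboundary_cob pull_cochain_def)
qed

lemma pull_add: "pull_cochain NM p (\<lambda>s. c s + d s) = (\<lambda>s. pull_cochain NM p c s + pull_cochain NM p d s)"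
  by (auto simp: pull_cochain_def)

lemma pull_diff: "pull_cochain NM p (\<lambda>s. c s - d s) = (\<lambda>s. pull_cochain NM p c s - pull_cochain NM p d s)"
  by (auto simp: pull_cochain_def)

lemma pull_zero [simp]: "pull_cochain NM p (\<lambda>s. 0) = (\<lambda>s. 0)"
  by (auto simp: pull_cochain_def)

lemma pull_cocycles:
  assumes "simplicial_pair NM" "simplicial_pair NM'" "simplicial_map NM NM' p" "c \<in> cocycles NM' q"
  shows "pull_cochain NM p c \<in> cocycles NM q"
  using assms pull_coboundary[OF assms(1,3), of c] cochains_Nil[of c NM' q]
  by (auto simp: cocycles_iff pull_cochains)

lemma pull_coboundaries:
  assumes "simplicial_pair NM" "simplicial_pair NM'" "simplicial_map NM NM' p" "b \<in> coboundaries NM' q"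
  shows "pull_cochain NM p b \<in> coboundaries NM q"
proof -
  obtain a where a: "a \<in> cochains NM' (q - 1)" "b = coboundary (fst NM') a"
    using assms(4) by (auto simp: coboundaries_def)
  then have "coboundary (fst NM) (pull_cochain NM p a) = pull_cochain NM p b"
    using pull_coboundary[OF assms(1,3)] cochains_Nil assms(2) by metis
  then show ?thesis
    using coboundariesI[OF pull_cochains[OF assms(3) a(1)]] by simp
qed

lemma pull_pull:
  assumes "simplicial_map NM NM' p"
  shows "pull_cochain NM p (pull_cochain NM' p' c) = pull_cochain NM (p' \<circ> p) c"
  using assms by (auto simp: pull_cochain_def simplicial_map_def)

lemma pull_id: "c \<in> cochains NM q \<Longrightarrow> pull_cochain NM id c = c"
  by (rule ext) (auto simp: pull_cochain_def cochains_def)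

text \<open>The prism truncated to the complex is the cochain homotopy. Contiguity puts every list
  occurring over a simplex into a simplex of the target, and over the subcomplex into the
  subcomplex. So \<open>D\<close> is a relative cochain, and the term with \<open>cob c\<close>
  drops out.\<close>

lemma contiguous_cohomologous:
  assumes "simplicial_pair NM" "simplicial_pair NM'" "contiguous NM NM' p p'" "c \<in> cocycles NM' q"
  shows "(\<lambda>s. pull_cochain NM p' c s - pull_cochain NM p c s) \<in> coboundaries NM q"
proof -
  have c: "c \<in> cochains NM' q" "coboundary (fst NM') c = (\<lambda>s. 0)"
    using assms(4) by (auto simp: cocycles_iff)
  define D where "D = (\<lambda>s. if set s \<in> fst NM then prism p p' s c else 0)"
  have sub: "set t \<in> snd NM'" if "set s \<in> snd NM" "set t \<subseteq> p ` set s \<union> p' ` set s" "t \<noteq> []" for s t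
    using that assms(1-3) abstract_complex_face[of "snd NM'" "p ` set s \<union> p' ` set s" "set t"]
    by (auto simp: simplicial_pair_def contiguous_def)
  have subN: "set t \<in> fst NM'" if "set s \<in> fst NM" "set t \<subseteq> p ` set s \<union> p' ` set s" "t \<noteq> []" for s t
    using that assms(1-3) abstract_complex_face[of "fst NM'" "p ` set s \<union> p' ` set s" "set t"]
    by (auto simp: simplicial_pair_def contiguous_def)
  have D: "D \<in> cochains NM (q - 1)"
    unfolding cochains_def
  proof (intro CollectI allI impI)
    fix s assume "D s \<noteq> 0"
    then have s: "set s \<in> fst NM" "prism p p' s c \<noteq> prism p p' s (\<lambda>t. 0)"
      by (auto simp: D_def prism_zero split: if_splits)
    then obtain t where t: "set t \<subseteq> p ` set s \<union> p' ` set s" "length t = Suc (length s)" "c t \<noteq> 0"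
      using prism_cong[of p s p' c "\<lambda>t. 0"] by blast
    have "set s \<notin> snd NM"
      using sub[of s t] t cochainsD(3)[OF c(1) t(3)] by (cases t) auto
    then show "int (length s) = q - 1 + 1 \<and> set s \<in> fst NM \<and> set s \<notin> snd NM"
      using cochainsD(1)[OF c(1) t(3)] t(2) s by simp
  qed
  have "coboundary (fst NM) D s = pull_cochain NM p' c s - pull_cochain NM p c s" for s
  proof (cases "set s \<in> fst NM")
    case True
    have 1: "cob D s = cob (\<lambda>s. prism p p' s c) s"
      by (rule coboundary_subcomplex[of "fst NM"])
        (use assms True in \<open>auto simp: D_def simplicial_pair_def\<close>)
    have "prism p p' s (cob c) = prism p p' s (\<lambda>t. 0)"
    proof (rule prism_cong)
      fix t assume "set t \<subseteq> p ` set s \<union> p' ` set s" "length t = Suc (length s)"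
      then have "set t \<in> fst NM'"
        using subN[OF True, of t] by (cases "t = []") auto
      then show "cob c t = 0"
        using fun_cong[OF c(2), of t] by (simp add: coboundary_cob)
    qed
    then show ?thesis
      using prism_homotopy[of p p' c s] 1 True by (simp add: coboundary_cob pull_cochain_def prism_zero)
  qed (simp add: coboundary_cob pull_cochain_def)
  then have "coboundary (fst NM) D = (\<lambda>s. pull_cochain NM p' c s - pull_cochain NM p c s)"
    by auto
  then show ?thesis
    using coboundariesI[OF D] by simp
qed

subsection \<open>Cohomology classes\<close>

lemma group_cocycle_group: "comm_group (cocycle_group NM q :: ('v list \<Rightarrow> 'g::ab_group_add) monoid)"
proof (rule comm_groupI)
  fix c :: "'v list \<Rightarrow> 'g"
  assume "c \<in> cocycles NM q"
  then have "(\<lambda>s. 0 - c s) \<in> cocycles NM q"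
    by (intro cocycles_diff) simp_all
  then show "\<exists>d\<in>cocycles NM q. d \<otimes>\<^bsub>cocycle_group NM q\<^esub> c = \<one>\<^bsub>cocycle_group NM q\<^esub>"
    by (intro bexI) (auto simp: cocycle_group_def)
qed (auto simp: cocycle_group_def cochains_add coboundary_add add_ac)

lemma subgroup_coboundaries:
  assumes "simplicial_pair NM"
  shows "subgroup (coboundaries NM q) (cocycle_group NM q)"
proof -
  interpret comm_group "cocycle_group NM q" by (rule group_cocycle_group)
  show ?thesis
  proof (rule subgroupI)
    show "coboundaries NM q \<subseteq> cocycles NM q"
      using coboundaries_cocycles[OF assms] by blast
    show "coboundaries NM q \<noteq> {}"
      using coboundaries_zero[of NM q] by blast
    fix a :: "'a list \<Rightarrow> 'b"
    assume a: "a \<in> coboundaries NM q"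
    have "(\<lambda>s. 0 - a s) \<in> coboundaries NM q"
      using a by (intro coboundaries_diff) simp_all
    moreover have "inv\<^bsub>cocycle_group NM q\<^esub> a = (\<lambda>s. 0 - a s)"
      using a calculation coboundaries_cocycles[OF assms]
      by (intro inv_equality) (auto simp: cocycle_group_def)
    ultimately show "inv\<^bsub>cocycle_group NM q\<^esub> a \<in> coboundaries NM q" by simp
  next
    fix a b :: "'a list \<Rightarrow> 'b"
    assume "a \<in> coboundaries NM q" "b \<in> coboundaries NM q"
    then show "a \<otimes>\<^bsub>cocycle_group NM q\<^esub> b \<in> coboundaries NM q"
      using coboundaries_add[of a NM q b] by (simp add: cocycle_group_def)
  qed
qed

lemma normal_coboundaries:
  assumes "simplicial_pair NM"
  shows "coboundaries NM q \<lhd> cocycle_group NM q"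
  using comm_group.normal_iff_subgroup[OF group_cocycle_group] subgroup_coboundaries[OF assms] by blast

lemma simp_class_eq: "simp_class NM q c = {\<lambda>s. b s + c s | b. b \<in> coboundaries NM q}"
  by (auto simp: simp_class_def r_coset_def cocycle_group_def)

lemma simp_class_eq_iff:
  "simp_class NM q c = simp_class NM q d \<longleftrightarrow> (\<lambda>s. c s - d s) \<in> coboundaries NM q"
proof
  assume "simp_class NM q c = simp_class NM q d"
  moreover have "c \<in> simp_class NM q c"
    unfolding simp_class_eq by (rule CollectI, rule exI[of _ "\<lambda>s. 0"]) simp
  ultimately obtain b where "c = (\<lambda>s. b s + d s)" "b \<in> coboundaries NM q"
    by (auto simp: simp_class_eq)
  then show "(\<lambda>s. c s - d s) \<in> coboundaries NM q" by simp
next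
  assume *: "(\<lambda>s. c s - d s) \<in> coboundaries NM q"
  have "\<exists>b'\<in>coboundaries NM q. (\<lambda>s. b s + c s) = (\<lambda>s. b' s + d s)" if "b \<in> coboundaries NM q" for b
    by (rule bexI[OF _ coboundaries_add[OF that *]]) auto
  moreover have "\<exists>b'\<in>coboundaries NM q. (\<lambda>s. b s + d s) = (\<lambda>s. b' s + c s)" if "b \<in> coboundaries NM q" for b
    by (rule bexI[OF _ coboundaries_diff[OF that *]]) auto
  ultimately show "simp_class NM q c = simp_class NM q d"
    unfolding simp_class_eq by blast
qed

lemma simp_class_self: "c \<in> simp_class NM q c"
  unfolding simp_class_eq by (rule CollectI, rule exI[of _ "\<lambda>s. 0"]) simp

lemma simp_class_memD: "d \<in> simp_class NM q c \<Longrightarrow> simp_class NM q d = simp_class NM q c"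
  by (auto simp: simp_class_eq_iff, auto simp: simp_class_eq)

lemma carrier_simp_cohomology: "carrier (simp_cohomology NM q) = simp_class NM q ` cocycles NM q"
  by (simp add: simp_cohomology_def carrier_FactGroup simp_class_def image_def)

lemma one_simp_cohomology: "\<one>\<^bsub>simp_cohomology NM q\<^esub> = simp_class NM q (\<lambda>s. 0)"
  by (simp add: simp_cohomology_def simp_class_eq)

lemma mult_simp_cohomology:
  assumes "simplicial_pair NM" "c \<in> cocycles NM q" "d \<in> cocycles NM q"
  shows "simp_class NM q c \<otimes>\<^bsub>simp_cohomology NM q\<^esub> simp_class NM q d = simp_class NM q (\<lambda>s. c s + d s)"
  using normal.rcos_sum[OF normal_coboundaries[OF assms(1)] assms(2,3)]
  by (simp add: simp_cohomology_def simp_class_def) (simp add: cocycle_group_def)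

section \<open>Induced and connecting homomorphisms on cohomology classes\<close>

lemma simp_induced_class:
  assumes "simplicial_pair NM" "simplicial_pair NM'" "simplicial_map NM NM' p" "c \<in> cocycles NM' q"
  shows "simp_induced NM q p (simp_class NM' q c) = simp_class NM q (pull_cochain NM p c)"
proof -
  have "simp_class NM q (pull_cochain NM p d) = simp_class NM q (pull_cochain NM p c)"
    if "d \<in> simp_class NM' q c" for d
    using pull_coboundaries[OF assms(1-3) simp_class_memD[OF that, unfolded simp_class_eq_iff]]
    unfolding simp_class_eq_iff pull_diff .
  then have "(\<Union>d\<in>simp_class NM' q c. simp_class NM q (pull_cochain NM p d)) =
      (\<Union>d\<in>simp_class NM' q c. simp_class NM q (pull_cochain NM p c))"
    by (rule SUP_cong[OF refl])
  then show ?thesis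
    unfolding simp_induced_def using simp_class_self[of c NM' q] by (metis UN_constant empty_iff)
qed

text \<open>Extended by zero, \<open>c\<close> is a cochain of the whole complex; on the subcomplex
  its coboundary is the one taken there, which is zero.\<close>

lemma delta_cocycles:
  assumes "simplicial_pair NM" "c \<in> cocycles (snd NM, {}) q"
  shows "coboundary (fst NM) c \<in> cocycles NM (q + 1)"
proof -
  have c: "c \<in> cochains (fst NM, {}) q" "c \<in> cochains (snd NM, {}) q" "coboundary (snd NM) c = (\<lambda>s. 0)"
    using assms by (auto simp: cocycles_iff cochains_def simplicial_pair_def)
  have "coboundary (fst NM) c \<in> cochains (fst NM, {}) (q + 1)"
    using coboundary_cochains[OF _ c(1)] assms(1) by (simp add: simplicial_pair_def)
  moreover have "coboundary (fst NM) c s = 0" if "set s \<in> snd NM" for s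
    using that fun_cong[OF c(3), of s] by (auto simp: coboundary_cob)
  ultimately have "coboundary (fst NM) c \<in> cochains NM (q + 1)"
    by (auto simp: cochains_def)
  then show ?thesis
    using assms(1) by (simp add: cocycles_iff simplicial_pair_def coboundary_coboundary)
qed

text \<open>If \<open>c\<close> is the coboundary of \<open>b\<close> in the subcomplex, it agrees
  there with the coboundary of \<open>b\<close> in the whole complex. Their difference is a relative
  cochain with the same coboundary as \<open>c\<close>.\<close>

lemma delta_coboundaries:
  assumes "simplicial_pair NM" "c \<in> coboundaries (snd NM, {}) q"
  shows "coboundary (fst NM) c \<in> coboundaries NM (q + 1)"
proof -
  obtain b where b: "b \<in> cochains (snd NM, {}) (q - 1)" and c: "c = coboundary (snd NM) b"
    using assms(2) by (auto simp: coboundaries_def)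
  let ?a = "\<lambda>s. c s - coboundary (fst NM) b s"
  have sc: "simplicial_pair (fst NM, {})" "simplicial_pair (snd NM, {})"
    using assms(1) by (auto simp: simplicial_pair_def)
  have "b \<in> cochains (fst NM, {}) (q - 1)"
    using b assms(1) by (auto simp: cochains_def simplicial_pair_def)
  from coboundary_cochains[OF sc(1) this] have 1: "coboundary (fst NM) b \<in> cochains (fst NM, {}) q"
    by simp
  have "c \<in> cochains (snd NM, {}) q"
    using coboundary_cochains[OF sc(2) b] c by simp
  then have "c \<in> cochains (fst NM, {}) q"
    using assms(1) by (auto simp: cochains_def simplicial_pair_def)
  from cochains_diff[OF this 1] have "?a \<in> cochains (fst NM, {}) q" .
  moreover have "?a s = 0" if "set s \<in> snd NM" for s
    using that c assms(1) by (auto simp: coboundary_cob simplicial_pair_def)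
  ultimately have "?a \<in> cochains NM q"
    by (auto simp: cochains_def)
  moreover have "coboundary (fst NM) ?a = coboundary (fst NM) c"
    using assms(1) by (simp add: coboundary_diff coboundary_coboundary simplicial_pair_def)
  ultimately show ?thesis
    using coboundariesI[of ?a NM "q + 1"] by simp
qed

lemma simp_delta_class:
  assumes "simplicial_pair NM" "c \<in> cocycles (snd NM, {}) q"
  shows "simp_delta NM q (simp_class (snd NM, {}) q c) = simp_class NM (q + 1) (coboundary (fst NM) c)"
proof -
  have "simp_class NM (q + 1) (coboundary (fst NM) d) = simp_class NM (q + 1) (coboundary (fst NM) c)"
    if "d \<in> simp_class (snd NM, {}) q c" for d
    using delta_coboundaries[OF assms(1) simp_class_memD[OF that, unfolded simp_class_eq_iff]]
    unfolding simp_class_eq_iff coboundary_diff .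
  then have "(\<Union>d\<in>simp_class (snd NM, {}) q c. simp_class NM (q + 1) (coboundary (fst NM) d)) =
      (\<Union>d\<in>simp_class (snd NM, {}) q c. simp_class NM (q + 1) (coboundary (fst NM) c))"
    by (rule SUP_cong[OF refl])
  then show ?thesis
    unfolding simp_delta_def using simp_class_self[of c "(snd NM, {})" q] by (metis UN_constant empty_iff)
qed


section \<open>Cech classes carried by families of sets\<close>

text \<open>The nerve of an indexed family: vertices of a complex remain distinct even where their
  sets coincide. For \<open>W = id\<close> it is the nerve of a cover.\<close>

definition inerve :: "'i set \<Rightarrow> ('i \<Rightarrow> 'a set) \<Rightarrow> 'a set \<Rightarrow> 'i set set" where
  "inerve I W S = {\<sigma>. \<sigma> \<subseteq> I \<and> finite \<sigma> \<and> \<sigma> \<noteq> {} \<and> (\<Inter>i\<in>\<sigma>. W i) \<inter> S \<noteq> {}}"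

definition subordinate :: "'a set set \<Rightarrow> 'i set \<Rightarrow> ('i \<Rightarrow> 'a set) \<Rightarrow> ('a set \<Rightarrow> 'i) \<Rightarrow> bool" where
  "subordinate \<beta> I W p \<longleftrightarrow> (\<forall>V\<in>\<beta>. p V \<in> I \<and> V \<subseteq> W (p V))"

text \<open>The members of \<beta> may be sets of a space larger than that of \<open>P\<close>. Only
  those that meet the space of \<open>P\<close> are vertices of the nerve.\<close>

definition trace_subordinate ::
    "'a spair \<Rightarrow> 'a set set \<Rightarrow> 'i set \<Rightarrow> ('i \<Rightarrow> 'a set) \<Rightarrow> ('a set \<Rightarrow> 'i) \<Rightarrow> bool" where
  "trace_subordinate P \<beta> I W p \<longleftrightarrow>
     (\<forall>V\<in>\<beta>. V \<inter> topspace (fst P) \<noteq> {} \<longrightarrow> p V \<in> I \<and> V \<inter> topspace (fst P) \<subseteq> W (p V))"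

text \<open>What it takes to pull a cochain of \<open>NM\<close> back to the nerve of a cover: the
  sets \<open>W i\<close> are refined by an open cover, and \<open>NM\<close> contains their nerve,
  possibly properly. This fits both a cover with its nerve and the vertices of a polyhedron with the
  preimages of their open stars.\<close>

definition carried ::
    "'a spair \<Rightarrow> 'i set \<Rightarrow> ('i \<Rightarrow> 'a set) \<Rightarrow> 'i set set \<times> 'i set set \<Rightarrow> bool" where
  "carried P I W NM \<longleftrightarrow> snd P \<subseteq> topspace (fst P) \<and> simplicial_pair NM \<and>
     (\<exists>\<beta> p. open_cover (fst P) \<beta> \<and> subordinate \<beta> I W p) \<and>
     inerve I W (topspace (fst P)) \<subseteq> fst NM \<and> inerve I W (snd P) \<subseteq> snd NM"

lemma nerve_eq_inerve: "nerve \<alpha> S = inerve \<alpha> id S"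
  by (simp add: nerve_def inerve_def)

lemma inerve_mono: "S \<subseteq> S' \<Longrightarrow> inerve I W S \<subseteq> inerve I W S'"
  by (auto simp: inerve_def)

lemma inerve_empty [simp]: "inerve I W {} = {}"
  by (simp add: inerve_def)

lemma abstract_complex_inerve: "abstract_complex (inerve I W S)"
  unfolding abstract_complex_def inerve_def by (auto intro: finite_subset) blast

lemma simplicial_pair_nerve_pair:
  "snd P \<subseteq> topspace (fst P) \<Longrightarrow> simplicial_pair (nerve_pair P \<alpha>)"
  by (simp add: simplicial_pair_def nerve_pair_def nerve_eq_inerve abstract_complex_inerve inerve_mono)

lemma inerve_Un_image:
  assumes "\<sigma> \<in> inerve I W S"
    and "\<And>i. \<lbrakk>i \<in> I; W i \<inter> S \<noteq> {}\<rbrakk> \<Longrightarrow> p i \<in> J \<and> W i \<inter> S \<subseteq> W' (p i)"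
    and "\<And>i. \<lbrakk>i \<in> I; W i \<inter> S \<noteq> {}\<rbrakk> \<Longrightarrow> p' i \<in> J \<and> W i \<inter> S \<subseteq> W' (p' i)"
  shows "p ` \<sigma> \<union> p' ` \<sigma> \<in> inerve J W' S"
proof -
  obtain z where z: "z \<in> S" "\<And>i. i \<in> \<sigma> \<Longrightarrow> i \<in> I \<and> z \<in> W i" and \<sigma>: "finite \<sigma>" "\<sigma> \<noteq> {}"
    using assms(1) unfolding inerve_def by blast
  have "p i \<in> J \<and> z \<in> W' (p i) \<and> p' i \<in> J \<and> z \<in> W' (p' i)" if "i \<in> \<sigma>" for i
    using z(2)[OF that] z(1) assms(2,3)[of i] by blast
  then show ?thesis
    using \<sigma> z(1) unfolding inerve_def by auto
qed

lemma trace_subordinate_sub: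
  assumes "trace_subordinate P \<beta> I W p" "S \<subseteq> topspace (fst P)" "V \<in> \<beta>" "id V \<inter> S \<noteq> {}"
  shows "p V \<in> I \<and> id V \<inter> S \<subseteq> W (p V)"
  using assms unfolding trace_subordinate_def id_def by blast

text \<open>A point common to the members of a simplex lies in all sets chosen by \<open>p\<close>
  and in all sets chosen by \<open>p'\<close>, so together these span a simplex.\<close>

lemma trace_subordinate_contiguous:
  assumes "carried P I W NM" "trace_subordinate P \<beta> I W p" "trace_subordinate P \<beta> I W p'"
  shows "contiguous (nerve_pair P \<beta>) NM p p'"
proof -
  have "p ` \<sigma> \<union> p' ` \<sigma> \<in> inerve I W S" if "\<sigma> \<in> inerve \<beta> id S" "S \<subseteq> topspace (fst P)" for \<sigma> S
    by (rule inerve_Un_image[OF that(1)]) (rule trace_subordinate_sub[OF _ that(2)]; use assms in blast)+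
  then show ?thesis
    using assms(1) unfolding contiguous_def nerve_pair_def nerve_eq_inerve carried_def fst_conv snd_conv by blast
qed

lemma carriedD:
  assumes "carried P I W NM"
  shows "snd P \<subseteq> topspace (fst P)" "simplicial_pair NM" "simplicial_pair (nerve_pair P \<beta>)"
  using assms simplicial_pair_nerve_pair unfolding carried_def by blast+

lemma subordinate_trace: "subordinate \<beta> I W p \<Longrightarrow> trace_subordinate P \<beta> I W p"
  unfolding subordinate_def trace_subordinate_def by blast

lemma trace_subordinate_simplicial:
  assumes "carried P I W NM" "trace_subordinate P \<beta> I W p"
  shows "simplicial_map (nerve_pair P \<beta>) NM p"
  by (rule contiguous_imp_simplicial(1)[OF carriedD(3,2)[OF assms(1)] trace_subordinate_contiguous[OF assms assms(2)]])

lemma subordinate_comp: "subordinate \<gamma> \<beta> id r \<Longrightarrow> subordinate \<beta> I W p \<Longrightarrow> subordinate \<gamma> I W (p \<circ> r)"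
  by (fastforce simp: subordinate_def)

lemma trace_subordinate_comp:
  "trace_subordinate P \<gamma> \<beta> id r \<Longrightarrow> trace_subordinate P \<beta> I W p \<Longrightarrow> trace_subordinate P \<gamma> I W (p \<circ> r)"
  by (fastforce simp: trace_subordinate_def)

lemma projection_id: "projection id \<gamma> \<beta> p \<longleftrightarrow> subordinate \<gamma> \<beta> id p"
  by (simp add: projection_def subordinate_def)

lemma subordinate_id: "subordinate \<beta> \<beta> id id"
  by (simp add: subordinate_def)

section \<open>Refinement of covers and extension from a closed subspace\<close>

lemma common_refinement:
  assumes "open_cover T \<alpha>" "open_cover T \<beta>"
  obtains \<gamma> r r' where "open_cover T \<gamma>" "subordinate \<gamma> \<alpha> id r" "subordinate \<gamma> \<beta> id r'"
proof -
  define \<gamma> where "\<gamma> = {U \<inter> V | U V. U \<in> \<alpha> \<and> V \<in> \<beta>}"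
  have "\<forall>G. \<exists>U V. G \<in> \<gamma> \<longrightarrow> U \<in> \<alpha> \<and> V \<in> \<beta> \<and> G = U \<inter> V"
    by (auto simp: \<gamma>_def)
  then obtain r r' where r: "\<And>G. G \<in> \<gamma> \<Longrightarrow> r G \<in> \<alpha> \<and> r' G \<in> \<beta> \<and> G = r G \<inter> r' G"
    by metis
  have "\<Union>\<gamma> = \<Union>\<alpha> \<inter> \<Union>\<beta>"
    by (auto simp: \<gamma>_def)
  then have "open_cover T \<gamma>"
    using assms by (auto simp: open_cover_def \<gamma>_def)
  then show ?thesis
    using r by (intro that[of \<gamma> r r']) (auto simp: subordinate_def)
qed

text \<open>Extend each member of \<open>\<gamma>\<^sub>0\<close> to an open set of
  \<open>T\<close>, intersect with the members of \<alpha>, and add the sets \<open>U - A\<close>.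
  The latter are open because \<open>A\<close> is closed, and they have no trace on
  \<open>A\<close>.\<close>

lemma open_cover_trace:
  assumes "closedin T A" "open_cover (subtopology T A) \<gamma>\<^sub>0" "open_cover T \<alpha>"
  obtains \<gamma> r \<pi> where "open_cover T \<gamma>" "subordinate \<gamma> \<alpha> id r"
    "\<And>V. \<lbrakk>V \<in> \<gamma>; V \<inter> A \<noteq> {}\<rbrakk> \<Longrightarrow> \<pi> V \<in> \<gamma>\<^sub>0 \<and> V \<inter> A \<subseteq> \<pi> V"
proof -
  have "\<forall>V\<in>\<gamma>\<^sub>0. \<exists>E. openin T E \<and> V = E \<inter> A"
    using assms(2) by (auto simp: open_cover_def openin_subtopology)
  then obtain E where E: "\<And>V. V \<in> \<gamma>\<^sub>0 \<Longrightarrow> openin T (E V) \<and> V = E V \<inter> A"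
    by metis
  define \<gamma> where "\<gamma> = {U \<inter> E V | U V. U \<in> \<alpha> \<and> V \<in> \<gamma>\<^sub>0} \<union> {U - A | U. U \<in> \<alpha>}"
  have A: "A \<subseteq> topspace T"
    using assms(1) by (rule closedin_subset)
  have op: "openin T G" if "G \<in> \<gamma>" for G
    using that assms(1,3) E by (auto simp: \<gamma>_def open_cover_def openin_diff)
  have "z \<in> \<Union>\<gamma>" if z: "z \<in> topspace T" for z
  proof -
    obtain U where U: "U \<in> \<alpha>" "z \<in> U"
      using z assms(3) by (auto simp: open_cover_def)
    show ?thesis
    proof (cases "z \<in> A")
      case True
      then have "z \<in> \<Union>\<gamma>\<^sub>0"
        using assms(2) z unfolding open_cover_def by simp
      then obtain V where "V \<in> \<gamma>\<^sub>0" "z \<in> V"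
        by blast
      then show ?thesis
        using U E[of V] by (auto simp: \<gamma>_def)
    next
      case False
      then have "z \<in> U - A" "U - A \<in> \<gamma>"
        using U by (auto simp: \<gamma>_def)
      then show ?thesis by blast
    qed
  qed
  then have cov: "open_cover T \<gamma>"
    using op openin_subset[of T] unfolding open_cover_def by blast
  have "\<forall>G. \<exists>U. G \<in> \<gamma> \<longrightarrow> U \<in> \<alpha> \<and> G \<subseteq> U"
    by (auto simp: \<gamma>_def)
  then obtain r where r: "\<And>G. G \<in> \<gamma> \<Longrightarrow> r G \<in> \<alpha> \<and> G \<subseteq> r G"
    by metis
  have "\<forall>G. \<exists>V. G \<in> \<gamma> \<and> G \<inter> A \<noteq> {} \<longrightarrow> V \<in> \<gamma>\<^sub>0 \<and> G \<inter> A \<subseteq> V"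
    unfolding \<gamma>_def using E by blast
  then obtain \<pi> where "\<And>G. \<lbrakk>G \<in> \<gamma>; G \<inter> A \<noteq> {}\<rbrakk> \<Longrightarrow> \<pi> G \<in> \<gamma>\<^sub>0 \<and> G \<inter> A \<subseteq> \<pi> G"
    by metis
  then show ?thesis
    using cov r by (intro that[of \<gamma> r \<pi>]) (auto simp: subordinate_def)
qed

lemma pull_refines_cohomologous:
  assumes "carried P I W NM" "c \<in> cocycles NM q" "trace_subordinate P \<beta> I W p" "trace_subordinate P \<beta> I W p'"
  shows "(\<lambda>s. pull_cochain (nerve_pair P \<beta>) p c s - pull_cochain (nerve_pair P \<beta>) p' c s)
    \<in> coboundaries (nerve_pair P \<beta>) q"
  by (rule contiguous_cohomologous[OF carriedD(3,2)[OF assms(1)] trace_subordinate_contiguous[OF assms(1,4,3)] assms(2)])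

lemma pull_refines_cocycles:
  assumes "carried P I W NM" "c \<in> cocycles NM q" "trace_subordinate P \<beta> I W p"
  shows "pull_cochain (nerve_pair P \<beta>) p c \<in> cocycles (nerve_pair P \<beta>) q"
  by (rule pull_cocycles[OF carriedD(3,2)[OF assms(1)] trace_subordinate_simplicial[OF assms(1,3)] assms(2)])

lemma carried_nerve_pair:
  assumes "snd P \<subseteq> topspace (fst P)" "open_cover (fst P) \<alpha>"
  shows "carried P \<alpha> id (nerve_pair P \<alpha>)"
  using assms simplicial_pair_nerve_pair[OF assms(1)] subordinate_id[of \<alpha>]
  by (auto simp: carried_def nerve_pair_def nerve_eq_inerve)

lemma cohomologous_trans:
  assumes "(\<lambda>s. c s - d s) \<in> coboundaries NM q" "(\<lambda>s. d s - e s) \<in> coboundaries NM q"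
  shows "(\<lambda>s. c s - e s) \<in> coboundaries NM q"
  using assms simp_class_eq_iff by metis

lemma cohomologous_sym:
  assumes "(\<lambda>s. c s - d s) \<in> coboundaries NM q"
  shows "(\<lambda>s. d s - c s) \<in> coboundaries NM q"
  using assms simp_class_eq_iff by metis

text \<open>The relation over \<gamma> is pulled back along \<open>r\<close>; the projections
  \<open>p \<circ> r\<close> and \<open>p' \<circ> r\<close> obtained in this way are then replaced
  by the contiguous ones \<open>t\<close> and \<open>t'\<close>. Only the trace of \<delta> on the
  space matters, so \<delta> may cover a larger space.\<close>

lemma cohomologous_refine:
  assumes "carried P I W NM" "c \<in> cocycles NM q" "carried P J W' NM'" "c' \<in> cocycles NM' q"
    and "trace_subordinate P \<gamma> I W p" "trace_subordinate P \<gamma> J W' p'"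
    and "(\<lambda>s. pull_cochain (nerve_pair P \<gamma>) p c s - pull_cochain (nerve_pair P \<gamma>) p' c' s)
      \<in> coboundaries (nerve_pair P \<gamma>) q"
    and \<gamma>: "open_cover (fst P) \<gamma>" and r: "trace_subordinate P \<delta> \<gamma> id r"
    and "trace_subordinate P \<delta> I W t" "trace_subordinate P \<delta> J W' t'"
  shows "(\<lambda>s. pull_cochain (nerve_pair P \<delta>) t c s - pull_cochain (nerve_pair P \<delta>) t' c' s)
      \<in> coboundaries (nerve_pair P \<delta>) q"
proof -
  let ?N = "nerve_pair P \<delta>" and ?M = "nerve_pair P \<gamma>"
  have sub: "snd P \<subseteq> topspace (fst P)"
    using assms(1) by (simp add: carried_def)
  have sm: "simplicial_map ?N ?M r"
    using trace_subordinate_simplicial[OF carried_nerve_pair[OF sub \<gamma>] r] .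
  have "(\<lambda>s. pull_cochain ?N (p \<circ> r) c s - pull_cochain ?N (p' \<circ> r) c' s) \<in> coboundaries ?N q"
    using pull_coboundaries[OF simplicial_pair_nerve_pair[OF sub] simplicial_pair_nerve_pair[OF sub] sm assms(7)]
    unfolding pull_diff pull_pull[OF sm] .
  moreover have "(\<lambda>s. pull_cochain ?N t c s - pull_cochain ?N (p \<circ> r) c s) \<in> coboundaries ?N q"
    using assms by (intro pull_refines_cohomologous[of _ I W NM]) (auto intro: trace_subordinate_comp)
  moreover have "(\<lambda>s. pull_cochain ?N (p' \<circ> r) c' s - pull_cochain ?N t' c' s) \<in> coboundaries ?N q"
    using assms by (intro pull_refines_cohomologous[of _ J W' NM']) (auto intro: trace_subordinate_comp)
  ultimately show ?thesis
    using cohomologous_trans by blast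
qed

section \<open>The equivalence relation of the direct limit and classes pulled back from a
  complex\<close>

lemma cech_reps_class:
  "(\<alpha>, x) \<in> cech_reps q P \<longleftrightarrow>
     open_cover (fst P) \<alpha> \<and> (\<exists>c\<in>cocycles (nerve_pair P \<alpha>) q. x = simp_class (nerve_pair P \<alpha>) q c)"
  by (auto simp: cech_reps_def carrier_simp_cohomology)

lemma cech_rel_class:
  assumes "snd P \<subseteq> topspace (fst P)" "open_cover (fst P) \<alpha>" "open_cover (fst P) \<beta>"
    and "c \<in> cocycles (nerve_pair P \<alpha>) q" "d \<in> cocycles (nerve_pair P \<beta>) q"
  shows "((\<alpha>, simp_class (nerve_pair P \<alpha>) q c), (\<beta>, simp_class (nerve_pair P \<beta>) q d)) \<in> cech_rel q P \<longleftrightarrow>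
    (\<exists>\<gamma> p p'. open_cover (fst P) \<gamma> \<and> subordinate \<gamma> \<alpha> id p \<and> subordinate \<gamma> \<beta> id p' \<and>
      (\<lambda>s. pull_cochain (nerve_pair P \<gamma>) p c s - pull_cochain (nerve_pair P \<gamma>) p' d s)
        \<in> coboundaries (nerve_pair P \<gamma>) q)"
proof -
  have "simp_induced (nerve_pair P \<gamma>) q p (simp_class (nerve_pair P \<alpha>) q c) =
      simp_class (nerve_pair P \<gamma>) q (pull_cochain (nerve_pair P \<gamma>) p c)"
    if "subordinate \<gamma> \<alpha> id p" "open_cover (fst P) \<alpha>" "c \<in> cocycles (nerve_pair P \<alpha>) q" for \<alpha> \<gamma> p c
    by (rule simp_induced_class[OF _ _ trace_subordinate_simplicial[OF carried_nerve_pair[OF assms(1) that(2)]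
          subordinate_trace[OF that(1)]] that(3)]) (rule simplicial_pair_nerve_pair[OF assms(1)])+
  note ind = this
  have "(\<alpha>, simp_class (nerve_pair P \<alpha>) q c) \<in> cech_reps q P" "(\<beta>, simp_class (nerve_pair P \<beta>) q d) \<in> cech_reps q P"
    using assms cech_reps_class by blast+
  moreover have "simp_induced (nerve_pair P \<gamma>) q p (simp_class (nerve_pair P \<alpha>) q c) =
        simp_induced (nerve_pair P \<gamma>) q p' (simp_class (nerve_pair P \<beta>) q d) \<longleftrightarrow>
      (\<lambda>s. pull_cochain (nerve_pair P \<gamma>) p c s - pull_cochain (nerve_pair P \<gamma>) p' d s)
        \<in> coboundaries (nerve_pair P \<gamma>) q"
    if "subordinate \<gamma> \<alpha> id p" "subordinate \<gamma> \<beta> id p'" for \<gamma> p p'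
    using ind[OF that(1) assms(2,4)] ind[OF that(2) assms(3,5)] by (simp add: simp_class_eq_iff)
  ultimately show ?thesis
    unfolding cech_rel_def projection_id by blast
qed

lemma equiv_cech_rel:
  assumes "snd P \<subseteq> topspace (fst P)"
  shows "equiv (cech_reps q P :: ('a set set \<times> ('a set list \<Rightarrow> 'g::ab_group_add) set) set) (cech_rel q P)"
    (is "equiv ?A ?R")
proof (rule equivI)
  show "?R \<subseteq> ?A \<times> ?A"
    by (auto simp: cech_rel_def)
  show "sym ?R"
    by (rule symI, clarify) (unfold cech_rel_def, clarify, metis)
  show "refl_on ?A ?R"
  proof (rule refl_onI, clarify)
    fix \<alpha> :: "'a set set" and x :: "('a set list \<Rightarrow> 'g) set"
    assume x: "(\<alpha>, x) \<in> cech_reps q P"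
    then have "open_cover (fst P) \<alpha>"
      by (simp add: cech_reps_def)
    with x show "((\<alpha>, x), (\<alpha>, x)) \<in> cech_rel q P"
      using subordinate_id[of \<alpha>] unfolding cech_rel_def projection_id by blast
  qed
  show "trans ?R"
  proof (rule transI, clarify)
    fix \<alpha> \<beta> \<delta> :: "'a set set" and x y z :: "('a set list \<Rightarrow> 'g) set"
    assume xy: "((\<alpha>, x), (\<beta>, y)) \<in> cech_rel q P" and yz: "((\<beta>, y), (\<delta>, z)) \<in> cech_rel q P"
    then have "(\<alpha>, x) \<in> cech_reps q P" "(\<beta>, y) \<in> cech_reps q P" "(\<delta>, z) \<in> cech_reps q P"
      by (auto simp: cech_rel_def)
    then obtain c d e where cov: "open_cover (fst P) \<alpha>" "open_cover (fst P) \<beta>" "open_cover (fst P) \<delta>"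
      and c: "c \<in> cocycles (nerve_pair P \<alpha>) q" "x = simp_class (nerve_pair P \<alpha>) q c"
      and d: "d \<in> cocycles (nerve_pair P \<beta>) q" "y = simp_class (nerve_pair P \<beta>) q d"
      and e: "e \<in> cocycles (nerve_pair P \<delta>) q" "z = simp_class (nerve_pair P \<delta>) q e"
      by (auto simp: cech_reps_class)
    note car = carried_nerve_pair[OF assms]
    obtain \<gamma> p p' where \<gamma>: "open_cover (fst P) \<gamma>" "subordinate \<gamma> \<alpha> id p" "subordinate \<gamma> \<beta> id p'"
      "(\<lambda>s. pull_cochain (nerve_pair P \<gamma>) p c s - pull_cochain (nerve_pair P \<gamma>) p' d s)
        \<in> coboundaries (nerve_pair P \<gamma>) q"
      using xy cech_rel_class[OF assms cov(1,2) c(1) d(1)] c d by auto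
    obtain \<gamma>' s s' where \<gamma>': "open_cover (fst P) \<gamma>'" "subordinate \<gamma>' \<beta> id s" "subordinate \<gamma>' \<delta> id s'"
      "(\<lambda>t. pull_cochain (nerve_pair P \<gamma>') s d t - pull_cochain (nerve_pair P \<gamma>') s' e t)
        \<in> coboundaries (nerve_pair P \<gamma>') q"
      using yz cech_rel_class[OF assms cov(2,3) d(1) e(1)] d e by auto
    obtain \<epsilon> r r' where \<epsilon>: "open_cover (fst P) \<epsilon>" "subordinate \<epsilon> \<gamma> id r" "subordinate \<epsilon> \<gamma>' id r'"
      using common_refinement[OF \<gamma>(1) \<gamma>'(1)] .
    note ref = subordinate_comp[OF \<epsilon>(2) \<gamma>(2)] subordinate_comp[OF \<epsilon>(2) \<gamma>(3)] subordinate_comp[OF \<epsilon>(3) \<gamma>'(3)]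
    have "(\<lambda>t. pull_cochain (nerve_pair P \<epsilon>) (p \<circ> r) c t - pull_cochain (nerve_pair P \<epsilon>) (p' \<circ> r) d t)
        \<in> coboundaries (nerve_pair P \<epsilon>) q"
      using \<gamma>(2,3) \<epsilon>(2) ref
      by (intro cohomologous_refine[OF car[OF cov(1)] c(1) car[OF cov(2)] d(1) _ _ \<gamma>(4,1)] subordinate_trace)
    moreover have "(\<lambda>t. pull_cochain (nerve_pair P \<epsilon>) (s \<circ> r') d t - pull_cochain (nerve_pair P \<epsilon>) (s' \<circ> r') e t)
        \<in> coboundaries (nerve_pair P \<epsilon>) q"
      using \<gamma>'(2,3) \<epsilon>(3) subordinate_comp[OF \<epsilon>(3) \<gamma>'(2)] ref
      by (intro cohomologous_refine[OF car[OF cov(2)] d(1) car[OF cov(3)] e(1) _ _ \<gamma>'(4,1)] subordinate_trace)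
    \<comment> \<open>The two routes from \<epsilon> to \<beta> are different projections; by
      contiguity the pullbacks of \<open>d\<close> are cohomologous.\<close>
    moreover have "(\<lambda>t. pull_cochain (nerve_pair P \<epsilon>) (p' \<circ> r) d t - pull_cochain (nerve_pair P \<epsilon>) (s \<circ> r') d t)
        \<in> coboundaries (nerve_pair P \<epsilon>) q"
      using ref(2) subordinate_comp[OF \<epsilon>(3) \<gamma>'(2)]
      by (intro pull_refines_cohomologous[OF car[OF cov(2)] d(1)] subordinate_trace)
    ultimately have "(\<lambda>t. pull_cochain (nerve_pair P \<epsilon>) (p \<circ> r) c t - pull_cochain (nerve_pair P \<epsilon>) (s' \<circ> r') e t)
        \<in> coboundaries (nerve_pair P \<epsilon>) q"
      using cohomologous_trans by blast
    then show "((\<alpha>, x), (\<delta>, z)) \<in> cech_rel q P"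
      using cech_rel_class[OF assms cov(1,3) c(1) e(1)] c e \<epsilon>(1) ref by auto
  qed
qed

text \<open>The classes in the union coincide if \<open>c\<close> is a cocycle of a complex carrying the family.\<close>

definition cech_pull ::
    "int \<Rightarrow> 'a spair \<Rightarrow> 'i set \<Rightarrow> ('i \<Rightarrow> 'a set) \<Rightarrow> ('i list \<Rightarrow> 'g::ab_group_add) \<Rightarrow> ('a, 'g) cech_class" where
  "cech_pull q P I W c =
     \<Union>{cech_rel q P `` {(\<beta>, simp_class (nerve_pair P \<beta>) q (pull_cochain (nerve_pair P \<beta>) p c))}
       | \<beta> p. open_cover (fst P) \<beta> \<and> subordinate \<beta> I W p}"

text \<open>The covers \<beta> and \<beta>' only name the classes: a cover witnessing the right-hand
  side can be refined below both, and there the projections through \<beta> and \<beta>' are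
  contiguous to \<open>t\<close> and \<open>t'\<close>.\<close>

lemma cech_rel_pull:
  assumes "carried P I W NM" "c \<in> cocycles NM q" "carried P J W' NM'" "c' \<in> cocycles NM' q"
    and \<beta>: "open_cover (fst P) \<beta>" "subordinate \<beta> I W p" and \<beta>': "open_cover (fst P) \<beta>'" "subordinate \<beta>' J W' p'"
  shows "((\<beta>, simp_class (nerve_pair P \<beta>) q (pull_cochain (nerve_pair P \<beta>) p c)),
      (\<beta>', simp_class (nerve_pair P \<beta>') q (pull_cochain (nerve_pair P \<beta>') p' c'))) \<in> cech_rel q P \<longleftrightarrow>
    (\<exists>\<gamma> t t'. open_cover (fst P) \<gamma> \<and> subordinate \<gamma> I W t \<and> subordinate \<gamma> J W' t' \<and>
      (\<lambda>s. pull_cochain (nerve_pair P \<gamma>) t c s - pull_cochain (nerve_pair P \<gamma>) t' c' s)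
        \<in> coboundaries (nerve_pair P \<gamma>) q)" (is "?l \<longleftrightarrow> ?r")
proof -
  have sub: "snd P \<subseteq> topspace (fst P)"
    using assms(1) by (simp add: carried_def)
  note rel = cech_rel_class[OF sub \<beta>(1) \<beta>'(1) pull_refines_cocycles[OF assms(1,2) subordinate_trace[OF \<beta>(2)]]
      pull_refines_cocycles[OF assms(3,4) subordinate_trace[OF \<beta>'(2)]]]
  note car = carried_nerve_pair[OF sub]
  have pp: "pull_cochain (nerve_pair P \<gamma>) r (pull_cochain (nerve_pair P \<beta>) p d) =
      pull_cochain (nerve_pair P \<gamma>) (p \<circ> r) d" if "subordinate \<gamma> \<beta> id r" "open_cover (fst P) \<beta>"
    for \<gamma> \<beta> r d and p :: "'a set \<Rightarrow> 'i"
    using pull_pull[OF trace_subordinate_simplicial[OF car[OF that(2)] subordinate_trace[OF that(1)]]] .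
  have pp': "pull_cochain (nerve_pair P \<gamma>) r (pull_cochain (nerve_pair P \<beta>) p d) =
      pull_cochain (nerve_pair P \<gamma>) (p \<circ> r) d" if "subordinate \<gamma> \<beta> id r" "open_cover (fst P) \<beta>"
    for \<gamma> \<beta> r d and p :: "'a set \<Rightarrow> 'k"
    using pull_pull[OF trace_subordinate_simplicial[OF car[OF that(2)] subordinate_trace[OF that(1)]]] .
  show ?thesis
  proof
    assume ?l
    then obtain \<gamma> r r' where \<gamma>: "open_cover (fst P) \<gamma>" "subordinate \<gamma> \<beta> id r" "subordinate \<gamma> \<beta>' id r'"
      "(\<lambda>s. pull_cochain (nerve_pair P \<gamma>) (p \<circ> r) c s - pull_cochain (nerve_pair P \<gamma>) (p' \<circ> r') c' s)
        \<in> coboundaries (nerve_pair P \<gamma>) q"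
      unfolding rel using \<beta>(1) \<beta>'(1) by (auto simp: pp pp')
    then show ?r
      using subordinate_comp[OF \<gamma>(2) \<beta>(2)] subordinate_comp[OF \<gamma>(3) \<beta>'(2)] by blast
  next
    assume ?r
    then obtain \<gamma> t t' where \<gamma>: "open_cover (fst P) \<gamma>" "subordinate \<gamma> I W t" "subordinate \<gamma> J W' t'"
      "(\<lambda>s. pull_cochain (nerve_pair P \<gamma>) t c s - pull_cochain (nerve_pair P \<gamma>) t' c' s)
        \<in> coboundaries (nerve_pair P \<gamma>) q"
      by blast
    obtain \<delta> r r' where \<delta>: "open_cover (fst P) \<delta>" "subordinate \<delta> \<beta> id r" "subordinate \<delta> \<beta>' id r'"
      using common_refinement[OF \<beta>(1) \<beta>'(1)] .
    obtain \<epsilon> u v where \<epsilon>: "open_cover (fst P) \<epsilon>" "subordinate \<epsilon> \<gamma> id u" "subordinate \<epsilon> \<delta> id v"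
      using common_refinement[OF \<gamma>(1) \<delta>(1)] .
    note ref = subordinate_comp[OF \<epsilon>(3) \<delta>(2)] subordinate_comp[OF \<epsilon>(3) \<delta>(3)]
    have "(\<lambda>s. pull_cochain (nerve_pair P \<epsilon>) (p \<circ> (r \<circ> v)) c s - pull_cochain (nerve_pair P \<epsilon>) (p' \<circ> (r' \<circ> v)) c' s)
        \<in> coboundaries (nerve_pair P \<epsilon>) q"
      by (rule cohomologous_refine[OF assms(1-4) subordinate_trace[OF \<gamma>(2)] subordinate_trace[OF \<gamma>(3)] \<gamma>(4,1)
            subordinate_trace[OF \<epsilon>(2)] subordinate_trace[OF subordinate_comp[OF ref(1) \<beta>(2)]]
            subordinate_trace[OF subordinate_comp[OF ref(2) \<beta>'(2)]]])
    then show ?l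
      unfolding rel using \<epsilon>(1) ref \<beta>(1) \<beta>'(1) by (intro exI[of _ \<epsilon>] exI[of _ "r \<circ> v"] exI[of _ "r' \<circ> v"]) (auto simp: pp pp')
  qed
qed

lemma cech_pull_eq:
  assumes "carried P I W NM" "c \<in> cocycles NM q" "open_cover (fst P) \<beta>" "subordinate \<beta> I W p"
  shows "cech_pull q P I W c =
    cech_rel q P `` {(\<beta>, simp_class (nerve_pair P \<beta>) q (pull_cochain (nerve_pair P \<beta>) p c))}"
proof -
  have sub: "snd P \<subseteq> topspace (fst P)"
    using assms(1) by (simp add: carried_def)
  have "cech_rel q P `` {(\<beta>', simp_class (nerve_pair P \<beta>') q (pull_cochain (nerve_pair P \<beta>') p' c))} =
      cech_rel q P `` {(\<beta>, simp_class (nerve_pair P \<beta>) q (pull_cochain (nerve_pair P \<beta>) p c))}"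
    if "open_cover (fst P) \<beta>'" "subordinate \<beta>' I W p'" for \<beta>' p'
  proof (rule equiv_class_eq[OF equiv_cech_rel[OF sub]])
    obtain \<gamma> r r' where \<gamma>: "open_cover (fst P) \<gamma>" "subordinate \<gamma> \<beta>' id r" "subordinate \<gamma> \<beta> id r'"
      using common_refinement[OF \<open>open_cover (fst P) \<beta>'\<close> assms(3)] .
    note that = \<open>open_cover (fst P) \<beta>'\<close> \<open>subordinate \<beta>' I W p'\<close>
    show "((\<beta>', simp_class (nerve_pair P \<beta>') q (pull_cochain (nerve_pair P \<beta>') p' c)),
        \<beta>, simp_class (nerve_pair P \<beta>) q (pull_cochain (nerve_pair P \<beta>) p c)) \<in> cech_rel q P"
      unfolding cech_rel_pull[OF assms(1,2) assms(1,2) that assms(3,4)]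
      using \<gamma>(1) subordinate_comp[OF \<gamma>(2) that(2)] subordinate_comp[OF \<gamma>(3) assms(4)]
        pull_refines_cohomologous[OF assms(1,2) subordinate_trace subordinate_trace] by blast
  qed
  then have "{cech_rel q P `` {(\<beta>, simp_class (nerve_pair P \<beta>) q (pull_cochain (nerve_pair P \<beta>) p c))}
       | \<beta> p. open_cover (fst P) \<beta> \<and> subordinate \<beta> I W p} =
      {cech_rel q P `` {(\<beta>, simp_class (nerve_pair P \<beta>) q (pull_cochain (nerve_pair P \<beta>) p c))}}"
    using assms(3,4) by (intro equalityI subsetI) (blast, blast)
  then show ?thesis
    unfolding cech_pull_def by simp
qed

text \<open>Equality in the direct limit is equality at one stage. The families may have different
  index types and complexes, which is what lets covers and polyhedra be compared.\<close>

lemma cech_pull_eq_iff: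
  assumes "carried P I W NM" "c \<in> cocycles NM q" "carried P J W' NM'" "c' \<in> cocycles NM' q"
  shows "cech_pull q P I W c = cech_pull q P J W' c' \<longleftrightarrow>
    (\<exists>\<gamma> t t'. open_cover (fst P) \<gamma> \<and> subordinate \<gamma> I W t \<and> subordinate \<gamma> J W' t' \<and>
      (\<lambda>s. pull_cochain (nerve_pair P \<gamma>) t c s - pull_cochain (nerve_pair P \<gamma>) t' c' s)
        \<in> coboundaries (nerve_pair P \<gamma>) q)"
proof -
  obtain \<beta> p \<beta>' p' where \<beta>: "open_cover (fst P) \<beta>" "subordinate \<beta> I W p"
    and \<beta>': "open_cover (fst P) \<beta>'" "subordinate \<beta>' J W' p'"
    using assms(1,3) unfolding carried_def by blast
  have sub: "snd P \<subseteq> topspace (fst P)"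
    using assms(1) by (simp add: carried_def)
  have "(\<beta>, simp_class (nerve_pair P \<beta>) q (pull_cochain (nerve_pair P \<beta>) p c)) \<in> cech_reps q P"
    "(\<beta>', simp_class (nerve_pair P \<beta>') q (pull_cochain (nerve_pair P \<beta>') p' c')) \<in> cech_reps q P"
    using \<beta> \<beta>' pull_refines_cocycles[OF assms(1,2) subordinate_trace] pull_refines_cocycles[OF assms(3,4) subordinate_trace]
    by (auto simp: cech_reps_class)
  from equiv_class_eq_iff[OF equiv_cech_rel[OF sub]] this show ?thesis
    unfolding cech_pull_eq[OF assms(1,2) \<beta>] cech_pull_eq[OF assms(3,4) \<beta>']
      cech_rel_pull[OF assms \<beta> \<beta>', symmetric] by blast
qed

lemma cech_pull_carrier:
  assumes "carried P I W NM" "c \<in> cocycles NM q"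
  shows "cech_pull q P I W c \<in> carrier (cech_cohomology q P)"
proof -
  obtain \<beta> p where \<beta>: "open_cover (fst P) \<beta>" "subordinate \<beta> I W p"
    using assms(1) unfolding carried_def by blast
  then have "(\<beta>, simp_class (nerve_pair P \<beta>) q (pull_cochain (nerve_pair P \<beta>) p c)) \<in> cech_reps q P"
    using pull_refines_cocycles[OF assms subordinate_trace] by (auto simp: cech_reps_class)
  then show ?thesis
    unfolding cech_pull_eq[OF assms \<beta>] by (simp add: cech_cohomology_def quotientI)
qed

lemma cech_pull_id:
  assumes "snd P \<subseteq> topspace (fst P)" "open_cover (fst P) \<alpha>" "c \<in> cocycles (nerve_pair P \<alpha>) q"
  shows "cech_pull q P \<alpha> id c = cech_rel q P `` {(\<alpha>, simp_class (nerve_pair P \<alpha>) q c)}"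
proof -
  have "pull_cochain (nerve_pair P \<alpha>) id c = c"
    using assms(3) by (intro pull_id) (auto simp: cocycles_iff)
  then show ?thesis
    using cech_pull_eq[OF carried_nerve_pair[OF assms(1,2)] assms(3,2) subordinate_id] by simp
qed

lemma cech_class_memD:
  assumes "snd P \<subseteq> topspace (fst P)" "A \<in> carrier (cech_cohomology q P)" "(\<alpha>, x) \<in> A"
  obtains c where "open_cover (fst P) \<alpha>" "c \<in> cocycles (nerve_pair P \<alpha>) q"
    "x = simp_class (nerve_pair P \<alpha>) q c" "A = cech_pull q P \<alpha> id c"
proof -
  have A: "A \<in> cech_reps q P // cech_rel q P"
    using assms(2) by (simp add: cech_cohomology_def)
  have "(\<alpha>, x) \<in> cech_reps q P"
    using in_quotient_imp_subset[OF equiv_cech_rel[OF assms(1)] A] assms(3) by blast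
  then obtain c where c: "open_cover (fst P) \<alpha>" "c \<in> cocycles (nerve_pair P \<alpha>) q"
    "x = simp_class (nerve_pair P \<alpha>) q c"
    by (auto simp: cech_reps_class)
  have "A = cech_rel q P `` {(\<alpha>, x)}"
    using A assms(3) quotient_eqI[OF equiv_cech_rel[OF assms(1)] A quotientI]
    by (metis (no_types, lifting) Image_singleton_iff equiv_class_eq[OF equiv_cech_rel[OF assms(1)]] quotientE)
  then show ?thesis
    using that[OF c] c cech_pull_id[OF assms(1) c(1,2)] by simp
qed

lemma cech_class_nonempty:
  assumes "snd P \<subseteq> topspace (fst P)" "A \<in> carrier (cech_cohomology q P)"
  obtains \<alpha> x where "(\<alpha>, x) \<in> A"
  using assms in_quotient_imp_non_empty[OF equiv_cech_rel[OF assms(1)]]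
  by (fastforce simp: cech_cohomology_def)

lemma cech_class_cases:
  assumes "snd P \<subseteq> topspace (fst P)" "A \<in> carrier (cech_cohomology q P)"
  obtains \<alpha> c where "open_cover (fst P) \<alpha>" "c \<in> cocycles (nerve_pair P \<alpha>) q"
    "A = cech_pull q P \<alpha> id c"
  using cech_class_nonempty[OF assms] cech_class_memD[OF assms] by metis

lemma open_cover_remove_empty: "open_cover T \<beta> \<Longrightarrow> open_cover T (\<beta> - {{}})"
  by (auto simp: open_cover_def)

text \<open>A cover subordinate to the first family becomes subordinate to the second when its
  projection is composed with \<open>r\<close>.\<close>

lemma cech_pull_natural:
  assumes "carried P I W NM" "carried P J W' NM'" "simplicial_map NM NM' r" "c \<in> cocycles NM' q"
    and "\<And>i. \<lbrakk>i \<in> I; W i \<inter> topspace (fst P) \<noteq> {}\<rbrakk> \<Longrightarrow> r i \<in> J \<and> W i \<inter> topspace (fst P) \<subseteq> W' (r i)"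
  shows "cech_pull q P I W (pull_cochain NM r c) = cech_pull q P J W' c"
proof -
  obtain \<beta> p where \<beta>: "open_cover (fst P) \<beta>" "subordinate \<beta> I W p"
    using assms(1) unfolding carried_def by blast
  \<comment> \<open>The condition on \<open>r\<close> concerns the sets \<open>W i\<close> that meet
    the space; those containing a nonempty member of the cover do.\<close>
  let ?\<beta> = "\<beta> - {{}}"
  have 1: "open_cover (fst P) ?\<beta>" "subordinate ?\<beta> I W p"
    using \<beta> open_cover_remove_empty by (auto simp: subordinate_def)
  have 2: "subordinate ?\<beta> J W' (r \<circ> p)"
    unfolding subordinate_def
  proof
    fix V assume V: "V \<in> ?\<beta>"
    then have "V \<noteq> {}" "V \<subseteq> topspace (fst P)" "p V \<in> I" "V \<subseteq> W (p V)"
      using \<beta> by (auto simp: open_cover_def subordinate_def)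
    then show "(r \<circ> p) V \<in> J \<and> V \<subseteq> W' ((r \<circ> p) V)"
      using assms(5)[of "p V"] by auto
  qed
  have c: "pull_cochain NM r c \<in> cocycles NM q"
    by (rule pull_cocycles[OF carriedD(2)[OF assms(1)] carriedD(2)[OF assms(2)] assms(3,4)])
  show ?thesis
    unfolding cech_pull_eq[OF assms(1) c 1] cech_pull_eq[OF assms(2,4) 1(1) 2]
      pull_pull[OF trace_subordinate_simplicial[OF assms(1) subordinate_trace[OF 1(2)]]] ..
qed

text \<open>Pulling back evaluates \<open>c\<close> only at simplices of the indexed nerve, so
  \<open>c\<close> may be changed at those simplices of the complex that the family does not
  realize.\<close>

lemma cech_pull_cong:
  assumes "\<And>s. set s \<in> inerve I W (topspace (fst P)) \<Longrightarrow> c s = c' s"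
  shows "cech_pull q P I W c = cech_pull q P I W c'"
proof -
  have "pull_cochain (nerve_pair P \<beta>) p c = pull_cochain (nerve_pair P \<beta>) p c'" if "subordinate \<beta> I W p" for \<beta> p
  proof
    fix s
    have "set (map p s) \<in> inerve I W (topspace (fst P))" if "set s \<in> nerve \<beta> (topspace (fst P))"
      using inerve_Un_image[of "set s" \<beta> id "topspace (fst P)" p I W p] that \<open>subordinate \<beta> I W p\<close>
      by (auto simp: nerve_eq_inerve subordinate_def)
    then show "pull_cochain (nerve_pair P \<beta>) p c s = pull_cochain (nerve_pair P \<beta>) p c' s"
      using assms by (auto simp: pull_cochain_def nerve_pair_def)
  qed
  then show ?thesis
    unfolding cech_pull_def by (metis (no_types, lifting))
qed

lemma cech_pull_cohomologous:
  assumes "carried P I W NM" "c \<in> cocycles NM q" "c' \<in> cocycles NM q" "(\<lambda>s. c s - c' s) \<in> coboundaries NM q"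
  shows "cech_pull q P I W c = cech_pull q P I W c'"
proof -
  obtain \<beta> p where \<beta>: "open_cover (fst P) \<beta>" "subordinate \<beta> I W p"
    using assms(1) unfolding carried_def by blast
  have "(\<lambda>s. pull_cochain (nerve_pair P \<beta>) p c s - pull_cochain (nerve_pair P \<beta>) p c' s) \<in> coboundaries (nerve_pair P \<beta>) q"
    using pull_coboundaries[OF carriedD(3,2)[OF assms(1)]
      trace_subordinate_simplicial[OF assms(1) subordinate_trace[OF \<beta>(2)]] assms(4)]
    unfolding pull_diff .
  then show ?thesis
    using cech_pull_eq_iff[OF assms(1,2,1,3)] \<beta> by blast
qed


section \<open>The Cech cohomology sequence of a pair\<close>

lemma cech_pull_subordinate:
  assumes "snd P \<subseteq> topspace (fst P)" "open_cover (fst P) \<alpha>" "open_cover (fst P) \<gamma>"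
    and "trace_subordinate P \<gamma> \<alpha> id r" "a \<in> cocycles (nerve_pair P \<alpha>) q"
  shows "cech_pull q P \<gamma> id (pull_cochain (nerve_pair P \<gamma>) r a) = cech_pull q P \<alpha> id a"
    and "pull_cochain (nerve_pair P \<gamma>) r a \<in> cocycles (nerve_pair P \<gamma>) q"
proof -
  note car = carried_nerve_pair[OF assms(1,2)] carried_nerve_pair[OF assms(1,3)]
  show "cech_pull q P \<gamma> id (pull_cochain (nerve_pair P \<gamma>) r a) = cech_pull q P \<alpha> id a"
    using assms(4)
    by (intro cech_pull_natural[OF car(2,1) trace_subordinate_simplicial[OF car(1) assms(4)] assms(5)])
      (auto simp: trace_subordinate_def)
  show "pull_cochain (nerve_pair P \<gamma>) r a \<in> cocycles (nerve_pair P \<gamma>) q"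
    by (rule pull_refines_cocycles[OF car(1) assms(5,4)])
qed

text \<open>With all classes on one cover, sums and group laws reduce to those of cocycles.\<close>

lemma cech_common_cover:
  assumes "snd P \<subseteq> topspace (fst P)" "finite \<A>" "\<A> \<subseteq> carrier (cech_cohomology q P)"
  shows "\<exists>\<gamma>. open_cover (fst P) \<gamma> \<and>
    (\<forall>A\<in>\<A>. \<exists>a. a \<in> cocycles (nerve_pair P \<gamma>) q \<and> A = cech_pull q P \<gamma> id a)"
  using assms(2,3)
proof (induction rule: finite_induct)
  case empty
  have "open_cover (fst P) {topspace (fst P)}"
    by (simp add: open_cover_def)
  then show ?case by blast
next
  case (insert A \<A>)
  then obtain \<gamma> where \<gamma>: "open_cover (fst P) \<gamma>"
    and *: "\<forall>A\<in>\<A>. \<exists>a. a \<in> cocycles (nerve_pair P \<gamma>) q \<and> A = cech_pull q P \<gamma> id a"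
    by blast
  obtain \<alpha> a where a: "open_cover (fst P) \<alpha>" "a \<in> cocycles (nerve_pair P \<alpha>) q" "A = cech_pull q P \<alpha> id a"
    using cech_class_cases[OF assms(1), of A q] insert.prems by blast
  obtain \<delta> r r' where \<delta>: "open_cover (fst P) \<delta>" "subordinate \<delta> \<alpha> id r" "subordinate \<delta> \<gamma> id r'"
    using common_refinement[OF a(1) \<gamma>] .
  have "\<exists>b. b \<in> cocycles (nerve_pair P \<delta>) q \<and> B = cech_pull q P \<delta> id b" if "B \<in> insert A \<A>" for B
  proof (cases "B = A")
    case True
    then show ?thesis
      using cech_pull_subordinate[OF assms(1) a(1) \<delta>(1) subordinate_trace[OF \<delta>(2)] a(2)] a(3) by metis
  next
    case False
    then obtain b where b: "b \<in> cocycles (nerve_pair P \<gamma>) q" "B = cech_pull q P \<gamma> id b"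
      using * \<open>B \<in> insert A \<A>\<close> by auto
    then show ?thesis
      using cech_pull_subordinate[OF assms(1) \<gamma> \<delta>(1) subordinate_trace[OF \<delta>(3)] b(1)] by metis
  qed
  then show ?case
    using \<delta>(1) by blast
qed

lemma cech_pull_zero:
  assumes "carried P I W NM"
  shows "cech_pull q P I W (\<lambda>s. 0) = \<one>\<^bsub>cech_cohomology q P\<^esub>"
proof -
  have sub: "snd P \<subseteq> topspace (fst P)"
    using carriedD(1)[OF assms] .
  let ?T = "{topspace (fst P)}"
  have T: "open_cover (fst P) ?T"
    by (simp add: open_cover_def)
  obtain \<beta> p where \<beta>: "open_cover (fst P) \<beta>" "subordinate \<beta> I W p"
    using assms unfolding carried_def by blast
  have "subordinate \<beta> ?T id (\<lambda>_. topspace (fst P))"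
    using \<beta>(1) by (auto simp: open_cover_def subordinate_def)
  then have "cech_pull q P I W (\<lambda>s. 0) = cech_pull q P ?T id (\<lambda>s. 0)"
    unfolding cech_pull_eq_iff[OF assms cocycles_zero carried_nerve_pair[OF sub T] cocycles_zero]
    using \<beta> by (intro exI[of _ \<beta>] exI[of _ p] exI[of _ "\<lambda>_. topspace (fst P)"]) simp
  also have "\<dots> = \<one>\<^bsub>cech_cohomology q P\<^esub>"
    by (simp add: cech_pull_id[OF sub T] cech_cohomology_def one_simp_cohomology)
  finally show ?thesis .
qed

lemma cech_pull_add_cong:
  assumes "carried P I W NM" "c \<in> cocycles NM q" "d \<in> cocycles NM q"
    and "carried P J W' NM'" "c' \<in> cocycles NM' q" "d' \<in> cocycles NM' q"
    and "cech_pull q P I W c = cech_pull q P J W' c'" "cech_pull q P I W d = cech_pull q P J W' d'"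
  shows "cech_pull q P I W (\<lambda>s. c s + d s) = cech_pull q P J W' (\<lambda>s. c' s + d' s)"
proof -
  obtain \<gamma> t t' where \<gamma>: "open_cover (fst P) \<gamma>" "subordinate \<gamma> I W t" "subordinate \<gamma> J W' t'"
    "(\<lambda>s. pull_cochain (nerve_pair P \<gamma>) t c s - pull_cochain (nerve_pair P \<gamma>) t' c' s)
      \<in> coboundaries (nerve_pair P \<gamma>) q"
    using assms(7) unfolding cech_pull_eq_iff[OF assms(1,2,4,5)] by blast
  obtain \<delta> u u' where \<delta>: "open_cover (fst P) \<delta>" "subordinate \<delta> I W u" "subordinate \<delta> J W' u'"
    "(\<lambda>s. pull_cochain (nerve_pair P \<delta>) u d s - pull_cochain (nerve_pair P \<delta>) u' d' s)
      \<in> coboundaries (nerve_pair P \<delta>) q"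
    using assms(8) unfolding cech_pull_eq_iff[OF assms(1,3,4,6)] by blast
  obtain \<epsilon> r r' where \<epsilon>: "open_cover (fst P) \<epsilon>" "subordinate \<epsilon> \<gamma> id r" "subordinate \<epsilon> \<delta> id r'"
    using common_refinement[OF \<gamma>(1) \<delta>(1)] .
  note ref = subordinate_comp[OF \<epsilon>(2) \<gamma>(2)] subordinate_comp[OF \<epsilon>(2) \<gamma>(3)]
  let ?p = "pull_cochain (nerve_pair P \<epsilon>)"
  have "(\<lambda>s. ?p (t \<circ> r) c s - ?p (t' \<circ> r) c' s) \<in> coboundaries (nerve_pair P \<epsilon>) q"
    using \<gamma>(2,3) \<epsilon>(2) ref
    by (intro cohomologous_refine[OF assms(1,2,4,5) _ _ \<gamma>(4,1)] subordinate_trace)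
  moreover have "(\<lambda>s. ?p (t \<circ> r) d s - ?p (t' \<circ> r) d' s) \<in> coboundaries (nerve_pair P \<epsilon>) q"
    using \<delta>(2,3) \<epsilon>(3) ref
    by (intro cohomologous_refine[OF assms(1,3,4,6) _ _ \<delta>(4,1)] subordinate_trace)
  ultimately have "(\<lambda>s. (?p (t \<circ> r) c s - ?p (t' \<circ> r) c' s) + (?p (t \<circ> r) d s - ?p (t' \<circ> r) d' s))
      \<in> coboundaries (nerve_pair P \<epsilon>) q"
    by (rule coboundaries_add)
  then have "(\<lambda>s. ?p (t \<circ> r) (\<lambda>s. c s + d s) s - ?p (t' \<circ> r) (\<lambda>s. c' s + d' s) s)
      \<in> coboundaries (nerve_pair P \<epsilon>) q"
    by (simp add: pull_add algebra_simps)
  then show ?thesis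
    unfolding cech_pull_eq_iff[OF assms(1) cocycles_add[OF assms(2,3)] assms(4) cocycles_add[OF assms(5,6)]]
    using \<epsilon>(1) ref by blast
qed

text \<open>The union defining the product runs over all representatives and refinements;
  \<open>cech_pull_add_cong\<close> identifies their contributions.\<close>

lemma cech_pull_mult:
  assumes "carried P I W NM" "c \<in> cocycles NM q" "d \<in> cocycles NM q"
  shows "cech_pull q P I W c \<otimes>\<^bsub>cech_cohomology q P\<^esub> cech_pull q P I W d =
    cech_pull q P I W (\<lambda>s. c s + d s)" (is "?A \<otimes>\<^bsub>_\<^esub> ?B = ?C")
proof -
  let ?H = "\<lambda>\<gamma>. simp_cohomology (nerve_pair P \<gamma>) q"
  let ?f = "\<lambda>\<gamma> p p' x y. cech_rel q P `` {(\<gamma>, simp_induced (nerve_pair P \<gamma>) q p x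
      \<otimes>\<^bsub>?H \<gamma>\<^esub> simp_induced (nerve_pair P \<gamma>) q p' y)}"
  have sub: "snd P \<subseteq> topspace (fst P)"
    using carriedD(1)[OF assms(1)] .
  note AB = cech_pull_carrier[OF assms(1,2)] cech_pull_carrier[OF assms(1,3)]
  have *: "?f \<gamma> p p' x y = ?C" if mem: "(\<alpha>, x) \<in> ?A" "(\<beta>, y) \<in> ?B"
    and \<gamma>: "open_cover (fst P) \<gamma>" "subordinate \<gamma> \<alpha> id p" "subordinate \<gamma> \<beta> id p'" for \<alpha> \<beta> \<gamma> x y p p'
  proof -
    obtain a where a: "open_cover (fst P) \<alpha>" "a \<in> cocycles (nerve_pair P \<alpha>) q"
      "x = simp_class (nerve_pair P \<alpha>) q a" "?A = cech_pull q P \<alpha> id a"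
      using cech_class_memD[OF sub AB(1) mem(1)] .
    obtain b where b: "open_cover (fst P) \<beta>" "b \<in> cocycles (nerve_pair P \<beta>) q"
      "y = simp_class (nerve_pair P \<beta>) q b" "?B = cech_pull q P \<beta> id b"
      using cech_class_memD[OF sub AB(2) mem(2)] .
    note pa = cech_pull_subordinate[OF sub a(1) \<gamma>(1) subordinate_trace[OF \<gamma>(2)] a(2)]
    note pb = cech_pull_subordinate[OF sub b(1) \<gamma>(1) subordinate_trace[OF \<gamma>(3)] b(2)]
    note sp = simplicial_pair_nerve_pair[OF sub]
    have "simp_induced (nerve_pair P \<gamma>) q p x = simp_class (nerve_pair P \<gamma>) q (pull_cochain (nerve_pair P \<gamma>) p a)"
      unfolding a(3) by (rule simp_induced_class[OF sp sp trace_subordinate_simplicial[OF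
            carried_nerve_pair[OF sub a(1)] subordinate_trace[OF \<gamma>(2)]] a(2)])
    moreover have "simp_induced (nerve_pair P \<gamma>) q p' y = simp_class (nerve_pair P \<gamma>) q (pull_cochain (nerve_pair P \<gamma>) p' b)"
      unfolding b(3) by (rule simp_induced_class[OF sp sp trace_subordinate_simplicial[OF
            carried_nerve_pair[OF sub b(1)] subordinate_trace[OF \<gamma>(3)]] b(2)])
    ultimately have "?f \<gamma> p p' x y = cech_pull q P \<gamma> id
        (\<lambda>s. pull_cochain (nerve_pair P \<gamma>) p a s + pull_cochain (nerve_pair P \<gamma>) p' b s)"
      using mult_simp_cohomology[OF sp pa(2) pb(2)] cech_pull_id[OF sub \<gamma>(1) cocycles_add[OF pa(2) pb(2)]]
      by simp
    also have "\<dots> = ?C"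
      by (rule cech_pull_add_cong[OF carried_nerve_pair[OF sub \<gamma>(1)] pa(2) pb(2) assms])
        (use pa(1) pb(1) a(4) b(4) in simp_all)
    finally show ?thesis .
  qed
  obtain \<alpha> x \<beta> y where mem: "(\<alpha>, x) \<in> ?A" "(\<beta>, y) \<in> ?B"
    using cech_class_nonempty[OF sub AB(1)] cech_class_nonempty[OF sub AB(2)] by metis
  have cov: "open_cover (fst P) \<alpha>" "open_cover (fst P) \<beta>"
    using cech_class_memD[OF sub AB(1) mem(1)] cech_class_memD[OF sub AB(2) mem(2)] by metis+
  obtain \<gamma> p p' where \<gamma>: "open_cover (fst P) \<gamma>" "subordinate \<gamma> \<alpha> id p" "subordinate \<gamma> \<beta> id p'"
    using common_refinement[OF cov] .
  have "{?f \<gamma> p p' x y | \<alpha> x \<beta> y \<gamma> p p'. (\<alpha>, x) \<in> ?A \<and> (\<beta>, y) \<in> ?B \<and> open_cover (fst P) \<gamma> \<and>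
      projection id \<gamma> \<alpha> p \<and> projection id \<gamma> \<beta> p'} = {?C}"
    unfolding projection_id
  proof (intro equalityI subsetI)
    fix Z
    assume "Z \<in> {?C}"
    then have "Z = ?f \<gamma> p p' x y"
      using *[OF mem \<gamma>] by simp
    then show "Z \<in> {?f \<gamma> p p' x y | \<alpha> x \<beta> y \<gamma> p p'. (\<alpha>, x) \<in> ?A \<and> (\<beta>, y) \<in> ?B \<and>
        open_cover (fst P) \<gamma> \<and> subordinate \<gamma> \<alpha> id p \<and> subordinate \<gamma> \<beta> id p'}"
      using mem \<gamma> by blast
  qed (use * in blast)
  then show ?thesis
    by (simp add: cech_cohomology_def)
qed

lemma cech_group:
  assumes sub: "snd P \<subseteq> topspace (fst P)"
  shows "group (cech_cohomology q P :: ('a, 'g::ab_group_add) cech_class monoid)"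
proof (rule groupI)
  let ?H = "cech_cohomology q P :: ('a, 'g) cech_class monoid"
  note [simp] = cocycles_add
  have one: "\<one>\<^bsub>?H\<^esub> = cech_pull q P \<gamma> id (\<lambda>s. 0)" if "open_cover (fst P) \<gamma>" for \<gamma>
    by (rule cech_pull_zero[OF carried_nerve_pair[OF sub that], symmetric])
  have "open_cover (fst P) {topspace (fst P)}"
    by (simp add: open_cover_def)
  from cech_pull_carrier[OF carried_nerve_pair[OF sub this] cocycles_zero]
  show "\<one>\<^bsub>?H\<^esub> \<in> carrier ?H"
    by (simp add: one[OF \<open>open_cover (fst P) {topspace (fst P)}\<close>])
  fix A B
  assume A: "A \<in> carrier ?H" and B: "B \<in> carrier ?H"
  obtain \<gamma> a b where \<gamma>: "open_cover (fst P) \<gamma>"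
    and a: "a \<in> cocycles (nerve_pair P \<gamma>) q" "A = cech_pull q P \<gamma> id a"
    and b: "b \<in> cocycles (nerve_pair P \<gamma>) q" "B = cech_pull q P \<gamma> id b"
    using cech_common_cover[OF sub, of "{A, B}" q] A B by auto
  note car = carried_nerve_pair[OF sub \<gamma>]
  show "A \<otimes>\<^bsub>?H\<^esub> B \<in> carrier ?H"
    using cech_pull_carrier[OF car cocycles_add[OF a(1) b(1)]] by (simp add: a b cech_pull_mult[OF car])
  show "\<one>\<^bsub>?H\<^esub> \<otimes>\<^bsub>?H\<^esub> A = A"
    using a by (simp add: one[OF \<gamma>] cech_pull_mult[OF car])
  have na: "(\<lambda>s. 0 - a s) \<in> cocycles (nerve_pair P \<gamma>) q"
    using a by (intro cocycles_diff) simp_all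
  show "\<exists>B\<in>carrier ?H. B \<otimes>\<^bsub>?H\<^esub> A = \<one>\<^bsub>?H\<^esub>"
    using cech_pull_carrier[OF car na] cech_pull_mult[OF car na a(1)] a(2) one[OF \<gamma>] by auto
next
  let ?H = "cech_cohomology q P :: ('a, 'g) cech_class monoid"
  fix A B C
  assume A: "A \<in> carrier ?H" and B: "B \<in> carrier ?H" and C: "C \<in> carrier ?H"
  obtain \<gamma> a b c where \<gamma>: "open_cover (fst P) \<gamma>"
    and a: "a \<in> cocycles (nerve_pair P \<gamma>) q" "A = cech_pull q P \<gamma> id a"
    and b: "b \<in> cocycles (nerve_pair P \<gamma>) q" "B = cech_pull q P \<gamma> id b"
    and c: "c \<in> cocycles (nerve_pair P \<gamma>) q" "C = cech_pull q P \<gamma> id c"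
    using cech_common_cover[OF sub, of "{A, B, C}" q] A B C by auto
  note car = carried_nerve_pair[OF sub \<gamma>]
  show "A \<otimes>\<^bsub>?H\<^esub> B \<otimes>\<^bsub>?H\<^esub> C = A \<otimes>\<^bsub>?H\<^esub> (B \<otimes>\<^bsub>?H\<^esub> C)"
    by (simp add: a b c cech_pull_mult[OF car] cocycles_add add.assoc)
qed

lemma open_cover_pair_map:
  assumes "pair_map P R id" "open_cover (fst R) \<gamma>"
  obtains \<gamma>' \<pi> where "open_cover (fst P) \<gamma>'" "subordinate \<gamma>' \<gamma> id \<pi>"
proof -
  have cont: "continuous_map (fst P) (fst R) id" and top: "topspace (fst P) \<subseteq> topspace (fst R)"
    using assms(1) continuous_map_image_subset_topspace[of "fst P" "fst R" id] by (auto simp: pair_map_def)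
  define \<gamma>' where "\<gamma>' = (\<lambda>V. V \<inter> topspace (fst P)) ` \<gamma>"
  have "openin (fst P) (V \<inter> topspace (fst P))" if "V \<in> \<gamma>" for V
    using openin_continuous_map_preimage[OF cont, of V] that assms(2)
    by (simp add: open_cover_def Int_def conj_commute)
  then have cov: "open_cover (fst P) \<gamma>'"
    using assms(2) top by (auto simp: \<gamma>'_def open_cover_def)
  have "\<forall>G\<in>\<gamma>'. \<exists>V\<in>\<gamma>. G \<subseteq> V"
    by (auto simp: \<gamma>'_def)
  then obtain \<pi> where "\<forall>G\<in>\<gamma>'. \<pi> G \<in> \<gamma> \<and> G \<subseteq> \<pi> G"
    by metis
  then show ?thesis
    using that[OF cov, of \<pi>] by (simp add: subordinate_def)
qed

lemma pair_map_idD: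
  assumes "pair_map P R id"
  shows "topspace (fst P) \<subseteq> topspace (fst R)" "snd P \<subseteq> snd R"
  using assms continuous_map_image_subset_topspace[of "fst P" "fst R" id] by (auto simp: pair_map_def)

lemma carried_pair_map:
  assumes "pair_map P R id" "snd P \<subseteq> topspace (fst P)" "carried R I W NM"
  shows "carried P I W NM"
proof -
  obtain \<beta> p where \<beta>: "open_cover (fst R) \<beta>" "subordinate \<beta> I W p"
    using assms(3) unfolding carried_def by blast
  obtain \<beta>' \<pi> where "open_cover (fst P) \<beta>'" "subordinate \<beta>' \<beta> id \<pi>"
    using open_cover_pair_map[OF assms(1) \<beta>(1)] .
  with subordinate_comp[OF this(2) \<beta>(2)] assms(2,3)
    inerve_mono[OF pair_map_idD(1)[OF assms(1)]] inerve_mono[OF pair_map_idD(2)[OF assms(1)]]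
  show ?thesis
    unfolding carried_def by blast
qed

lemma cech_pull_restrict_cong:
  assumes "pair_map P R id" "snd P \<subseteq> topspace (fst P)" "carried R I W NM" "c \<in> cocycles NM q"
    and "carried R J W' NM'" "c' \<in> cocycles NM' q" "cech_pull q R I W c = cech_pull q R J W' c'"
  shows "cech_pull q P I W c = cech_pull q P J W' c'"
proof -
  obtain \<gamma> t t' where \<gamma>: "open_cover (fst R) \<gamma>" "subordinate \<gamma> I W t" "subordinate \<gamma> J W' t'"
    "(\<lambda>s. pull_cochain (nerve_pair R \<gamma>) t c s - pull_cochain (nerve_pair R \<gamma>) t' c' s)
      \<in> coboundaries (nerve_pair R \<gamma>) q"
    using assms(7) unfolding cech_pull_eq_iff[OF assms(3-6)] by blast
  obtain \<gamma>' \<pi> where \<gamma>': "open_cover (fst P) \<gamma>'" "subordinate \<gamma>' \<gamma> id \<pi>"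
    using open_cover_pair_map[OF assms(1) \<gamma>(1)] .
  have sm: "simplicial_map (nerve_pair P \<gamma>') (nerve_pair R \<gamma>) \<pi>"
    by (rule trace_subordinate_simplicial[OF carried_pair_map[OF assms(1,2) carried_nerve_pair[OF
            carriedD(1)[OF assms(3)] \<gamma>(1)]] subordinate_trace[OF \<gamma>'(2)]])
  have "(\<lambda>s. pull_cochain (nerve_pair P \<gamma>') (t \<circ> \<pi>) c s - pull_cochain (nerve_pair P \<gamma>') (t' \<circ> \<pi>) c' s)
      \<in> coboundaries (nerve_pair P \<gamma>') q"
    using pull_coboundaries[OF simplicial_pair_nerve_pair[OF assms(2)] carriedD(3)[OF assms(3)] sm \<gamma>(4)]
    unfolding pull_diff pull_pull[OF sm] .
  then show ?thesis
    unfolding cech_pull_eq_iff[OF carried_pair_map[OF assms(1-3)] assms(4) carried_pair_map[OF assms(1,2,5)] assms(6)]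
    using \<gamma>'(1) subordinate_comp[OF \<gamma>'(2) \<gamma>(2)] subordinate_comp[OF \<gamma>'(2) \<gamma>(3)] by blast
qed

text \<open>Restriction keeps the family and the cocycle and shrinks only the space, because a
  family carried on \<open>R\<close> is carried on \<open>P\<close>. Naturality thus becomes a
  comparison of one cocycle on several spaces.\<close>

lemma cech_induced_pull:
  assumes "pair_map P R id" "snd P \<subseteq> topspace (fst P)" "carried R I W NM" "c \<in> cocycles NM q"
  shows "cech_induced q P R id (cech_pull q R I W c) = cech_pull q P I W c"
proof -
  let ?A = "cech_pull q R I W c"
  let ?f = "\<lambda>\<beta> p x. cech_rel q P `` {(\<beta>, simp_induced (nerve_pair P \<beta>) q p x)}"
  have sub: "snd R \<subseteq> topspace (fst R)"
    using carriedD(1)[OF assms(3)] .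
  note A = cech_pull_carrier[OF assms(3,4)]
  have *: "?f \<beta> p x = cech_pull q P I W c"
    if mem: "(\<alpha>, x) \<in> ?A" and \<beta>: "open_cover (fst P) \<beta>" "subordinate \<beta> \<alpha> id p" for \<alpha> x \<beta> p
  proof -
    obtain a where a: "open_cover (fst R) \<alpha>" "a \<in> cocycles (nerve_pair R \<alpha>) q"
      "x = simp_class (nerve_pair R \<alpha>) q a" "?A = cech_pull q R \<alpha> id a"
      using cech_class_memD[OF sub A mem] .
    note car = carried_nerve_pair[OF sub a(1)]
    note car' = carried_pair_map[OF assms(1,2) car]
    have "simp_induced (nerve_pair P \<beta>) q p x = simp_class (nerve_pair P \<beta>) q (pull_cochain (nerve_pair P \<beta>) p a)"
      unfolding a(3) by (rule simp_induced_class[OF simplicial_pair_nerve_pair[OF assms(2)]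
            simplicial_pair_nerve_pair[OF sub] trace_subordinate_simplicial[OF car' subordinate_trace[OF \<beta>(2)]] a(2)])
    then have "?f \<beta> p x = cech_pull q P \<alpha> id a"
      using cech_pull_eq[OF car' a(2) \<beta>] by simp
    also have "\<dots> = cech_pull q P I W c"
      by (rule cech_pull_restrict_cong[OF assms(1,2) car a(2) assms(3,4) a(4)[symmetric]])
    finally show ?thesis .
  qed
  obtain \<alpha> x where mem: "(\<alpha>, x) \<in> ?A"
    using cech_class_nonempty[OF sub A] by metis
  have cov: "open_cover (fst R) \<alpha>"
    using cech_class_memD[OF sub A mem] by metis
  obtain \<beta> p where \<beta>: "open_cover (fst P) \<beta>" "subordinate \<beta> \<alpha> id p"
    using open_cover_pair_map[OF assms(1) cov] .
  have "{?f \<beta> p x | \<alpha> x \<beta> p. (\<alpha>, x) \<in> ?A \<and> open_cover (fst P) \<beta> \<and> projection id \<beta> \<alpha> p} =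
      {cech_pull q P I W c}"
    unfolding projection_id
  proof (intro equalityI subsetI)
    fix Z
    assume "Z \<in> {cech_pull q P I W c}"
    then have "Z = ?f \<beta> p x"
      using *[OF mem \<beta>] by simp
    then show "Z \<in> {?f \<beta> p x | \<alpha> x \<beta> p. (\<alpha>, x) \<in> ?A \<and> open_cover (fst P) \<beta> \<and> subordinate \<beta> \<alpha> id p}"
      using mem \<beta> by blast
  qed (use * in blast)
  then show ?thesis
    by (simp add: cech_induced_def)
qed

lemma cech_induced_hom:
  assumes "pair_map P R id" "snd P \<subseteq> topspace (fst P)" "snd R \<subseteq> topspace (fst R)"
  shows "cech_induced q P R id \<in> hom (cech_cohomology q R :: ('a, 'g::ab_group_add) cech_class monoid) (cech_cohomology q P)"
proof (rule homI)
  fix A :: "('a, 'g) cech_class"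
  assume "A \<in> carrier (cech_cohomology q R)"
  then obtain \<alpha> a where a: "open_cover (fst R) \<alpha>" "a \<in> cocycles (nerve_pair R \<alpha>) q" "A = cech_pull q R \<alpha> id a"
    using cech_class_cases[OF assms(3)] by metis
  note car = carried_nerve_pair[OF assms(3) a(1)]
  show "cech_induced q P R id A \<in> carrier (cech_cohomology q P)"
    unfolding a(3) cech_induced_pull[OF assms(1,2) car a(2)]
    by (rule cech_pull_carrier[OF carried_pair_map[OF assms(1,2) car] a(2)])
next
  fix A B :: "('a, 'g) cech_class"
  assume "A \<in> carrier (cech_cohomology q R)" "B \<in> carrier (cech_cohomology q R)"
  then obtain \<alpha> a b where \<alpha>: "open_cover (fst R) \<alpha>"
    and a: "a \<in> cocycles (nerve_pair R \<alpha>) q" "A = cech_pull q R \<alpha> id a"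
    and b: "b \<in> cocycles (nerve_pair R \<alpha>) q" "B = cech_pull q R \<alpha> id b"
    using cech_common_cover[OF assms(3), of "{A, B}" q] by auto
  note car = carried_nerve_pair[OF assms(3) \<alpha>]
  show "cech_induced q P R id (A \<otimes>\<^bsub>cech_cohomology q R\<^esub> B) =
      cech_induced q P R id A \<otimes>\<^bsub>cech_cohomology q P\<^esub> cech_induced q P R id B"
    unfolding a(2) b(2) cech_pull_mult[OF car a(1) b(1)] cech_induced_pull[OF assms(1,2) car a(1)]
      cech_induced_pull[OF assms(1,2) car b(1)] cech_induced_pull[OF assms(1,2) car cocycles_add[OF a(1) b(1)]]
      cech_pull_mult[OF carried_pair_map[OF assms(1,2) car] a(1) b(1)] ..
qed


subsection \<open>The three members of the sequence\<close>

text \<open>One parameter in place of three copies: a single map of pairs into a polyhedral pair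
  yields classes of the pair, the space and the subspace, from cochains of the corresponding part of
  the complex.\<close>

datatype part = Relative | Absolute | Subspace

fun part_pair :: "part \<Rightarrow> 'a spair \<Rightarrow> 'a spair" where
  "part_pair Relative P = P"
| "part_pair Absolute P = (fst P, {})"
| "part_pair Subspace P = (subtopology (fst P) (snd P), {})"

fun part_complex :: "part \<Rightarrow> 'v set set \<times> 'v set set \<Rightarrow> 'v set set \<times> 'v set set" where
  "part_complex Relative NM = NM"
| "part_complex Absolute NM = (fst NM, {})"
| "part_complex Subspace NM = (snd NM, {})"

lemma part_pair_subset: "snd P \<subseteq> topspace (fst P) \<Longrightarrow> snd (part_pair k P) \<subseteq> topspace (fst (part_pair k P))"
  by (cases k) auto

lemma nerve_pair_part:
  assumes "snd P \<subseteq> topspace (fst P)"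
  shows "nerve_pair (part_pair k P) \<gamma> = part_complex k (nerve_pair P \<gamma>)"
proof -
  have "topspace (fst P) \<inter> snd P = snd P"
    using assms by blast
  then show ?thesis
    by (cases k) (simp_all add: nerve_pair_def nerve_eq_inerve)
qed

lemma simplicial_pair_part: "simplicial_pair NM \<Longrightarrow> simplicial_pair (part_complex k NM)"
  by (cases k) (auto simp: simplicial_pair_def)

lemma simplicial_map_part: "simplicial_map NM NM' p \<Longrightarrow> simplicial_map (part_complex k NM) (part_complex k NM') p"
  by (cases k) (auto simp: simplicial_map_def)

lemma pair_map_part: "snd P \<subseteq> topspace (fst P) \<Longrightarrow> pair_map P R id \<Longrightarrow> pair_map (part_pair k P) (part_pair k R) id"
  by (cases k) (auto simp: pair_map_def continuous_map_in_subtopology continuous_map_from_subtopology id_def)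

lemma part_pair_incl: "pair_map (part_pair Subspace P) (part_pair Absolute P) id" "pair_map (part_pair Absolute P) P id"
  by (auto simp: pair_map_def continuous_map_from_subtopology)

lemma carried_part:
  assumes "carried P I W NM"
  shows "carried (part_pair k P) I W (part_complex k NM)"
proof -
  note sub = carriedD(1)[OF assms]
  have "pair_map (part_pair k P) P id"
    using sub by (cases k) (auto simp: pair_map_def continuous_map_from_subtopology)
  from carried_pair_map[OF this part_pair_subset[OF sub] assms]
  have "\<exists>\<beta> p. open_cover (fst (part_pair k P)) \<beta> \<and> subordinate \<beta> I W p"
    unfolding carried_def by blast
  moreover have "topspace (fst P) \<inter> snd P = snd P"
    using sub by blast
  then have "inerve I W (topspace (fst (part_pair k P))) \<subseteq> fst (part_complex k NM)"
    "inerve I W (snd (part_pair k P)) \<subseteq> snd (part_complex k NM)"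
    using assms by (cases k; simp add: carried_def)+
  ultimately show ?thesis
    using part_pair_subset[OF sub] simplicial_pair_part[OF carriedD(2)[OF assms]]
    unfolding carried_def by blast
qed


subsection \<open>The connecting homomorphism\<close>

text \<open>A simplex outside \<open>snd NM\<close> may be sent into \<open>snd NM'\<close>, so
  pulling back and extending by zero do not commute. The two extensions differ by a relative
  cochain, hence their coboundaries by a relative coboundary.\<close>

lemma delta_pull:
  assumes "simplicial_pair NM" "simplicial_pair NM'" "simplicial_map NM NM' t" "c \<in> cocycles (snd NM', {}) q"
  shows "(\<lambda>s. coboundary (fst NM) (pull_cochain (snd NM, {}) t c) s -
      pull_cochain NM t (coboundary (fst NM') c) s) \<in> coboundaries NM (q + 1)"
proof -
  let ?a = "\<lambda>s. pull_cochain (snd NM, {}) t c s - pull_cochain NM t c s"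
  have c: "c \<in> cochains (snd NM', {}) q"
    using assms(4) by (simp add: cocycles_iff)
  have "c [] = 0"
    using cochains_Nil[OF c] assms(2) by (simp add: simplicial_pair_def)
  moreover have "?a \<in> cochains NM q"
    using c assms(1) by (auto simp: cochains_def pull_cochain_def simplicial_pair_def)
  ultimately show ?thesis
    using coboundariesI[of ?a NM "q + 1"]
    unfolding coboundary_diff pull_coboundary[where c = c, OF assms(1,3) \<open>c [] = 0\<close>] by simp
qed

text \<open>A cover of the subspace on which \<open>c\<close> and \<open>c'\<close> become
  cohomologous is refined by the trace of a cover of the whole space. On the nerve of the latter
  \<open>delta_coboundaries\<close> applies, and \<open>delta_pull\<close> exchanges coboundary and
  pullback on both sides.\<close>

lemma cech_delta_cong:
  assumes "closedin (fst P) (snd P)" "carried P I W NM" "c \<in> cocycles (snd NM, {}) q"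
    and "carried P J W' NM'" "c' \<in> cocycles (snd NM', {}) q"
    and "cech_pull q (part_pair Subspace P) I W c = cech_pull q (part_pair Subspace P) J W' c'"
  shows "cech_pull (q + 1) P I W (coboundary (fst NM) c) = cech_pull (q + 1) P J W' (coboundary (fst NM') c')"
proof -
  let ?S = "part_pair Subspace P"
  note car = carried_part[OF assms(2), of Subspace, unfolded part_complex.simps]
    carried_part[OF assms(4), of Subspace, unfolded part_complex.simps]
  note sub = carriedD(1)[OF assms(2)]
  obtain \<gamma>\<^sub>0 t t' where \<gamma>\<^sub>0: "open_cover (fst ?S) \<gamma>\<^sub>0" "subordinate \<gamma>\<^sub>0 I W t" "subordinate \<gamma>\<^sub>0 J W' t'"
    "(\<lambda>s. pull_cochain (nerve_pair ?S \<gamma>\<^sub>0) t c s - pull_cochain (nerve_pair ?S \<gamma>\<^sub>0) t' c' s)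
      \<in> coboundaries (nerve_pair ?S \<gamma>\<^sub>0) q"
    using assms(6) unfolding cech_pull_eq_iff[OF car(1) assms(3) car(2) assms(5)] by blast
  obtain \<beta> p \<beta>' p' where \<beta>: "open_cover (fst P) \<beta>" "subordinate \<beta> I W p"
    and \<beta>': "open_cover (fst P) \<beta>'" "subordinate \<beta>' J W' p'"
    using assms(2,4) unfolding carried_def by blast
  obtain \<delta> u u' where \<delta>: "open_cover (fst P) \<delta>" "subordinate \<delta> \<beta> id u" "subordinate \<delta> \<beta>' id u'"
    using common_refinement[OF \<beta>(1) \<beta>'(1)] .
  obtain \<gamma> r \<pi> where \<gamma>: "open_cover (fst P) \<gamma>" "subordinate \<gamma> \<delta> id r"
    and \<pi>: "\<And>V. \<lbrakk>V \<in> \<gamma>; V \<inter> snd P \<noteq> {}\<rbrakk> \<Longrightarrow> \<pi> V \<in> \<gamma>\<^sub>0 \<and> V \<inter> snd P \<subseteq> \<pi> V"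
    using open_cover_trace[OF assms(1) _ \<delta>(1), of \<gamma>\<^sub>0] \<gamma>\<^sub>0(1) by auto
  have \<pi>': "trace_subordinate ?S \<gamma> \<gamma>\<^sub>0 id \<pi>"
    unfolding trace_subordinate_def
  proof (intro ballI impI)
    fix V assume V: "V \<in> \<gamma>" "V \<inter> topspace (fst ?S) \<noteq> {}"
    then show "\<pi> V \<in> \<gamma>\<^sub>0 \<and> V \<inter> topspace (fst ?S) \<subseteq> id (\<pi> V)"
      using \<pi>[of V] by auto
  qed
  define v v' where "v = p \<circ> u \<circ> r" and "v' = p' \<circ> u' \<circ> r"
  have v: "subordinate \<gamma> I W v" "subordinate \<gamma> J W' v'"
    using subordinate_comp[OF \<gamma>(2) subordinate_comp[OF \<delta>(2) \<beta>(2)]]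
      subordinate_comp[OF \<gamma>(2) subordinate_comp[OF \<delta>(3) \<beta>'(2)]] by (auto simp: v_def v'_def o_assoc)
  let ?N = "nerve_pair P \<gamma>"
  let ?p = "pull_cochain (snd ?N, {})"
  have "(\<lambda>s. ?p v c s - ?p v' c' s) \<in> coboundaries (snd ?N, {}) q"
    using cohomologous_refine[OF car(1) assms(3) car(2) assms(5) subordinate_trace[OF \<gamma>\<^sub>0(2)]
      subordinate_trace[OF \<gamma>\<^sub>0(3)] \<gamma>\<^sub>0(4,1) \<pi>' subordinate_trace[OF v(1)] subordinate_trace[OF v(2)]]
    unfolding nerve_pair_part[OF sub] part_complex.simps .
  from delta_coboundaries[OF simplicial_pair_nerve_pair[OF sub] this]
  have 1: "(\<lambda>s. coboundary (fst ?N) (?p v c) s - coboundary (fst ?N) (?p v' c') s) \<in> coboundaries ?N (q + 1)"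
    unfolding coboundary_diff .
  note sm = trace_subordinate_simplicial[OF assms(2) subordinate_trace[OF v(1)]]
    trace_subordinate_simplicial[OF assms(4) subordinate_trace[OF v(2)]]
  note 2 = delta_pull[OF carriedD(3)[OF assms(2)] carriedD(2)[OF assms(2)] sm(1) assms(3)]
  note 3 = delta_pull[OF carriedD(3)[OF assms(4)] carriedD(2)[OF assms(4)] sm(2) assms(5)]
  have "(\<lambda>s. pull_cochain ?N v (coboundary (fst NM) c) s - pull_cochain ?N v' (coboundary (fst NM') c') s)
      \<in> coboundaries ?N (q + 1)"
    using cohomologous_trans[OF cohomologous_trans[OF cohomologous_sym[OF 2] 1] 3] .
  then show ?thesis
    unfolding cech_pull_eq_iff[OF assms(2) delta_cocycles[OF carriedD(2)[OF assms(2)] assms(3)]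
        assms(4) delta_cocycles[OF carriedD(2)[OF assms(4)] assms(5)]]
    using \<gamma>(1) v by blast
qed

text \<open>The counterpart of \<open>cech_induced_pull\<close>: the family is kept, and the
  connecting homomorphism is applied once, in the complex \<open>NM\<close>.\<close>

lemma cech_delta_pull:
  assumes "closedin (fst P) (snd P)" "carried P I W NM" "c \<in> cocycles (snd NM, {}) q"
  shows "cech_delta q P (cech_pull q (part_pair Subspace P) I W c) = cech_pull (q + 1) P I W (coboundary (fst NM) c)"
proof -
  let ?S = "part_pair Subspace P"
  let ?A = "cech_pull q ?S I W c" and ?C = "cech_pull (q + 1) P I W (coboundary (fst NM) c)"
  let ?f = "\<lambda>\<alpha> p y. cech_rel (q + 1) P `` {(\<alpha>, simp_delta (nerve_pair P \<alpha>) q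
                                   (simp_induced (nerve \<alpha> (snd P), {}) q p y))}"
  note carS = carried_part[OF assms(2), of Subspace, unfolded part_complex.simps]
  note sub = carriedD(1)[OF assms(2)] and subS = carriedD(1)[OF carS]
  note A = cech_pull_carrier[OF carS assms(3)]
  have S: "topspace (fst ?S) = snd P"
    using sub by auto
  have *: "?f \<alpha> p y = ?C" if mem: "(\<beta>, y) \<in> ?A" and \<alpha>: "open_cover (fst P) \<alpha>"
    and p: "\<forall>V\<in>\<alpha>. V \<inter> snd P \<noteq> {} \<longrightarrow> p V \<in> \<beta> \<and> V \<inter> snd P \<subseteq> p V" for \<alpha> \<beta> y p
  proof -
    obtain b where b: "open_cover (fst ?S) \<beta>" "b \<in> cocycles (nerve_pair ?S \<beta>) q"
      "y = simp_class (nerve_pair ?S \<beta>) q b" "?A = cech_pull q ?S \<beta> id b"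
      using cech_class_memD[OF subS A mem] .
    note car = carried_nerve_pair[OF sub \<alpha>]
    note car' = carried_part[OF car, of Subspace]
    note carb = carried_nerve_pair[OF subS b(1)]
    have tr: "trace_subordinate ?S \<alpha> \<beta> id p"
      unfolding trace_subordinate_def S using p by simp
    let ?d = "pull_cochain (nerve_pair ?S \<alpha>) p b"
    have NS: "nerve_pair ?S \<alpha> = (snd (nerve_pair P \<alpha>), {})"
      using nerve_pair_part[OF sub, of Subspace] by simp
    have d: "?d \<in> cocycles (snd (nerve_pair P \<alpha>), {}) q"
      using pull_refines_cocycles[OF carb b(2) tr] by (simp only: NS)
    have 1: "simp_induced (nerve \<alpha> (snd P), {}) q p y = simp_class (nerve_pair ?S \<alpha>) q ?d"
      using simp_induced_class[OF simplicial_pair_nerve_pair[OF subS] simplicial_pair_nerve_pair[OF subS]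
          trace_subordinate_simplicial[OF carb tr] b(2)]
      unfolding b(3) NS by (simp add: nerve_pair_def)
    have "?f \<alpha> p y = cech_pull (q + 1) P \<alpha> id (coboundary (fst (nerve_pair P \<alpha>)) ?d)"
      unfolding 1 NS cech_pull_id[OF sub \<alpha> delta_cocycles[OF simplicial_pair_nerve_pair[OF sub] d[unfolded NS]]]
        simp_delta_class[OF simplicial_pair_nerve_pair[OF sub] d[unfolded NS]] ..
    also have "\<dots> = ?C"
    proof (rule cech_delta_cong[OF assms(1) car d assms(2,3)])
      have "cech_pull q ?S \<alpha> id ?d = cech_pull q ?S \<beta> id b"
        unfolding NS
        by (rule cech_pull_natural[OF car'[unfolded part_complex.simps] carb _ b(2)])
          (use trace_subordinate_simplicial[OF carb tr] tr in \<open>auto simp only: NS trace_subordinate_def id_def\<close>)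
      then show "cech_pull q ?S \<alpha> id ?d = ?A"
        using b(4) by simp
    qed
    finally show ?thesis .
  qed
  obtain \<beta> y where mem: "(\<beta>, y) \<in> ?A"
    using cech_class_nonempty[OF subS A] by metis
  have "open_cover (fst ?S) \<beta>"
    using cech_class_memD[OF subS A mem] by metis
  then have cov: "open_cover (subtopology (fst P) (snd P)) \<beta>"
    by simp
  have "open_cover (fst P) {topspace (fst P)}"
    by (simp add: open_cover_def)
  from open_cover_trace[OF assms(1) cov this] obtain \<alpha> p where \<alpha>: "open_cover (fst P) \<alpha>"
    and p: "\<forall>V\<in>\<alpha>. V \<inter> snd P \<noteq> {} \<longrightarrow> p V \<in> \<beta> \<and> V \<inter> snd P \<subseteq> p V"
    by metis
  have "{?f \<alpha> p y | \<beta> y \<alpha> p. (\<beta>, y) \<in> ?A \<and> open_cover (fst P) \<alpha> \<and>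
           (\<forall>V\<in>\<alpha>. V \<inter> snd P \<noteq> {} \<longrightarrow> p V \<in> \<beta> \<and> V \<inter> snd P \<subseteq> p V)} = {?C}"
  proof (intro equalityI subsetI)
    fix Z
    assume "Z \<in> {?C}"
    then have "Z = ?f \<alpha> p y"
      using *[OF mem \<alpha> p] by simp
    then show "Z \<in> {?f \<alpha> p y | \<beta> y \<alpha> p. (\<beta>, y) \<in> ?A \<and> open_cover (fst P) \<alpha> \<and>
           (\<forall>V\<in>\<alpha>. V \<inter> snd P \<noteq> {} \<longrightarrow> p V \<in> \<beta> \<and> V \<inter> snd P \<subseteq> p V)}"
      using mem \<alpha> p by blast
  next
    fix Z
    assume "Z \<in> {?f \<alpha> p y | \<beta> y \<alpha> p. (\<beta>, y) \<in> ?A \<and> open_cover (fst P) \<alpha> \<and>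
           (\<forall>V\<in>\<alpha>. V \<inter> snd P \<noteq> {} \<longrightarrow> p V \<in> \<beta> \<and> V \<inter> snd P \<subseteq> p V)}"
    then obtain \<beta> y \<alpha> p where "Z = ?f \<alpha> p y" "(\<beta>, y) \<in> ?A" "open_cover (fst P) \<alpha>"
      "\<forall>V\<in>\<alpha>. V \<inter> snd P \<noteq> {} \<longrightarrow> p V \<in> \<beta> \<and> V \<inter> snd P \<subseteq> p V"
      by (elim CollectE exE conjE)
    with *[OF this(2-4)] show "Z \<in> {?C}" by simp
  qed
  then show ?thesis
    unfolding cech_delta_def by simp
qed

text \<open>The part is closed, so a cover of it is refined by the trace of a cover of the whole
  space. The class then lives on a part of the nerve pair of that cover, next to the cochains of the
  pair.\<close>

lemma cech_part_cases:
  assumes "snd P \<subseteq> topspace (fst P)" "closedin (fst P) (topspace (fst (part_pair k P)))"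
    and "open_cover (fst P) \<alpha>" "A \<in> carrier (cech_cohomology q (part_pair k P))"
  obtains \<gamma> r c where "open_cover (fst P) \<gamma>" "subordinate \<gamma> \<alpha> id r"
    "c \<in> cocycles (part_complex k (nerve_pair P \<gamma>)) q" "A = cech_pull q (part_pair k P) \<gamma> id c"
proof -
  let ?P = "part_pair k P" let ?S = "topspace (fst ?P)"
  note subk = part_pair_subset[OF assms(1), of k]
  obtain \<alpha>\<^sub>0 c\<^sub>0 where c\<^sub>0: "open_cover (fst ?P) \<alpha>\<^sub>0" "c\<^sub>0 \<in> cocycles (nerve_pair ?P \<alpha>\<^sub>0) q"
    "A = cech_pull q ?P \<alpha>\<^sub>0 id c\<^sub>0"
    using cech_class_cases[OF subk assms(4)] .
  have "fst ?P = subtopology (fst P) ?S"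
    using assms(1) by (cases k) (simp_all add: inf_absorb2)
  with c\<^sub>0(1) have "open_cover (subtopology (fst P) ?S) \<alpha>\<^sub>0"
    by simp
  from open_cover_trace[OF assms(2) this assms(3)] obtain \<gamma> r \<pi> where
    \<gamma>: "open_cover (fst P) \<gamma>" "subordinate \<gamma> \<alpha> id r"
    and \<pi>: "\<And>V. \<lbrakk>V \<in> \<gamma>; V \<inter> ?S \<noteq> {}\<rbrakk> \<Longrightarrow> \<pi> V \<in> \<alpha>\<^sub>0 \<and> V \<inter> ?S \<subseteq> \<pi> V"
    by metis
  note car0 = carried_nerve_pair[OF subk c\<^sub>0(1)]
  have tr: "trace_subordinate ?P \<gamma> \<alpha>\<^sub>0 id \<pi>"
    using \<pi> by (simp add: trace_subordinate_def)
  note N = nerve_pair_part[OF assms(1), of k \<gamma>]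
  have "A = cech_pull q ?P \<gamma> id (pull_cochain (part_complex k (nerve_pair P \<gamma>)) \<pi> c\<^sub>0)"
    unfolding c\<^sub>0(3)
    by (rule cech_pull_natural[OF carried_part[OF carried_nerve_pair[OF assms(1) \<gamma>(1)]] car0 _ c\<^sub>0(2), symmetric])
      (use trace_subordinate_simplicial[OF car0 tr] \<pi> in \<open>simp_all add: N\<close>)
  then show ?thesis
    using that[OF \<gamma>] pull_refines_cocycles[OF car0 c\<^sub>0(2) tr] N by simp
qed

lemma cech_delta_hom:
  assumes "closedin (fst P) (snd P)"
  shows "cech_delta q P \<in> hom (cech_cohomology q (part_pair Subspace P) :: ('a, 'g::ab_group_add) cech_class monoid)
    (cech_cohomology (q + 1) P)"
proof -
  let ?S = "part_pair Subspace P"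
  have sub: "snd P \<subseteq> topspace (fst P)"
    using assms by (rule closedin_subset)
  have T: "open_cover (fst P) {topspace (fst P)}"
    by (simp add: open_cover_def)
  have cl: "closedin (fst P) (topspace (fst ?S))"
    using assms sub by (simp add: inf_absorb2)
  show ?thesis
  proof (rule homI)
    fix A :: "('a, 'g) cech_class"
    assume "A \<in> carrier (cech_cohomology q ?S)"
    then obtain \<gamma> c where \<gamma>: "open_cover (fst P) \<gamma>" and c: "c \<in> cocycles (snd (nerve_pair P \<gamma>), {}) q"
      and A: "A = cech_pull q ?S \<gamma> id c"
      using cech_part_cases[OF sub cl T] unfolding part_complex.simps by metis
    note car = carried_nerve_pair[OF sub \<gamma>]
    show "cech_delta q P A \<in> carrier (cech_cohomology (q + 1) P)"
      unfolding A cech_delta_pull[OF assms car c]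
      by (rule cech_pull_carrier[OF car delta_cocycles[OF carriedD(2)[OF car] c]])
  next
    fix A B :: "('a, 'g) cech_class"
    assume A: "A \<in> carrier (cech_cohomology q ?S)" and B: "B \<in> carrier (cech_cohomology q ?S)"
    obtain \<gamma>\<^sub>1 a\<^sub>1 where \<gamma>\<^sub>1: "open_cover (fst P) \<gamma>\<^sub>1" and a\<^sub>1: "a\<^sub>1 \<in> cocycles (snd (nerve_pair P \<gamma>\<^sub>1), {}) q"
      and A1: "A = cech_pull q ?S \<gamma>\<^sub>1 id a\<^sub>1"
      using cech_part_cases[OF sub cl T A] unfolding part_complex.simps by metis
    \<comment> \<open>The second class is represented on a refinement of the cover of the first, so
      both get cocycles on one nerve.\<close>
    obtain \<gamma> r b where \<gamma>: "open_cover (fst P) \<gamma>" "subordinate \<gamma> \<gamma>\<^sub>1 id r"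
      and b: "b \<in> cocycles (snd (nerve_pair P \<gamma>), {}) q" and Bb: "B = cech_pull q ?S \<gamma> id b"
      using cech_part_cases[OF sub cl \<gamma>\<^sub>1 B] unfolding part_complex.simps by metis
    note car = carried_nerve_pair[OF sub \<gamma>(1)]
    note car1 = carried_nerve_pair[OF sub \<gamma>\<^sub>1]
    note carS = carried_part[OF car, of Subspace] carried_part[OF car1, of Subspace]
    let ?N = "part_complex Subspace (nerve_pair P \<gamma>)"
    define a where "a = pull_cochain ?N r a\<^sub>1"
    have sm: "simplicial_map ?N (part_complex Subspace (nerve_pair P \<gamma>\<^sub>1)) r"
      by (rule simplicial_map_part[OF trace_subordinate_simplicial[OF car1 subordinate_trace[OF \<gamma>(2)]]])
    have a\<^sub>1': "a\<^sub>1 \<in> cocycles (part_complex Subspace (nerve_pair P \<gamma>\<^sub>1)) q"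
      using a\<^sub>1 by simp
    have Aa: "A = cech_pull q ?S \<gamma> id a"
      unfolding A1 a_def using \<gamma>(2)
      by (intro cech_pull_natural[OF carS sm a\<^sub>1', symmetric]) (auto simp: subordinate_def)
    have a: "a \<in> cocycles (snd (nerve_pair P \<gamma>), {}) q"
      using pull_cocycles[OF carriedD(2)[OF carS(1)] carriedD(2)[OF carS(2)] sm a\<^sub>1'] by (simp add: a_def)
    note carS' = carS(1)[unfolded part_complex.simps]
    note dc = delta_cocycles[OF carriedD(2)[OF car]]
    show "cech_delta q P (A \<otimes>\<^bsub>cech_cohomology q ?S\<^esub> B) =
        cech_delta q P A \<otimes>\<^bsub>cech_cohomology (q + 1) P\<^esub> cech_delta q P B"
      unfolding Aa Bb cech_pull_mult[OF carS' a b] cech_delta_pull[OF assms car cocycles_add[OF a b]]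
        cech_delta_pull[OF assms car a] cech_delta_pull[OF assms car b]
        cech_pull_mult[OF car dc[OF a] dc[OF b]] coboundary_add ..
  qed
qed


section \<open>Exactness of the Cech sequence for a closed subspace\<close>

lemma closed_part:
  assumes "closedin (fst P) (snd P)"
  shows "closedin (fst P) (topspace (fst (part_pair k P)))"
  using assms closedin_subset[OF assms] by (cases k) (simp_all add: inf_absorb2)

lemma open_cover_whole: "open_cover T {topspace T}"
  by (simp add: open_cover_def)

lemma cochains_extend_zero:
  assumes "b \<in> cochains (snd NM, {}) q" "simplicial_pair NM"
  shows "b \<in> cochains (fst NM, {}) q"
  using assms by (auto simp: cochains_def simplicial_pair_def)

text \<open>On a refinement the restriction of \<open>c\<close> to the subcomplex is the coboundary
  of some \<open>b\<close>. Subtracting the coboundary of \<open>b\<close> extended by zero keeps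
  the absolute class and makes the cocycle vanish on the subcomplex.\<close>

lemma cech_exact_total:
  fixes y :: "('a, 'g::ab_group_add) cech_class"
  assumes cl: "closedin (fst P) (snd P)"
    and y: "y \<in> carrier (cech_cohomology q (part_pair Absolute P))"
    and 0: "cech_induced q (part_pair Subspace P) (part_pair Absolute P) id y = \<one>\<^bsub>cech_cohomology q (part_pair Subspace P)\<^esub>"
  shows "\<exists>x\<in>carrier (cech_cohomology q P). cech_induced q (part_pair Absolute P) P id x = y"
proof -
  let ?S = "part_pair Subspace P" and ?T = "part_pair Absolute P"
  have sub: "snd P \<subseteq> topspace (fst P)"
    using cl by (rule closedin_subset)
  note subS = part_pair_subset[OF sub, of Subspace] and subT = part_pair_subset[OF sub, of Absolute]
  obtain \<alpha> c where \<alpha>: "open_cover (fst ?T) \<alpha>" and c: "c \<in> cocycles (nerve_pair ?T \<alpha>) q" "y = cech_pull q ?T \<alpha> id c"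
    using cech_class_cases[OF subT y] .
  note carT = carried_nerve_pair[OF subT \<alpha>]
  note carS = carried_pair_map[OF part_pair_incl(1) subS carT]
  have \<alpha>': "open_cover (fst P) \<alpha>"
    using \<alpha> by simp
  from 0 have "cech_pull q ?S \<alpha> id c = cech_pull q ?S \<alpha> id (\<lambda>s. 0)"
    unfolding c(2) cech_induced_pull[OF part_pair_incl(1) subS carT c(1)] cech_pull_zero[OF carS] .
  then obtain \<gamma>\<^sub>0 t t' where \<gamma>\<^sub>0: "open_cover (fst ?S) \<gamma>\<^sub>0" "subordinate \<gamma>\<^sub>0 \<alpha> id t" "subordinate \<gamma>\<^sub>0 \<alpha> id t'"
    "(\<lambda>s. pull_cochain (nerve_pair ?S \<gamma>\<^sub>0) t c s - pull_cochain (nerve_pair ?S \<gamma>\<^sub>0) t' (\<lambda>s. 0) s)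
      \<in> coboundaries (nerve_pair ?S \<gamma>\<^sub>0) q"
    unfolding cech_pull_eq_iff[OF carS c(1) carS cocycles_zero] by blast
  have "open_cover (subtopology (fst P) (snd P)) \<gamma>\<^sub>0"
    using \<gamma>\<^sub>0(1) by simp
  from open_cover_trace[OF cl this \<alpha>'] obtain \<gamma> r \<pi> where
    \<gamma>: "open_cover (fst P) \<gamma>" "subordinate \<gamma> \<alpha> id r"
    and \<pi>: "\<And>V. \<lbrakk>V \<in> \<gamma>; V \<inter> snd P \<noteq> {}\<rbrakk> \<Longrightarrow> \<pi> V \<in> \<gamma>\<^sub>0 \<and> V \<inter> snd P \<subseteq> \<pi> V"
    by metis
  have tr: "trace_subordinate ?S \<gamma> \<gamma>\<^sub>0 id \<pi>"
    using \<pi> sub by (auto simp: trace_subordinate_def inf_absorb2)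
  define N where "N = nerve_pair P \<gamma>"
  have N: "nerve_pair ?S \<gamma> = (snd N, {})" "nerve_pair ?T \<gamma> = (fst N, {})" "simplicial_pair N"
    using nerve_pair_part[OF sub, of Subspace \<gamma>] nerve_pair_part[OF sub, of Absolute \<gamma>]
      simplicial_pair_nerve_pair[OF sub] by (simp_all add: N_def)
  have "(\<lambda>s. pull_cochain (snd N, {}) r c s) \<in> coboundaries (snd N, {}) q"
    using cohomologous_refine[OF carS c(1) carS cocycles_zero subordinate_trace[OF \<gamma>\<^sub>0(2)]
      subordinate_trace[OF \<gamma>\<^sub>0(3)] \<gamma>\<^sub>0(4,1) tr subordinate_trace[OF \<gamma>(2)] subordinate_trace[OF \<gamma>(2)]]
    unfolding N pull_zero diff_0_right .
  then obtain b where b: "b \<in> cochains (snd N, {}) (q - 1)" "pull_cochain (snd N, {}) r c = coboundary (snd N) b"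
    by (auto simp: coboundaries_def)
  let ?rc = "pull_cochain (fst N, {}) r c" and ?db = "coboundary (fst N) b"
  let ?c = "\<lambda>s. ?rc s - ?db s"
  have rc: "?rc \<in> cocycles (fst N, {}) q" "cech_pull q ?T \<gamma> id ?rc = y"
    using cech_pull_subordinate[OF subT \<alpha> _ subordinate_trace[OF \<gamma>(2)] c(1)] \<gamma>(1) c(2) N(2) by simp_all
  have b': "?db \<in> coboundaries (fst N, {}) q"
    using coboundariesI[OF cochains_extend_zero[OF b(1) N(3)]] by simp
  have sT: "simplicial_pair (fst N, {})"
    using N(3) by (simp add: simplicial_pair_def)
  have cT: "?c \<in> cocycles (fst N, {}) q"
    by (rule cocycles_diff[OF rc(1) coboundaries_cocycles[OF sT b']])
  have "?c s = 0" if "set s \<in> snd N" for s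
    using fun_cong[OF b(2), of s] that N(3) by (auto simp: pull_cochain_def coboundary_cob simplicial_pair_def)
  then have c': "?c \<in> cocycles N q"
    using cT by (auto simp: cocycles_iff cochains_def)
  note carN = carried_nerve_pair[OF sub \<gamma>(1), folded N_def]
  note carNT = carried_part[OF carN, of Absolute, unfolded part_complex.simps]
  have "cech_pull q ?T \<gamma> id ?c = cech_pull q ?T \<gamma> id ?rc"
    using cohomologous_sym[of "\<lambda>s. 0" ?db "(fst N, {})" q] b'
    by (intro cech_pull_cohomologous[OF carNT cT rc(1)] cohomologous_sym[of ?rc]) simp
  then have "cech_induced q ?T P id (cech_pull q P \<gamma> id ?c) = y"
    using cech_induced_pull[OF part_pair_incl(2) subT carN c'] rc(2) by simp
  then show ?thesis
    using cech_pull_carrier[OF carN c'] by blast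
qed

text \<open>On a refinement the relative cocycle is the coboundary of an absolute \<open>b\<close>.
  This coboundary vanishes on the subcomplex, so the truncation \<open>b'\<close> of
  \<open>b\<close> is a cocycle there; as \<open>b - b'\<close> is relative, \<open>b'\<close> has
  the required image.\<close>

lemma cech_exact_relative:
  fixes x :: "('a, 'g::ab_group_add) cech_class"
  assumes cl: "closedin (fst P) (snd P)"
    and x: "x \<in> carrier (cech_cohomology q P)"
    and 0: "cech_induced q (part_pair Absolute P) P id x = \<one>\<^bsub>cech_cohomology q (part_pair Absolute P)\<^esub>"
  shows "\<exists>y\<in>carrier (cech_cohomology (q - 1) (part_pair Subspace P)). cech_delta (q - 1) P y = x"
proof -
  let ?S = "part_pair Subspace P" and ?T = "part_pair Absolute P"
  have sub: "snd P \<subseteq> topspace (fst P)"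
    using cl by (rule closedin_subset)
  note subT = part_pair_subset[OF sub, of Absolute]
  obtain \<alpha> c where \<alpha>: "open_cover (fst P) \<alpha>" and c: "c \<in> cocycles (nerve_pair P \<alpha>) q" "x = cech_pull q P \<alpha> id c"
    using cech_class_cases[OF sub x] .
  note carP = carried_nerve_pair[OF sub \<alpha>]
  note carT = carried_pair_map[OF part_pair_incl(2) subT carP]
  from 0 have "cech_pull q ?T \<alpha> id c = cech_pull q ?T \<alpha> id (\<lambda>s. 0)"
    unfolding c(2) cech_induced_pull[OF part_pair_incl(2) subT carP c(1)] cech_pull_zero[OF carT] .
  then obtain \<gamma> t and t' :: "'a set \<Rightarrow> 'a set" where "open_cover (fst ?T) \<gamma>" and t: "subordinate \<gamma> \<alpha> id t" and
    d: "(\<lambda>s. pull_cochain (nerve_pair ?T \<gamma>) t c s - pull_cochain (nerve_pair ?T \<gamma>) t' (\<lambda>s. 0) s)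
      \<in> coboundaries (nerve_pair ?T \<gamma>) q"
    unfolding cech_pull_eq_iff[OF carT c(1) carT cocycles_zero] by blast
  then have \<gamma>: "open_cover (fst P) \<gamma>"
    by simp
  define N where "N = nerve_pair P \<gamma>"
  have N: "nerve_pair ?S \<gamma> = (snd N, {})" "nerve_pair ?T \<gamma> = (fst N, {})" "simplicial_pair N"
    using nerve_pair_part[OF sub, of Subspace \<gamma>] nerve_pair_part[OF sub, of Absolute \<gamma>]
      simplicial_pair_nerve_pair[OF sub] by (simp_all add: N_def)
  have "pull_cochain (fst N, {}) t c = pull_cochain N t c"
    by (simp add: pull_cochain_def fun_eq_iff)
  with d obtain b where b: "b \<in> cochains (fst N, {}) (q - 1)" "pull_cochain N t c = coboundary (fst N) b"
    unfolding N pull_zero diff_0_right by (auto simp: coboundaries_def)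
  have tc: "pull_cochain N t c \<in> cocycles N q" "cech_pull q P \<gamma> id (pull_cochain N t c) = x"
    using cech_pull_subordinate[OF sub \<alpha> \<gamma> subordinate_trace[OF t] c(1)] c(2) by (simp_all add: N_def)
  define b' where "b' = (\<lambda>s. if set s \<in> snd N then b s else 0)"
  have b0: "b [] = 0"
    using cochains_Nil[OF b(1)] N(3) by (simp add: simplicial_pair_def)
  have "b' \<in> cochains (snd N, {}) (q - 1)"
    using b(1) by (auto simp: b'_def cochains_def)
  moreover have "coboundary (snd N) b' s = 0" for s
  proof (cases "set s \<in> snd N")
    case True
    have "cob b' s = cob b s"
      by (rule coboundary_subcomplex[of "snd N"]) (use N(3) True b0 in \<open>auto simp: b'_def simplicial_pair_def\<close>)
    also have "\<dots> = coboundary (fst N) b s"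
      using True N(3) by (auto simp: coboundary_cob simplicial_pair_def)
    also have "\<dots> = 0"
      using tc(1) True by (auto simp: b(2)[symmetric] cocycles_iff intro: cochains_eq_0)
    finally show ?thesis
      using True by (simp add: coboundary_cob)
  qed (simp add: coboundary_cob)
  ultimately have b': "b' \<in> cocycles (snd N, {}) (q - 1)"
    by (auto simp: cocycles_iff)
  note carN = carried_nerve_pair[OF sub \<gamma>, folded N_def]
  note carNS = carried_part[OF carN, of Subspace, unfolded part_complex.simps]
  have db: "coboundary (fst N) b' \<in> cocycles N q"
    using delta_cocycles[OF N(3) b'] by simp
  have "cech_delta (q - 1) P (cech_pull (q - 1) ?S \<gamma> id b') = cech_pull q P \<gamma> id (coboundary (fst N) b')"
    using cech_delta_pull[OF cl carN b'] by simp
  also have "\<dots> = cech_pull q P \<gamma> id (pull_cochain N t c)"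
  proof (rule cech_pull_cohomologous[OF carN db tc(1)], rule cohomologous_sym)
    have "(\<lambda>s. b s - b' s) \<in> cochains N (q - 1)"
      using b(1) by (auto simp: b'_def cochains_def)
    from coboundariesI[OF this]
    show "(\<lambda>s. pull_cochain N t c s - coboundary (fst N) b' s) \<in> coboundaries N q"
      by (simp add: coboundary_diff b(2))
  qed
  finally show ?thesis
    using tc(2) cech_pull_carrier[OF carNS b'] by metis
qed

text \<open>On a refinement the coboundary of \<open>c\<close>, extended by zero, is also that of a
  relative \<open>b\<close>. The extension minus \<open>b\<close> is then an absolute cocycle, and
  it restricts to \<open>c\<close> because \<open>b\<close> vanishes on the subcomplex.\<close>

lemma cech_exact_subspace:
  fixes y :: "('a, 'g::ab_group_add) cech_class"
  assumes cl: "closedin (fst P) (snd P)"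
    and y: "y \<in> carrier (cech_cohomology q (part_pair Subspace P))"
    and 0: "cech_delta q P y = \<one>\<^bsub>cech_cohomology (q + 1) P\<^esub>"
  shows "\<exists>x\<in>carrier (cech_cohomology q (part_pair Absolute P)).
    cech_induced q (part_pair Subspace P) (part_pair Absolute P) id x = y"
proof -
  let ?S = "part_pair Subspace P" and ?T = "part_pair Absolute P"
  have sub: "snd P \<subseteq> topspace (fst P)"
    using cl by (rule closedin_subset)
  note subS = part_pair_subset[OF sub, of Subspace] and subT = part_pair_subset[OF sub, of Absolute]
  obtain \<gamma> c where \<gamma>: "open_cover (fst P) \<gamma>"
    and c: "c \<in> cocycles (snd (nerve_pair P \<gamma>), {}) q" "y = cech_pull q ?S \<gamma> id c"
    using cech_part_cases[OF sub closed_part[OF cl] open_cover_whole y] by (metis part_complex.simps(3))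
  define M where "M = nerve_pair P \<gamma>"
  note c = c[folded M_def]
  note carM = carried_nerve_pair[OF sub \<gamma>, folded M_def]
  note dc = delta_cocycles[OF carriedD(2)[OF carM] c(1)]
  from 0 have "cech_pull (q + 1) P \<gamma> id (coboundary (fst M) c) = cech_pull (q + 1) P \<gamma> id (\<lambda>s. 0)"
    unfolding c(2) cech_delta_pull[OF cl carM c(1)] cech_pull_zero[OF carM] .
  then obtain \<epsilon> t and t' :: "'a set \<Rightarrow> 'a set" where \<epsilon>: "open_cover (fst P) \<epsilon>" and t: "subordinate \<epsilon> \<gamma> id t" and
    d: "(\<lambda>s. pull_cochain (nerve_pair P \<epsilon>) t (coboundary (fst M) c) s - pull_cochain (nerve_pair P \<epsilon>) t' (\<lambda>s. 0) s)
      \<in> coboundaries (nerve_pair P \<epsilon>) (q + 1)"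
    unfolding cech_pull_eq_iff[OF carM dc carM cocycles_zero] by blast
  define N where "N = nerve_pair P \<epsilon>"
  have N: "simplicial_pair N"
    using simplicial_pair_nerve_pair[OF sub] by (simp add: N_def)
  note carN = carried_nerve_pair[OF sub \<epsilon>, folded N_def]
  note carNT = carried_part[OF carN, of Absolute, unfolded part_complex.simps]
  note carNS = carried_part[OF carN, of Subspace, unfolded part_complex.simps]
  note carMS = carried_part[OF carM, of Subspace, unfolded part_complex.simps]
  have sm: "simplicial_map N M t"
    using trace_subordinate_simplicial[OF carM subordinate_trace[OF t]] by (simp add: N_def)
  obtain b where b: "b \<in> cochains N q" "pull_cochain N t (coboundary (fst M) c) = coboundary (fst N) b"
    using d unfolding pull_zero diff_0_right N_def[symmetric] by (auto simp: coboundaries_def)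
  have cM: "c \<in> cochains (snd M, {}) q"
    using c(1) by (simp add: cocycles_iff)
  have c0: "c [] = 0"
    using cochains_Nil[OF cM] carriedD(2)[OF carM] by (simp add: simplicial_pair_def)
  have smT: "simplicial_map (fst N, {}) (fst M, {}) t"
    using sm by (simp add: simplicial_map_def)
  let ?e = "\<lambda>s. pull_cochain N t c s - b s"
  have "pull_cochain N t c = pull_cochain (fst N, {}) t c"
    by (simp add: pull_cochain_def fun_eq_iff)
  with pull_cochains[OF smT cochains_extend_zero[OF cM carriedD(2)[OF carM]]]
  have "pull_cochain N t c \<in> cochains (fst N, {}) q"
    by simp
  moreover have "b \<in> cochains (fst N, {}) q"
    using b(1) by (auto simp: cochains_def)
  ultimately have "?e \<in> cochains (fst N, {}) q"
    by (rule cochains_diff)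
  moreover have "coboundary (fst N) ?e = (\<lambda>s. 0)"
    unfolding coboundary_diff pull_coboundary[where c = c, OF N sm c0] b(2) by simp
  ultimately have e: "?e \<in> cocycles (fst N, {}) q"
    by (simp add: cocycles_iff)
  have "cech_induced q ?S ?T id (cech_pull q ?T \<epsilon> id ?e) = cech_pull q ?S \<epsilon> id ?e"
    by (rule cech_induced_pull[OF part_pair_incl(1) subS carNT e])
  also have "\<dots> = cech_pull q ?S \<epsilon> id (pull_cochain (snd N, {}) t c)"
  proof (rule cech_pull_cong)
    fix s
    assume "set s \<in> inerve \<epsilon> id (topspace (fst ?S))"
    then have "set s \<in> snd N"
      using sub by (simp add: N_def nerve_pair_def nerve_eq_inerve inf_absorb2)
    then show "?e s = pull_cochain (snd N, {}) t c s"
      using cochains_eq_0[OF b(1), of s] N by (auto simp: pull_cochain_def simplicial_pair_def)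
  qed
  also have "\<dots> = y"
    unfolding c(2)
    by (rule cech_pull_natural[OF carNS carMS _ c(1)])
      (use sm t in \<open>auto simp: simplicial_map_def subordinate_def\<close>)
  finally show ?thesis
    using cech_pull_carrier[OF carNT e] by blast
qed

text \<open>The restriction to the subspace is represented by the truncation of \<open>c\<close> to
  the subcomplex. It differs from the cocycle \<open>c\<close> by a relative cochain, so its
  coboundary is a relative coboundary.\<close>

lemma cech_delta_restrict:
  fixes y :: "('a, 'g::ab_group_add) cech_class"
  assumes cl: "closedin (fst P) (snd P)" and y: "y \<in> carrier (cech_cohomology q (part_pair Absolute P))"
  shows "cech_delta q P (cech_induced q (part_pair Subspace P) (part_pair Absolute P) id y) =
    \<one>\<^bsub>cech_cohomology (q + 1) P\<^esub>"
proof -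
  let ?S = "part_pair Subspace P" and ?T = "part_pair Absolute P"
  have sub: "snd P \<subseteq> topspace (fst P)"
    using cl by (rule closedin_subset)
  note subS = part_pair_subset[OF sub, of Subspace] and subT = part_pair_subset[OF sub, of Absolute]
  obtain \<alpha> c where "open_cover (fst ?T) \<alpha>" and c: "c \<in> cocycles (nerve_pair ?T \<alpha>) q" "y = cech_pull q ?T \<alpha> id c"
    using cech_class_cases[OF subT y] .
  then have \<alpha>: "open_cover (fst P) \<alpha>"
    by simp
  define N where "N = nerve_pair P \<alpha>"
  have "nerve_pair ?T \<alpha> = (fst N, {})"
    using nerve_pair_part[OF sub, of Absolute] by (simp add: N_def)
  with c have cN: "c \<in> cocycles (fst N, {}) q"
    by simp
  then have cz: "c \<in> cochains (fst N, {}) q" and dc: "coboundary (fst N) c = (\<lambda>s. 0)"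
    by (simp_all add: cocycles_iff)
  note car = carried_nerve_pair[OF sub \<alpha>, folded N_def]
  note carT = carried_part[OF car, of Absolute, unfolded part_complex.simps]
  note N = carriedD(2)[OF car]
  let ?c = "\<lambda>s. if set s \<in> snd N then c s else 0"
  have c0: "c [] = 0"
    using cochains_Nil[OF cz] carriedD(2)[OF carT] by simp
  have c1: "?c \<in> cochains (snd N, {}) q"
    using cz by (auto simp: cochains_def)
  moreover have "coboundary (snd N) ?c s = 0" for s
  proof (cases "set s \<in> snd N")
    case True
    have "cob ?c s = cob c s"
      by (rule coboundary_subcomplex[of "snd N"]) (use N True c0 in \<open>auto simp: simplicial_pair_def\<close>)
    also have "\<dots> = coboundary (fst N) c s"
      using True N by (auto simp: coboundary_cob simplicial_pair_def)
    finally show ?thesis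
      using True dc by (simp add: coboundary_cob)
  qed (simp add: coboundary_cob)
  ultimately have cS: "?c \<in> cocycles (snd N, {}) q"
    by (auto simp: cocycles_iff)
  have "cech_induced q ?S ?T id y = cech_pull q ?S \<alpha> id c"
    unfolding c(2) by (rule cech_induced_pull[OF part_pair_incl(1) subS carT cN])
  also have "\<dots> = cech_pull q ?S \<alpha> id ?c"
    by (rule cech_pull_cong) (use sub in \<open>auto simp: N_def nerve_pair_def nerve_eq_inerve inf_absorb2\<close>)
  finally have "cech_delta q P (cech_induced q ?S ?T id y) = cech_pull (q + 1) P \<alpha> id (coboundary (fst N) ?c)"
    using cech_delta_pull[OF cl car cS] by simp
  also have "\<dots> = cech_pull (q + 1) P \<alpha> id (\<lambda>s. 0)"
  proof (rule cech_pull_cohomologous[OF car delta_cocycles[OF N cS] cocycles_zero])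
    have "(\<lambda>s. ?c s - c s) \<in> cochains N q"
      using cz by (auto simp: cochains_def)
    then show "(\<lambda>s. coboundary (fst N) ?c s - 0) \<in> coboundaries N (q + 1)"
      using coboundariesI[of "\<lambda>s. ?c s - c s" N "q + 1"] by (simp add: coboundary_diff dc)
  qed
  also have "\<dots> = \<one>\<^bsub>cech_cohomology (q + 1) P\<^esub>"
    by (rule cech_pull_zero[OF car])
  finally show ?thesis .
qed

text \<open>The two nerves coincide, hence every relative cochain is zero. Applied to pairs
  \<open>(K, K)\<close> and to the empty space.\<close>

lemma cech_trivial_pair:
  assumes "snd P = topspace (fst P)" "A \<in> carrier (cech_cohomology q P)"
  shows "A = \<one>\<^bsub>cech_cohomology q P\<^esub>"
proof -
  have sub: "snd P \<subseteq> topspace (fst P)"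
    using assms by simp
  obtain \<alpha> c where \<alpha>: "open_cover (fst P) \<alpha>" and c: "c \<in> cocycles (nerve_pair P \<alpha>) q" "A = cech_pull q P \<alpha> id c"
    using cech_class_cases[OF sub assms(2)] .
  have "c = (\<lambda>s. 0)"
    using c(1) assms(1) by (auto simp: cocycles_iff cochains_def nerve_pair_def)
  then show ?thesis
    using cech_pull_zero[OF carried_nerve_pair[OF sub \<alpha>]] c(2) by simp
qed

section \<open>Finite covers of compact pairs\<close>

lemma finite_subcover:
  assumes "compact_space T" "open_cover T \<gamma>"
  obtains \<delta> where "\<delta> \<subseteq> \<gamma>" "finite \<delta>" "open_cover T \<delta>"
proof -
  obtain \<delta> where "finite \<delta>" "\<delta> \<subseteq> \<gamma>" "topspace T \<subseteq> \<Union>\<delta>"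
    using assms unfolding compact_space_alt open_cover_def by (metis order_refl)
  then show ?thesis
    using that[of \<delta>] assms(2) openin_subset[of T] unfolding open_cover_def by blast
qed

text \<open>The classes live on a part, but the cover found is finite and covers the whole space:
  its nerve pair is to become a finite polyhedral pair into which the whole pair is mapped.\<close>

lemma cech_pull_part_eqD:
  assumes cl: "closedin (fst P) (snd P)" and comp: "compact_space (fst P)"
    and car: "carried P I W NM" "carried P J W' NM'"
    and c: "c \<in> cocycles (part_complex k NM) q" "c' \<in> cocycles (part_complex k NM') q"
    and eq: "cech_pull q (part_pair k P) I W c = cech_pull q (part_pair k P) J W' c'"
  obtains \<gamma> v v' where "finite \<gamma>" "open_cover (fst P) \<gamma>" "subordinate \<gamma> I W v" "subordinate \<gamma> J W' v'"
    "(\<lambda>s. pull_cochain (part_complex k (nerve_pair P \<gamma>)) v c s - pull_cochain (part_complex k (nerve_pair P \<gamma>)) v' c' s)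
      \<in> coboundaries (part_complex k (nerve_pair P \<gamma>)) q"
proof -
  let ?P = "part_pair k P" let ?S = "topspace (fst ?P)"
  note sub = carriedD(1)[OF car(1)]
  note cark = carried_part[OF car(1), of k] carried_part[OF car(2), of k]
  obtain \<gamma>\<^sub>0 t t' where \<gamma>\<^sub>0: "open_cover (fst ?P) \<gamma>\<^sub>0" "subordinate \<gamma>\<^sub>0 I W t" "subordinate \<gamma>\<^sub>0 J W' t'"
    "(\<lambda>s. pull_cochain (nerve_pair ?P \<gamma>\<^sub>0) t c s - pull_cochain (nerve_pair ?P \<gamma>\<^sub>0) t' c' s)
      \<in> coboundaries (nerve_pair ?P \<gamma>\<^sub>0) q"
    using eq unfolding cech_pull_eq_iff[OF cark(1) c(1) cark(2) c(2)] by blast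
  obtain \<beta> p \<beta>' p' where \<beta>: "open_cover (fst P) \<beta>" "subordinate \<beta> I W p"
    and \<beta>': "open_cover (fst P) \<beta>'" "subordinate \<beta>' J W' p'"
    using car unfolding carried_def by blast
  obtain \<delta> u u' where \<delta>: "open_cover (fst P) \<delta>" "subordinate \<delta> \<beta> id u" "subordinate \<delta> \<beta>' id u'"
    using common_refinement[OF \<beta>(1) \<beta>'(1)] .
  have "fst ?P = subtopology (fst P) ?S"
    using sub by (cases k) (simp_all add: inf_absorb2)
  with \<gamma>\<^sub>0(1) have "open_cover (subtopology (fst P) ?S) \<gamma>\<^sub>0"
    by simp
  from open_cover_trace[OF closed_part[OF cl] this \<delta>(1)] obtain \<gamma>\<^sub>1 r \<pi> where
    \<gamma>\<^sub>1: "open_cover (fst P) \<gamma>\<^sub>1" "subordinate \<gamma>\<^sub>1 \<delta> id r"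
    and \<pi>: "\<And>V. \<lbrakk>V \<in> \<gamma>\<^sub>1; V \<inter> ?S \<noteq> {}\<rbrakk> \<Longrightarrow> \<pi> V \<in> \<gamma>\<^sub>0 \<and> V \<inter> ?S \<subseteq> \<pi> V"
    by metis
  obtain \<gamma> where \<gamma>: "\<gamma> \<subseteq> \<gamma>\<^sub>1" "finite \<gamma>" "open_cover (fst P) \<gamma>"
    using finite_subcover[OF comp \<gamma>\<^sub>1(1)] .
  have r: "subordinate \<gamma> \<delta> id r"
    using \<gamma>\<^sub>1(2) \<gamma>(1) unfolding subordinate_def by blast
  have tr: "trace_subordinate ?P \<gamma> \<gamma>\<^sub>0 id \<pi>"
    using \<pi> \<gamma>(1) unfolding trace_subordinate_def id_def by blast
  define v v' where "v = p \<circ> u \<circ> r" and "v' = p' \<circ> u' \<circ> r"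
  have v: "subordinate \<gamma> I W v" "subordinate \<gamma> J W' v'"
    using subordinate_comp[OF r subordinate_comp[OF \<delta>(2) \<beta>(2)]]
      subordinate_comp[OF r subordinate_comp[OF \<delta>(3) \<beta>'(2)]] by (auto simp: v_def v'_def o_assoc)
  show ?thesis
    using that[OF \<gamma>(2,3) v] cohomologous_refine[OF cark(1) c(1) cark(2) c(2) subordinate_trace[OF \<gamma>\<^sub>0(2)]
      subordinate_trace[OF \<gamma>\<^sub>0(3)] \<gamma>\<^sub>0(4,1) tr subordinate_trace[OF v(1)] subordinate_trace[OF v(2)]]
    unfolding nerve_pair_part[OF sub] .
qed


section \<open>Polyhedra\<close>

text \<open>Points in barycentric coordinates. With natural numbers as vertices the realization lies
  in \<open>nat \<Rightarrow> real\<close>, the left summand of \<open>cw_universe\<close>.\<close>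

definition realization :: "nat set set \<Rightarrow> (nat \<Rightarrow> real) set" where
  "realization N = {y. (\<forall>v. 0 \<le> y v) \<and> {v. y v \<noteq> 0} \<in> N \<and> sum y {v. y v \<noteq> 0} = 1}"

text \<open>The topology of coordinatewise convergence; for a finite complex it is also the weak
  topology with respect to the cells.\<close>

definition poly_space :: "nat set set \<Rightarrow> 'u cw_universe topology" where
  "poly_space N = pullback_topology (Inl ` realization N) projl (powertop_real UNIV)"

definition poly_pair :: "nat set set \<times> nat set set \<Rightarrow> 'u cw_universe spair" where
  "poly_pair NM = (poly_space (fst NM), Inl ` realization (snd NM))"

text \<open>The preimage under \<open>f\<close> of the open star of the vertex
  \<open>v\<close>.\<close>

definition star :: "('a \<Rightarrow> 'u cw_universe) \<Rightarrow> nat \<Rightarrow> 'a set" where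
  "star f v = {z. 0 < projl (f z) v}"

lemma realizationI:
  assumes "abstract_complex N" "\<rho> \<in> N" "\<And>v. 0 \<le> y v" "\<And>v. y v \<noteq> 0 \<Longrightarrow> v \<in> \<rho>" "sum y \<rho> = 1"
  shows "y \<in> realization N"
proof -
  have sub: "{v. y v \<noteq> 0} \<subseteq> \<rho>" and fin: "finite \<rho>"
    using assms(1,2,4) by (auto simp: abstract_complex_def)
  have "sum y {v. y v \<noteq> 0} = sum y \<rho>"
    by (rule sum.mono_neutral_left[OF fin sub]) auto
  moreover have "{v. y v \<noteq> 0} \<noteq> {}"
    using assms(5) by (metis (mono_tags, lifting) empty_iff mem_Collect_eq sum.neutral zero_neq_one)
  ultimately show ?thesis
    using assms sub abstract_complex_face[OF assms(1,2) sub] by (simp add: realization_def)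
qed

lemma realization_sum:
  assumes "y \<in> realization N" "finite \<rho>" "{v. y v \<noteq> 0} \<subseteq> \<rho>"
  shows "sum y \<rho> = 1"
  using assms sum.mono_neutral_left[OF assms(2,3), of y] by (auto simp: realization_def)

lemma realization_nonneg: "y \<in> realization N \<Longrightarrow> 0 \<le> y v"
  by (simp add: realization_def)

lemma realization_support: "y \<in> realization N \<Longrightarrow> {v. y v \<noteq> 0} \<in> N"
  by (simp add: realization_def)

lemma realization_mono: "M \<subseteq> N \<Longrightarrow> realization M \<subseteq> realization N"
  by (auto simp: realization_def)

lemma topspace_poly_space [simp]: "topspace (poly_space N) = Inl ` realization N"
  by (auto simp: poly_space_def topspace_pullback_topology)

lemma continuous_map_poly_space:
  "continuous_map T (poly_space N) f \<longleftrightarrow>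
     f ` topspace T \<subseteq> Inl ` realization N \<and> (\<forall>v. continuous_map T euclideanreal (\<lambda>z. projl (f z) v))"
proof
  assume f: "continuous_map T (poly_space N) f"
  have "continuous_map (poly_space N) (powertop_real UNIV) (id \<circ> projl)"
    unfolding poly_space_def by (rule continuous_map_pullback) simp
  from continuous_map_compose[OF f this] show "f ` topspace T \<subseteq> Inl ` realization N \<and>
      (\<forall>v. continuous_map T euclideanreal (\<lambda>z. projl (f z) v))"
    using continuous_map_image_subset_topspace[OF f]
    by (simp add: continuous_map_componentwise_UNIV o_def)
next
  assume f: "f ` topspace T \<subseteq> Inl ` realization N \<and>
      (\<forall>v. continuous_map T euclideanreal (\<lambda>z. projl (f z) v))"
  show "continuous_map T (poly_space N) f"
    unfolding poly_space_def
    by (rule continuous_map_pullback')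
      (use f in \<open>auto simp: continuous_map_componentwise_UNIV\<close>)
qed

lemma continuous_map_coordinate: "continuous_map (poly_space N) euclideanreal (\<lambda>z. projl z v)"
    (is "continuous_map ?P _ _")
proof -
  have "continuous_map ?P ?P (\<lambda>z. z)"
    by simp
  then show ?thesis
    unfolding continuous_map_poly_space by blast
qed

lemma Hausdorff_poly_space: "Hausdorff_space (poly_space N)"
proof (rule Hausdorff_space_injective_preimage)
  show "continuous_map (poly_space N) (powertop_real UNIV) projl"
    by (simp add: continuous_map_componentwise_UNIV continuous_map_coordinate)
  show "inj_on projl (topspace (poly_space N))"
    by (auto simp: inj_on_def)
  show "Hausdorff_space (powertop_real (UNIV :: nat set))"
    by (simp add: Hausdorff_space_product_topology)
qed

lemma pair_map_poly:
  assumes "pair_map P (poly_pair NM) f"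
  shows "z \<in> topspace (fst P) \<Longrightarrow> f z \<in> Inl ` realization (fst NM)"
    and "z \<in> snd P \<Longrightarrow> f z \<in> Inl ` realization (snd NM)"
    and "continuous_map (fst P) euclideanreal (\<lambda>z. projl (f z) v)"
  using assms by (auto simp: pair_map_def poly_pair_def continuous_map_poly_space)

text \<open>The positive coordinates of a point of the realization form a nonempty simplex. As a
  simplex they bound the nerve of the stars; being nonempty they make the stars a cover.\<close>

lemma carried_star:
  assumes "pair_map P (poly_pair NM) f" "snd P \<subseteq> topspace (fst P)" "simplicial_pair NM"
  shows "carried P UNIV (star f) NM"
proof -
  have sub: "inerve UNIV (star f) S \<subseteq> N"
    if "f ` S \<subseteq> Inl ` realization N" "abstract_complex N" for S N
  proof
    fix \<sigma> assume "\<sigma> \<in> inerve UNIV (star f) S"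
    then obtain z where z: "z \<in> S" "\<And>v. v \<in> \<sigma> \<Longrightarrow> 0 < projl (f z) v" and "\<sigma> \<noteq> {}"
      by (auto simp: inerve_def star_def)
    moreover have "{v. projl (f z) v \<noteq> 0} \<in> N"
      using that(1) z(1) realization_support by fastforce
    moreover have "\<sigma> \<subseteq> {v. projl (f z) v \<noteq> 0}"
      using z(2) by fastforce
    ultimately show "\<sigma> \<in> N"
      using abstract_complex_face[OF that(2)] by blast
  qed
  \<comment> \<open>Cut down to the space, the star is open; outside the space the values of
    \<open>f\<close> are arbitrary.\<close>
  define G where "G v = {z \<in> topspace (fst P). projl (f z) v \<in> {0<..}}" for v
  have "openin (fst P) (G v)" for v
    unfolding G_def by (rule openin_continuous_map_preimage[OF pair_map_poly(3)[OF assms(1)]]) simp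
  moreover have "\<exists>v. z \<in> G v" if "z \<in> topspace (fst P)" for z
  proof -
    obtain y where y: "f z = Inl y" "y \<in> realization (fst NM)"
      using pair_map_poly(1)[OF assms(1) \<open>z \<in> topspace (fst P)\<close>] by blast
    then have "{v. y v \<noteq> 0} \<noteq> {}"
      using realization_support[of y] assms(3) abstract_complex_not_empty
      by (metis simplicial_pair_def)
    then show ?thesis
      using y that realization_nonneg[OF y(2)] by (force simp: G_def less_le)
  qed
  ultimately have "open_cover (fst P) (range G)"
    by (auto simp: open_cover_def G_def)
  moreover have "subordinate (range G) UNIV (star f) (inv_into UNIV G)"
    unfolding subordinate_def
    by (intro ballI conjI UNIV_I) (metis (mono_tags, lifting) G_def f_inv_into_f greaterThan_iff mem_Collect_eq star_def subsetI)
  ultimately show ?thesis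
    using assms(2,3) sub[of "topspace (fst P)" "fst NM"] sub[of "snd P" "snd NM"] pair_map_poly(1,2)[OF assms(1)]
    unfolding carried_def simplicial_pair_def by blast
qed

section \<open>Homotopy invariance of classes along maps into a polyhedron\<close>

lemma pair_homotopic_poly_imp:
  assumes "pair_homotopic P (poly_pair NM) f g"
  obtains h where "continuous_map (prod_topology (top_of_set {0..1::real}) (fst P)) (poly_space (fst NM)) h"
    "\<And>x. h (0, x) = f x" "\<And>x. h (1, x) = g x" "\<And>t. t \<in> {0..1} \<Longrightarrow> pair_map P (poly_pair NM) (\<lambda>x. h (t, x))"
proof -
  obtain h where h: "continuous_map (prod_topology (top_of_set {0..1::real}) (fst P)) (poly_space (fst NM)) h"
    "\<forall>x. h (0, x) = f x" "\<forall>x. h (1, x) = g x"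
    "\<forall>t\<in>{0..1}. (\<lambda>x. h (t, x)) ` snd P \<subseteq> Inl ` realization (snd NM)"
    using assms by (auto simp: pair_homotopic_def homotopic_with_def poly_pair_def)
  have "continuous_map (fst P) (poly_space (fst NM)) (\<lambda>x. h (t, x))" if "t \<in> {0..1}" for t
    using continuous_map_o_Pair[OF h(1), of t] that by (simp add: o_def)
  then show ?thesis
    using that[of h] h by (simp add: pair_map_def poly_pair_def)
qed

text \<open>A tube argument: near \<open>(s, z)\<close> some coordinate stays positive on a product
  of \<open>A z\<close> and \<open>B z\<close>. Finitely many sets \<open>B z\<close> cover the
  space, and for \<open>t\<close> in the intersection of the corresponding \<open>A z\<close> one
  choice of vertices works at both times \<open>s\<close> and \<open>t\<close>.\<close>

lemma homotopy_cover:
  assumes comp: "compact_space T" and N: "abstract_complex N"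
    and h: "continuous_map (prod_topology (top_of_set {0..1::real}) T) (poly_space N) h" and s: "s \<in> {0..1}"
  obtains A where "openin (top_of_set {0..1}) A" "s \<in> A"
    "\<And>t. t \<in> A \<Longrightarrow> \<exists>\<beta> p. open_cover T \<beta> \<and> subordinate \<beta> UNIV (star (\<lambda>x. h (s, x))) p \<and>
      subordinate \<beta> UNIV (star (\<lambda>x. h (t, x))) p"
proof -
  have "\<exists>A B v. openin (top_of_set {0..1}) A \<and> openin T B \<and> s \<in> A \<and> z \<in> B \<and>
      (\<forall>t\<in>A. \<forall>x\<in>B. 0 < projl (h (t, x)) v)" if z: "z \<in> topspace T" for z
  proof -
    have top: "(s, z) \<in> topspace (prod_topology (top_of_set {0..1::real}) T)"
      using s z by simp
    then obtain y where y: "h (s, z) = Inl y" "y \<in> realization N"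
      using h unfolding continuous_map_poly_space by blast
    then have "{v. y v \<noteq> 0} \<noteq> {}"
      using realization_support[of y] abstract_complex_not_empty[OF N] by metis
    then obtain v where v: "0 < projl (h (s, z)) v"
      using realization_nonneg[OF y(2)] y(1) by (force simp: less_le)
    let ?G = "{w \<in> topspace (prod_topology (top_of_set {0..1::real}) T). projl (h w) v \<in> {0<..}}"
    have "openin (prod_topology (top_of_set {0..1::real}) T) ?G"
      using h by (intro openin_continuous_map_preimage) (auto simp: continuous_map_poly_space)
    moreover have "(s, z) \<in> ?G"
      using v top by simp
    ultimately obtain A B where "openin (top_of_set {0..1}) A" "openin T B" "s \<in> A" "z \<in> B" "A \<times> B \<subseteq> ?G"
      unfolding openin_prod_topology_alt by meson
    then show ?thesis by blast
  qed
  then obtain A B v where AB: "\<And>z. z \<in> topspace T \<Longrightarrow> openin (top_of_set {0..1}) (A z) \<and> openin T (B z) \<and>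
      s \<in> A z \<and> z \<in> B z \<and> (\<forall>t\<in>A z. \<forall>x\<in>B z. 0 < projl (h (t, x)) (v z))"
    by metis
  have "open_cover T (B ` topspace T)"
    using AB openin_subset[of T] unfolding open_cover_def by blast
  from finite_subcover[OF comp this] obtain \<beta> where \<beta>: "\<beta> \<subseteq> B ` topspace T" "finite \<beta>" "open_cover T \<beta>" .
  then obtain F where F: "F \<subseteq> topspace T" "finite F" "\<beta> = B ` F"
    by (metis finite_subset_image)
  \<comment> \<open>For an empty space \<open>F\<close> can be empty and its intersection is
    everything, hence the interval in front.\<close>
  let ?A = "{0..1} \<inter> (\<Inter>z\<in>F. A z)"
  have opA: "openin (top_of_set {0..1}) ?A"
    using F AB by (cases "F = {}") (auto intro!: openin_Int openin_INT2)
  define p where "p V = v (SOME z. z \<in> F \<and> B z = V)" for V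
  have p: "subordinate \<beta> UNIV (star (\<lambda>x. h (t, x))) p" if "t \<in> ?A" for t
    unfolding subordinate_def
  proof (intro ballI conjI UNIV_I subsetI)
    fix V x assume V: "V \<in> \<beta>" "x \<in> V"
    let ?z = "SOME z. z \<in> F \<and> B z = V"
    have "?z \<in> F \<and> B ?z = V"
      using V(1) F(3) by (intro someI_ex[of "\<lambda>z. z \<in> F \<and> B z = V"]) blast
    then show "x \<in> star (\<lambda>x. h (t, x)) (p V)"
      using AB[of ?z] that F(1) V(2) by (auto simp: star_def p_def)
  qed
  have "s \<in> ?A"
    using s F AB by auto
  then show ?thesis
    using that[OF opA] p \<beta>(3) by blast
qed

text \<open>The class along \<open>\<lambda>x. h (t, x)\<close> is locally constant in
  \<open>t\<close>, because \<open>homotopy_cover\<close> gives one cover with one projection for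
  \<open>s\<close> and a nearby \<open>t\<close>; the interval is connected.\<close>

lemma cech_pull_homotopic:
  assumes comp: "compact_space (fst P)" and sub: "snd P \<subseteq> topspace (fst P)" and NM: "simplicial_pair NM"
    and c: "c \<in> cocycles (part_complex k NM) q" and fg: "pair_homotopic P (poly_pair NM) f g"
  shows "cech_pull q (part_pair k P) UNIV (star f) c = cech_pull q (part_pair k P) UNIV (star g) c"
proof -
  obtain h where h: "continuous_map (prod_topology (top_of_set {0..1::real}) (fst P)) (poly_space (fst NM)) h"
    "\<And>x. h (0, x) = f x" "\<And>x. h (1, x) = g x" "\<And>t. t \<in> {0..1} \<Longrightarrow> pair_map P (poly_pair NM) (\<lambda>x. h (t, x))"
    by (rule pair_homotopic_poly_imp[OF fg]) blast
  define \<Phi> where "\<Phi> t = cech_pull q (part_pair k P) UNIV (star (\<lambda>x. h (t, x))) c" for t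
  have car: "carried (part_pair k P) UNIV (star (\<lambda>x. h (t, x))) (part_complex k NM)" if "t \<in> {0..1}" for t
    by (rule carried_part[OF carried_star[OF h(4)[OF that] sub NM]])
  have "\<forall>s\<in>{0..1}. eventually (\<lambda>t. \<Phi> s = \<Phi> t) (at s within {0..1})"
  proof
    fix s :: real assume s: "s \<in> {0..1}"
    obtain A where A: "openin (top_of_set {0..1}) A" "s \<in> A"
      and *: "\<And>t. t \<in> A \<Longrightarrow> \<exists>\<beta> p. open_cover (fst P) \<beta> \<and> subordinate \<beta> UNIV (star (\<lambda>x. h (s, x))) p \<and>
        subordinate \<beta> UNIV (star (\<lambda>x. h (t, x))) p"
      using homotopy_cover[OF comp _ h(1) s] NM by (auto simp: simplicial_pair_def)
    have "\<Phi> s = \<Phi> t" if t: "t \<in> A" for t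
    proof -
      have t01: "t \<in> {0..1}"
        using openin_imp_subset[OF A(1)] t by blast
      obtain \<beta> p where \<beta>: "open_cover (fst P) \<beta>" "subordinate \<beta> UNIV (star (\<lambda>x. h (s, x))) p"
        "subordinate \<beta> UNIV (star (\<lambda>x. h (t, x))) p"
        using *[OF t] by blast
      have "pair_map (part_pair k P) P id"
        using sub by (cases k) (auto simp: pair_map_def continuous_map_from_subtopology)
      from open_cover_pair_map[OF this \<beta>(1)] obtain \<beta>' \<pi> where
        \<beta>': "open_cover (fst (part_pair k P)) \<beta>'" "subordinate \<beta>' \<beta> id \<pi>" .
      show ?thesis
        unfolding \<Phi>_def cech_pull_eq[OF car[OF s] c \<beta>'(1) subordinate_comp[OF \<beta>'(2) \<beta>(2)]]
          cech_pull_eq[OF car[OF t01] c \<beta>'(1) subordinate_comp[OF \<beta>'(2) \<beta>(3)]] ..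
    qed
    moreover obtain S where "open S" "A = {0..1} \<inter> S"
      using A(1) by (auto simp: openin_open)
    ultimately show "eventually (\<lambda>t. \<Phi> s = \<Phi> t) (at s within {0..1})"
      unfolding eventually_at_topological using A(2) by blast
  qed
  then have "\<Phi> 0 = \<Phi> 1"
    by (intro connected_local_const[of "{0..1::real}"]) auto
  then show ?thesis
    by (simp add: \<Phi>_def h(2,3))
qed

text \<open>At each point both images lie in the closed simplex on \<rho>, which is convex.\<close>

lemma straight_line_homotopic:
  assumes f: "pair_map P (poly_pair NM) f" and g: "pair_map P (poly_pair NM) g" and NM: "simplicial_pair NM"
    and 1: "\<And>z. z \<in> topspace (fst P) \<Longrightarrow>
      \<exists>\<rho>\<in>fst NM. {v. projl (f z) v \<noteq> 0} \<subseteq> \<rho> \<and> {v. projl (g z) v \<noteq> 0} \<subseteq> \<rho>"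
    and 2: "\<And>z. z \<in> snd P \<Longrightarrow>
      \<exists>\<rho>\<in>snd NM. {v. projl (f z) v \<noteq> 0} \<subseteq> \<rho> \<and> {v. projl (g z) v \<noteq> 0} \<subseteq> \<rho>"
    and sub: "snd P \<subseteq> topspace (fst P)"
  shows "pair_homotopic P (poly_pair NM) f g"
proof -
  define h where "h = (\<lambda>(t::real, z). Inl (\<lambda>v. (1 - t) * projl (f z) v + t * projl (g z) v) :: 'b cw_universe)"
  have mem: "h (t, z) \<in> Inl ` realization N"
    if t: "t \<in> {0..1}" and N: "abstract_complex N" and fz: "f z \<in> Inl ` realization N" and gz: "g z \<in> Inl ` realization N"
      and \<rho>: "\<exists>\<rho>\<in>N. {v. projl (f z) v \<noteq> 0} \<subseteq> \<rho> \<and> {v. projl (g z) v \<noteq> 0} \<subseteq> \<rho>" for t z N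
  proof -
    obtain y y' where y: "f z = Inl y" "y \<in> realization N" and y': "g z = Inl y'" "y' \<in> realization N"
      using fz gz by blast
    obtain \<rho> where \<rho>: "\<rho> \<in> N" "{v. y v \<noteq> 0} \<subseteq> \<rho>" "{v. y' v \<noteq> 0} \<subseteq> \<rho>"
      using \<rho> y(1) y'(1) by auto
    have fin: "finite \<rho>"
      using N \<rho>(1) by (simp add: abstract_complex_def)
    have "(\<lambda>v. (1 - t) * y v + t * y' v) \<in> realization N"
    proof (rule realizationI[OF N \<rho>(1)])
      show "0 \<le> (1 - t) * y v + t * y' v" for v
        using t realization_nonneg[OF y(2), of v] realization_nonneg[OF y'(2), of v] by simp
      show "v \<in> \<rho>" if "(1 - t) * y v + t * y' v \<noteq> 0" for v
        using that \<rho>(2,3) by (cases "y v = 0"; cases "y' v = 0") auto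
      show "(\<Sum>v\<in>\<rho>. (1 - t) * y v + t * y' v) = 1"
        using realization_sum[OF y(2) fin \<rho>(2)] realization_sum[OF y'(2) fin \<rho>(3)]
        by (simp add: sum.distrib flip: sum_distrib_left)
    qed
    then show ?thesis
      by (auto simp: h_def y(1) y'(1))
  qed
  have sN: "abstract_complex (fst NM)" "abstract_complex (snd NM)"
    using NM by (auto simp: simplicial_pair_def)
  let ?X = "prod_topology (top_of_set {0..1::real}) (fst P)"
  have t: "continuous_map ?X euclideanreal fst"
    using continuous_map_fst continuous_map_into_fulltopology by blast
  have cont: "continuous_map ?X (poly_space (fst NM)) h"
    unfolding continuous_map_poly_space
  proof (intro conjI allI)
    show "h ` topspace ?X \<subseteq> Inl ` realization (fst NM)"
      using mem[OF _ sN(1) pair_map_poly(1)[OF f] pair_map_poly(1)[OF g] 1] by auto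
    fix v
    have "continuous_map ?X euclideanreal (\<lambda>w. projl (f (snd w)) v)" "continuous_map ?X euclideanreal (\<lambda>w. projl (g (snd w)) v)"
      using continuous_map_compose[OF continuous_map_snd pair_map_poly(3)[OF f]]
        continuous_map_compose[OF continuous_map_snd pair_map_poly(3)[OF g]] by (auto simp: o_def)
    then have "continuous_map ?X euclideanreal (\<lambda>w. (1 - fst w) * projl (f (snd w)) v + fst w * projl (g (snd w)) v)"
      using t by (intro continuous_intros) auto
    then show "continuous_map ?X euclideanreal (\<lambda>w. projl (h w) v)"
      by (simp add: h_def case_prod_unfold)
  qed
  have end1: "h (0, z) = f z" "h (1, z) = g z" if "z \<in> topspace (fst P)" for z
    using pair_map_poly(1)[OF f that] pair_map_poly(1)[OF g that] by (auto simp: h_def)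
  have sndM: "(\<lambda>x. h (t, x)) ` snd P \<subseteq> Inl ` realization (snd NM)" if "t \<in> {0..1}" for t
    using mem[OF that sN(2) pair_map_poly(2)[OF f] pair_map_poly(2)[OF g] 2] by auto
  show ?thesis
    unfolding pair_homotopic_def
  \<comment> \<open>The ends of \<open>h\<close> are \<open>f\<close> and \<open>g\<close> on the
    space only, since elsewhere these may leave the summand \<open>Inl\<close>. The characterization
    of \<open>homotopic_with\<close> by values on the space applies, as the condition on
    \<open>snd P\<close> depends on these values alone.\<close>
  proof (subst homotopic_with)
    show "(h ` snd P \<subseteq> snd (poly_pair NM)) = (k ` snd P \<subseteq> snd (poly_pair NM))"
      if "\<And>x. x \<in> topspace (fst P) \<Longrightarrow> h x = k x" for h k :: "'a \<Rightarrow> 'b cw_universe"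
    proof -
      have "h ` snd P = k ` snd P"
        using that sub by (intro image_cong) auto
      then show ?thesis by simp
    qed
    show "\<exists>h. continuous_map ?X (fst (poly_pair NM)) h \<and> (\<forall>x\<in>topspace (fst P). h (0, x) = f x) \<and>
        (\<forall>x\<in>topspace (fst P). h (1, x) = g x) \<and> (\<forall>t\<in>{0..1}. (\<lambda>x. h (t, x)) ` snd P \<subseteq> snd (poly_pair NM))"
      using cont end1 sndM by (intro exI[of _ h]) (simp add: poly_pair_def)
  qed
qed

subsection \<open>Canonical maps and simplicial maps\<close>

text \<open>Complete regularity gives at each point a bump that vanishes outside one of the sets;
  finitely many positivity sets of bumps cover. The bumps assigned to the same index are added, and
  the sums are normalized.\<close>

lemma partition_of_unity:
  assumes comp: "compact_space T" and Haus: "Hausdorff_space T"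
    and op: "\<And>i. i < n \<Longrightarrow> openin T (W i)" and cov: "topspace T \<subseteq> (\<Union>i<n. W i)"
  obtains \<tau> :: "'a \<Rightarrow> nat \<Rightarrow> real" where "\<And>i. continuous_map T euclideanreal (\<lambda>z. \<tau> z i)"
    "\<And>z i. 0 \<le> \<tau> z i" "\<And>z i. \<lbrakk>z \<in> topspace T; \<tau> z i \<noteq> 0\<rbrakk> \<Longrightarrow> i < n \<and> z \<in> W i"
    "\<And>z. z \<in> topspace T \<Longrightarrow> (\<Sum>i<n. \<tau> z i) = 1"
proof -
  have creg: "completely_regular_space T"
    using comp Haus compact_Hausdorff_or_regular_imp_normal_space normal_imp_completely_regular_space by blast
  have "\<exists>i g. i < n \<and> continuous_map T euclideanreal g \<and> (\<forall>x. 0 \<le> g x) \<and> 0 < g z \<and> (\<forall>x\<in>topspace T. g x \<noteq> 0 \<longrightarrow> x \<in> W i)"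
    if z: "z \<in> topspace T" for z
  proof -
    obtain i where i: "i < n" "z \<in> W i"
      using cov z by blast
    then have "closedin T (topspace T - W i)" "z \<in> topspace T - (topspace T - W i)"
      using op[OF i(1)] z by auto
    then obtain f :: "'a \<Rightarrow> real" where f: "continuous_map T (top_of_set {0..1}) f" "f z = 0" "f ` (topspace T - W i) \<subseteq> {1}"
      using creg unfolding completely_regular_space_def by meson
    have "continuous_map T euclideanreal f"
      using f(1) continuous_map_into_fulltopology by blast
    \<comment> \<open>The values of \<open>f\<close> are controlled on the space only; the maximum
      makes the bump nonnegative everywhere.\<close>
    then have "continuous_map T euclideanreal (\<lambda>x. max 0 (1 - f x))"
      by (intro continuous_intros) auto
    then show ?thesis
      using i(1) f(2,3) by (intro exI[of _ i] exI[of _ "\<lambda>x. max 0 (1 - f x)"]) (auto simp: max_def)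
  qed
  then obtain ix g where ig: "\<And>z. z \<in> topspace T \<Longrightarrow> ix z < n \<and> continuous_map T euclideanreal (g z) \<and> (\<forall>x. 0 \<le> g z x) \<and>
      0 < g z z \<and> (\<forall>x\<in>topspace T. g z x \<noteq> 0 \<longrightarrow> x \<in> W (ix z))"
    by metis
  define B where "B z = {x \<in> topspace T. g z x \<in> {0<..}}" for z
  have "openin T (B z)" if "z \<in> topspace T" for z
    unfolding B_def using ig[OF that] by (intro openin_continuous_map_preimage) auto
  moreover have "z \<in> B z" if "z \<in> topspace T" for z
    using ig[OF that] that by (simp add: B_def)
  ultimately have "open_cover T (B ` topspace T)"
    unfolding open_cover_def B_def by blast
  from finite_subcover[OF comp this] obtain \<beta> where \<beta>: "\<beta> \<subseteq> B ` topspace T" "finite \<beta>" "open_cover T \<beta>" .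
  then obtain F where F: "F \<subseteq> topspace T" "finite F" "\<beta> = B ` F"
    by (metis finite_subset_image)
  define S where "S x = (\<Sum>z\<in>F. g z x)" for x
  define R where "R x i = (\<Sum>z\<in>{z\<in>F. ix z = i}. g z x)" for x i
  have g0: "0 \<le> g z x" if "z \<in> F" for z x
    using ig[of z] F(1) that by blast
  have S: "0 < S x" if x: "x \<in> topspace T" for x
  proof -
    obtain z where "z \<in> F" "x \<in> B z"
      using x \<beta>(3) F(3) by (auto simp: open_cover_def)
    then show ?thesis
      unfolding S_def using F(2) g0 by (intro sum_pos2[of F z]) (auto simp: B_def)
  qed
  have cS: "continuous_map T euclideanreal S" and cR: "continuous_map T euclideanreal (\<lambda>x. R x i)" for i
    unfolding S_def R_def using F ig by (auto intro!: continuous_map_sum)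
  define \<tau> where "\<tau> x i = R x i / S x" for x i
  show ?thesis
  proof
    show "continuous_map T euclideanreal (\<lambda>z. \<tau> z i)" for i
      unfolding \<tau>_def using S by (intro continuous_map_real_divide cR cS) fastforce
    show "0 \<le> \<tau> z i" for z i
      unfolding \<tau>_def R_def S_def using g0 by (intro divide_nonneg_nonneg sum_nonneg) auto
    show "i < n \<and> z \<in> W i" if z: "z \<in> topspace T" and "\<tau> z i \<noteq> 0" for z i
    proof -
      have "R z i \<noteq> 0"
        using that by (auto simp: \<tau>_def)
      then obtain y where "y \<in> F" "ix y = i" "g y z \<noteq> 0"
        unfolding R_def by (elim sum.not_neutral_contains_not_neutral) auto
      then show ?thesis
        using ig[of y] F(1) z by blast
    qed
    show "(\<Sum>i<n. \<tau> z i) = 1" if z: "z \<in> topspace T" for z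
    proof -
      have "(\<Sum>i<n. R z i) = S z"
        unfolding R_def S_def using F ig by (intro sum.group) auto
      then show ?thesis
        using S[OF z] by (simp add: \<tau>_def flip: sum_divide_distrib)
    qed
  qed
qed

text \<open>The coordinates that are nonzero at \<open>z\<close> belong to sets containing
  \<open>z\<close>, and all such sets together span a simplex of the nerve, for \<open>z\<close> in
  the subspace even of the nerve of the subspace.\<close>

lemma canonical_map:
  assumes comp: "compact_space (fst P)" and Haus: "Hausdorff_space (fst P)" and sub: "snd P \<subseteq> topspace (fst P)"
    and op: "\<And>i. i < n \<Longrightarrow> openin (fst P) (W i)" and cov: "topspace (fst P) \<subseteq> (\<Union>i<n. W i)"
  obtains \<tau> :: "'a \<Rightarrow> 'u cw_universe"
  where "pair_map P (poly_pair (inerve {..<n} W (topspace (fst P)), inerve {..<n} W (snd P))) \<tau>"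
    "\<And>z i. \<lbrakk>z \<in> topspace (fst P); projl (\<tau> z) i \<noteq> 0\<rbrakk> \<Longrightarrow> i < n \<and> z \<in> W i"
proof -
  obtain \<tau> :: "'a \<Rightarrow> nat \<Rightarrow> real" where \<tau>: "\<And>i. continuous_map (fst P) euclideanreal (\<lambda>z. \<tau> z i)"
    "\<And>z i. 0 \<le> \<tau> z i" "\<And>z i. \<lbrakk>z \<in> topspace (fst P); \<tau> z i \<noteq> 0\<rbrakk> \<Longrightarrow> i < n \<and> z \<in> W i"
    "\<And>z. z \<in> topspace (fst P) \<Longrightarrow> (\<Sum>i<n. \<tau> z i) = 1"
    using partition_of_unity[OF comp Haus op cov] by blast
  have mem: "\<tau> z \<in> realization (inerve {..<n} W S)" if "z \<in> S" "S \<subseteq> topspace (fst P)" for z S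
  proof -
    have z: "z \<in> topspace (fst P)"
      using that by blast
    let ?\<rho> = "{i. i < n \<and> z \<in> W i}"
    have "sum (\<tau> z) ?\<rho> = sum (\<tau> z) {..<n}"
      by (rule sum.mono_neutral_left) (use \<tau>(3)[OF z] in auto)
    with \<tau>(4)[OF z] have s: "sum (\<tau> z) ?\<rho> = 1"
      by simp
    then have "?\<rho> \<noteq> {}"
      by (metis sum.empty zero_neq_one)
    then have "?\<rho> \<in> inerve {..<n} W S"
      using that by (auto simp: inerve_def)
    from realizationI[OF abstract_complex_inerve this \<tau>(2) _ s] show ?thesis
      using \<tau>(3)[OF z] by blast
  qed
  show ?thesis
  proof (rule that[of "\<lambda>z. Inl (\<tau> z)"])
    show "pair_map P (poly_pair (inerve {..<n} W (topspace (fst P)), inerve {..<n} W (snd P))) (\<lambda>z. Inl (\<tau> z))"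
      using mem sub \<tau>(1) by (auto simp: pair_map_def poly_pair_def continuous_map_poly_space)
  qed (use \<tau>(3) in simp)
qed

text \<open>The affine extension of the vertex map \<open>p\<close>: coordinates are added along its
  fibres. The bound \<open>n\<close>, above all vertices of the source complex, keeps the sums
  finite.\<close>

definition simplicial_realization :: "nat \<Rightarrow> (nat \<Rightarrow> nat) \<Rightarrow> 'u cw_universe \<Rightarrow> 'u cw_universe" where
  "simplicial_realization n p z = Inl (\<lambda>w. \<Sum>u\<in>{u. u < n \<and> p u = w}. projl z u)"

lemma simplicial_realization_support:
  assumes "\<And>u. 0 \<le> projl z u"
  shows "0 < projl z u \<Longrightarrow> u < n \<Longrightarrow> 0 < projl (simplicial_realization n p z) (p u)"
    and "projl (simplicial_realization n p z) w \<noteq> 0 \<Longrightarrow> \<exists>u<n. projl z u \<noteq> 0 \<and> p u = w"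
proof -
  show "0 < projl z u \<Longrightarrow> u < n \<Longrightarrow> 0 < projl (simplicial_realization n p z) (p u)"
    using assms by (auto simp: simplicial_realization_def intro!: sum_pos2[of _ u])
  assume "projl (simplicial_realization n p z) w \<noteq> 0"
  then show "\<exists>u<n. projl z u \<noteq> 0 \<and> p u = w"
    unfolding simplicial_realization_def sum.sel by (elim sum.not_neutral_contains_not_neutral) auto
qed

lemma pair_map_simplicial_realization:
  assumes sm: "simplicial_map NM NM' p" and NM: "simplicial_pair NM" "simplicial_pair NM'" and n: "\<Union>(fst NM) \<subseteq> {..<n}"
  shows "pair_map (poly_pair NM) (poly_pair NM') (simplicial_realization n p :: 'u cw_universe \<Rightarrow> 'u cw_universe)"
proof -
  have mem: "simplicial_realization n p z \<in> Inl ` realization N'"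
    if z: "z \<in> Inl ` realization N" and p: "\<And>\<sigma>. \<sigma> \<in> N \<Longrightarrow> p ` \<sigma> \<in> N'" and N: "abstract_complex N'" "N \<subseteq> fst NM" for z :: "'u cw_universe" and N N'
  proof -
    obtain y where y: "z = Inl y" "y \<in> realization N"
      using z by blast
    let ?s = "{v. y v \<noteq> 0}"
    have s: "?s \<in> N" "?s \<subseteq> {..<n}"
      using realization_support[OF y(2)] N(2) n by auto
    have "(\<lambda>w. \<Sum>u\<in>{u. u < n \<and> p u = w}. y u) \<in> realization N'"
    proof (rule realizationI[OF N(1) p[OF s(1)]])
      show "0 \<le> (\<Sum>u\<in>{u. u < n \<and> p u = w}. y u)" for w
        using realization_nonneg[OF y(2)] by (simp add: sum_nonneg)
      show "w \<in> p ` ?s" if "(\<Sum>u\<in>{u. u < n \<and> p u = w}. y u) \<noteq> 0" for w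
        using that by (elim sum.not_neutral_contains_not_neutral) auto
      have fin: "finite (p ` ?s)"
        using s(2) finite_subset by blast
      have eq: "(\<Sum>u\<in>{u. u < n \<and> p u = w}. y u) = (\<Sum>u\<in>{u \<in> ?s. p u = w}. y u)" for w
        using s(2) by (intro sum.mono_neutral_right) auto
      have "(\<Sum>w\<in>p ` ?s. \<Sum>u\<in>{u \<in> ?s. p u = w}. y u) = sum y ?s"
        using s(2) finite_subset fin by (intro sum.group) auto
      then show "(\<Sum>w\<in>p ` ?s. \<Sum>u\<in>{u. u < n \<and> p u = w}. y u) = 1"
        using realization_sum[OF y(2) finite_subset[OF s(2)]] by (simp add: eq)
    qed
    then show ?thesis
      by (auto simp: simplicial_realization_def y(1))
  qed
  show ?thesis
    unfolding pair_map_def poly_pair_def fst_conv snd_conv continuous_map_poly_space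
  proof (intro conjI allI)
    show "(simplicial_realization n p :: 'u cw_universe \<Rightarrow> _) ` topspace (poly_space (fst NM)) \<subseteq> Inl ` realization (fst NM')"
      using mem[of _ "fst NM" "fst NM'"] NM sm by (auto simp: simplicial_pair_def simplicial_map_def)
    show "(simplicial_realization n p :: 'u cw_universe \<Rightarrow> _) ` Inl ` realization (snd NM) \<subseteq> Inl ` realization (snd NM')"
      using mem[of _ "snd NM" "snd NM'"] NM sm by (auto simp: simplicial_pair_def simplicial_map_def)
    show "continuous_map (poly_space (fst NM)) euclideanreal (\<lambda>z :: 'u cw_universe. projl (simplicial_realization n p z) v)" for v
      unfolding simplicial_realization_def by (auto intro!: continuous_map_sum continuous_map_coordinate)
  qed
qed


subsection \<open>The cell structure\<close>

definition disc_norm :: "nat \<Rightarrow> (nat \<Rightarrow> real) \<Rightarrow> real" where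
  "disc_norm d x = sqrt (\<Sum>i<d. (x i)\<^sup>2)"

text \<open>Completes \<open>d\<close> coordinates to \<open>d + 1\<close> coordinates with sum
  zero, that is to a direction parallel to the standard simplex.\<close>

definition balanced :: "nat \<Rightarrow> (nat \<Rightarrow> real) \<Rightarrow> nat \<Rightarrow> real" where
  "balanced d x i = (if i < d then x i else - (\<Sum>j<d. x j))"

text \<open>The minimum of \<open>u 0\<close>, ..., \<open>u n\<close>, in recursive form so that
  its continuity follows by induction.\<close>

primrec least_coord :: "(nat \<Rightarrow> real) \<Rightarrow> nat \<Rightarrow> real" where
  "least_coord u 0 = u 0"
| "least_coord u (Suc n) = min (least_coord u n) (u (Suc n))"

text \<open>Nonnegative coordinates, at least one of them zero. Divided by their sum they give the
  point where the ray from the barycentre in the balanced direction leaves the simplex.\<close>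

definition shifted :: "nat \<Rightarrow> (nat \<Rightarrow> real) \<Rightarrow> nat \<Rightarrow> real" where
  "shifted d x i = balanced d x i - least_coord (balanced d x) d"

text \<open>Spheres about the origin go to the boundaries of the simplices homothetic to the standard one
  with the same barycentre. At the origin the fraction is \<open>0 / 0 = 0\<close>.\<close>

definition disc_to_simplex :: "nat \<Rightarrow> (nat \<Rightarrow> real) \<Rightarrow> nat \<Rightarrow> real" where
  "disc_to_simplex d x i =
     (1 - disc_norm d x) / (real d + 1) + disc_norm d x * (shifted d x i / (\<Sum>j\<le>d. shifted d x j))"

lemma least_coord_le: "i \<le> n \<Longrightarrow> least_coord u n \<le> u i"
  by (induction n) (auto simp: le_Suc_eq min_le_iff_disj)

lemma least_coord_attained: "\<exists>i\<le>n. least_coord u n = u i"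
proof (induction n)
  case (Suc n)
  then obtain i where "i \<le> n" "least_coord u n = u i" by blast
  then show ?case
    by (cases "least_coord u n \<le> u (Suc n)") (auto simp: min_def intro: exI[of _ i] exI[of _ "Suc n"])
qed simp

lemma least_coord_eqI: "i \<le> n \<Longrightarrow> u i = m \<Longrightarrow> (\<And>j. j \<le> n \<Longrightarrow> m \<le> u j) \<Longrightarrow> least_coord u n = m"
  using least_coord_le[of i n u] least_coord_attained[of n u] by force

lemma sum_balanced: "(\<Sum>i\<le>d. balanced d x i) = 0"
proof -
  have "(\<Sum>i\<le>d. balanced d x i) = (\<Sum>i<d. balanced d x i) + balanced d x d"
    by (simp add: lessThan_Suc_atMost[symmetric])
  also have "(\<Sum>i<d. balanced d x i) = (\<Sum>i<d. x i)"
    by (rule sum.cong) (auto simp: balanced_def)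
  finally show ?thesis by (simp add: balanced_def)
qed

lemma shifted_nonneg: "i \<le> d \<Longrightarrow> 0 \<le> shifted d x i"
  using least_coord_le[of i d "balanced d x"] by (simp add: shifted_def)

lemma shifted_zero: "\<exists>i\<le>d. shifted d x i = 0"
  using least_coord_attained[of d "balanced d x"] by (auto simp: shifted_def)

lemma sum_shifted: "(\<Sum>i\<le>d. shifted d x i) = - (real d + 1) * least_coord (balanced d x) d"
  by (simp add: shifted_def sum_subtractf sum_balanced algebra_simps)

lemma sum_shifted_nonneg: "0 \<le> (\<Sum>i\<le>d. shifted d x i)"
  by (intro sum_nonneg) (simp add: shifted_nonneg)

lemma disc_norm_nonneg: "0 \<le> disc_norm d x"
  by (simp add: disc_norm_def sum_nonneg)

lemma disc_norm_eq_0: "disc_norm d x = 0 \<longleftrightarrow> (\<forall>i<d. x i = 0)"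
  by (simp add: disc_norm_def sum_nonneg_eq_0_iff sum_nonneg) auto

lemma disc_norm_scale: "0 \<le> k \<Longrightarrow> disc_norm d (\<lambda>i. k * x i) = k * disc_norm d x"
  by (simp add: disc_norm_def power_mult_distrib real_sqrt_mult flip: sum_distrib_left)

lemma disc_norm_cong: "(\<And>i. i < d \<Longrightarrow> x i = y i) \<Longrightarrow> disc_norm d x = disc_norm d y"
  by (simp add: disc_norm_def)

text \<open>A zero sum would make all balanced coordinates equal to their minimum, and this minimum
  zero by \<open>sum_shifted\<close>.\<close>

lemma sum_shifted_pos:
  assumes "disc_norm d x \<noteq> 0"
  shows "0 < (\<Sum>i\<le>d. shifted d x i)"
proof (rule ccontr)
  assume "\<not> ?thesis"
  then have s0: "(\<Sum>i\<le>d. shifted d x i) = 0"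
    using sum_shifted_nonneg[of d x] by linarith
  then have "\<forall>i\<in>{..d}. shifted d x i = 0"
    by (subst (asm) sum_nonneg_eq_0_iff) (simp_all add: shifted_nonneg)
  moreover have "least_coord (balanced d x) d = 0"
    using s0 unfolding sum_shifted by (simp add: add_nonneg_eq_0_iff)
  ultimately have "balanced d x i = 0" if "i \<le> d" for i
    using that by (auto simp: shifted_def)
  then have "x i = 0" if "i < d" for i
    using that by (metis balanced_def less_imp_le)
  with assms show False
    by (simp add: disc_norm_eq_0)
qed

lemma sum_disc_to_simplex: "(\<Sum>i\<le>d. disc_to_simplex d x i) = 1"
proof -
  have "(\<Sum>i\<le>d. disc_to_simplex d x i) =
      (real d + 1) * ((1 - disc_norm d x) / (real d + 1)) +
      disc_norm d x * ((\<Sum>i\<le>d. shifted d x i) / (\<Sum>i\<le>d. shifted d x i))"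
    by (simp add: disc_to_simplex_def sum.distrib flip: sum_distrib_left sum_divide_distrib)
      (simp add: add.commute)
  also have "(real d + 1) * ((1 - disc_norm d x) / (real d + 1)) = 1 - disc_norm d x"
    by simp
  finally show ?thesis
    using sum_shifted_pos[of d x] by (cases "disc_norm d x = 0") auto
qed

lemma disc_to_simplex_ge:
  assumes "i \<le> d"
  shows "(1 - disc_norm d x) / (real d + 1) \<le> disc_to_simplex d x i"
  using shifted_nonneg[OF assms] sum_shifted_nonneg disc_norm_nonneg
  by (simp add: disc_to_simplex_def)

text \<open>With \<open>disc_to_simplex_ge\<close> this identifies the least barycentric coordinate
  of the image, which determines the norm of \<open>x\<close>. Injectivity and the distinction
  between interior and boundary rest on it.\<close>

lemma disc_to_simplex_least: "\<exists>i\<le>d. disc_to_simplex d x i = (1 - disc_norm d x) / (real d + 1)"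
  using shifted_zero[of d x] by (auto simp: disc_to_simplex_def)

text \<open>The norms agree by comparing least coordinates. If they are nonzero, the shifted
  coordinates are proportional with factor \<open>k\<close>, hence so are the balanced ones and the
  points themselves, and equal norms force \<open>k = 1\<close>.\<close>

lemma disc_to_simplex_inj:
  assumes eq: "\<And>i. i \<le> d \<Longrightarrow> disc_to_simplex d x i = disc_to_simplex d y i"
    and i: "i < d"
  shows "x i = y i"
proof -
  obtain a where a: "a \<le> d" "disc_to_simplex d x a = (1 - disc_norm d x) / (real d + 1)"
    using disc_to_simplex_least[of d x] by blast
  obtain b where b: "b \<le> d" "disc_to_simplex d y b = (1 - disc_norm d y) / (real d + 1)"
    using disc_to_simplex_least[of d y] by blast
  have "(1 - disc_norm d x) / (real d + 1) = (1 - disc_norm d y) / (real d + 1)"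
    using disc_to_simplex_ge[OF a(1), of y] disc_to_simplex_ge[OF b(1), of x] eq[OF a(1)] eq[OF b(1)] a(2) b(2)
    by linarith
  then have n: "disc_norm d x = disc_norm d y"
    by (simp add: divide_simps split: if_splits)
  show ?thesis
  proof (cases "disc_norm d x = 0")
    case True
    then show ?thesis
      using n i disc_norm_eq_0[of d x] disc_norm_eq_0[of d y] by simp
  next
    case False
    let ?X = "\<Sum>j\<le>d. shifted d x j" and ?Y = "\<Sum>j\<le>d. shifted d y j"
    have pos: "0 < ?X" "0 < ?Y"
      using sum_shifted_pos False n by auto
    define k where "k = ?X / ?Y"
    have k: "0 < k"
      using pos by (simp add: k_def)
    have sh: "shifted d x j = k * shifted d y j" if "j \<le> d" for j
    proof -
      have "shifted d x j / ?X = shifted d y j / ?Y"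
        using eq[OF that] False unfolding disc_to_simplex_def n[symmetric] by (simp del: times_divide_eq_right)
      then show ?thesis
        using pos by (simp add: k_def field_simps)
    qed
    have "?X = k * ?Y"
      using pos by (simp add: k_def)
    then have "- (real d + 1) * least_coord (balanced d x) d = k * (- (real d + 1) * least_coord (balanced d y) d)"
      unfolding sum_shifted .
    then have "(real d + 1) * least_coord (balanced d x) d = (real d + 1) * (k * least_coord (balanced d y) d)"
      by (simp add: algebra_simps)
    then have "least_coord (balanced d x) d = k * least_coord (balanced d y) d"
      by (metis mult_left_cancel of_nat_0_le_iff add_nonneg_pos less_irrefl zero_less_one)
    then have bal: "balanced d x j = k * balanced d y j" if "j \<le> d" for j
      using sh[OF that] by (simp add: shifted_def algebra_simps)
    have xk: "x j = k * y j" if "j < d" for j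
      using bal[of j] that by (simp add: balanced_def)
    have "disc_norm d x = disc_norm d (\<lambda>j. k * y j)"
      by (rule disc_norm_cong) (rule xk)
    then have "disc_norm d x = k * disc_norm d x"
      using disc_norm_scale[of k d y] k n by simp
    then show ?thesis
      using False xk[OF i] by simp
  qed
qed

text \<open>The inverse map is explicit: the least coordinate of \<open>y\<close> prescribes the
  norm, and the direction is the one from the barycentre to \<open>y\<close>.\<close>

lemma disc_to_simplex_surj:
  assumes y: "\<And>i. i \<le> d \<Longrightarrow> 0 < y i" "(\<Sum>i\<le>d. y i) = 1"
  obtains x where "\<And>i. d \<le> i \<Longrightarrow> x i = 0" "disc_norm d x < 1" "\<And>i. i \<le> d \<Longrightarrow> disc_to_simplex d x i = y i"
proof -
  define m where "m = least_coord y d"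
  obtain a where a: "a \<le> d" "y a = m"
    using least_coord_attained[of d y] by (auto simp: m_def)
  have m: "\<And>i. i \<le> d \<Longrightarrow> m \<le> y i" "0 < m"
    using least_coord_le[of _ d y] y(1)[OF a(1)] a(2) by (auto simp: m_def)
  have "(\<Sum>i\<le>d. m) \<le> (\<Sum>i\<le>d. y i)"
    using m(1) by (intro sum_mono) simp
  then have md: "(real d + 1) * m \<le> 1"
    using y(2) by (simp add: algebra_simps)
  \<comment> \<open>Solves \<open>m = (1 - r) / (real d + 1)\<close>, the least coordinate of the
    image of a point of norm \<open>r\<close>.\<close>
  define r where "r = 1 - (real d + 1) * m"
  have r: "0 \<le> r" "r < 1"
    using md m(2) by (auto simp: r_def intro!: mult_pos_pos)
  define x0 where "x0 i = (if i < d then y i - 1 / (real d + 1) else 0)" for i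
  \<comment> \<open>Rescales \<open>x0\<close> to norm \<open>r\<close>. For \<open>r = 0\<close>
    the point \<open>y\<close> is the barycentre, and its preimage is the origin.\<close>
  define s where "s = (if r = 0 then 0 else r / disc_norm d x0)"
  define x where "x i = s * x0 i" for i
  have bal: "balanced d x i = s * (y i - 1 / (real d + 1))" if "i \<le> d" for i
  proof (cases "i < d")
    case False
    then have i: "i = d"
      using that by simp
    have "(\<Sum>j<d. y j) + y d = 1"
      using y(2) by (simp add: lessThan_Suc_atMost[symmetric])
    moreover have "(\<Sum>j<d. x0 j) = (\<Sum>j<d. y j) - real d / (real d + 1)"
      by (simp add: x0_def sum_subtractf)
    moreover have "real d / (real d + 1) = 1 - 1 / (real d + 1)"
      by (simp add: field_simps)
    ultimately have "- (\<Sum>j<d. x0 j) = y d - 1 / (real d + 1)"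
      by linarith
    then have "s * - (\<Sum>j<d. x0 j) = s * (y d - 1 / (real d + 1))"
      by simp
    then show ?thesis
      by (simp add: balanced_def x_def i sum_distrib_left)
  qed (simp add: balanced_def x_def x0_def)
  have n0: "disc_norm d x0 \<noteq> 0" if "r \<noteq> 0"
  proof
    assume "disc_norm d x0 = 0"
    then have yi: "y i = 1 / (real d + 1)" if "i < d" for i
      using that unfolding disc_norm_eq_0 by (force simp: x0_def)
    have "(\<Sum>j<d. y j) + y d = 1"
      using y(2) by (simp add: lessThan_Suc_atMost[symmetric])
    then have "y d = 1 - real d / (real d + 1)"
      using yi by simp
    then have "y d = 1 / (real d + 1)"
      by (simp add: field_simps)
    then have "m = 1 / (real d + 1)"
      using a yi by (cases "a = d") auto
    then show False
      using \<open>r \<noteq> 0\<close> by (simp add: r_def)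
  qed
  have s: "0 \<le> s"
    using r disc_norm_nonneg by (simp add: s_def)
  have "disc_norm d x = s * disc_norm d x0"
    using disc_norm_scale[OF s, of d x0] by (simp add: x_def[abs_def])
  then have norm: "disc_norm d x = r"
    using n0 by (simp add: s_def)
  have "least_coord (balanced d x) d = s * (m - 1 / (real d + 1))"
    using s m(1) by (intro least_coord_eqI[OF a(1)]) (auto simp: bal a mult_left_mono)
  then have sh: "shifted d x i = s * (y i - m)" if "i \<le> d" for i
    using bal[OF that] by (simp add: shifted_def algebra_simps)
  have "(\<Sum>j\<le>d. shifted d x j) = (\<Sum>j\<le>d. s * (y j - m))"
    by (rule sum.cong) (auto simp: sh)
  also have "\<dots> = s * r"
    using y(2) by (simp add: sum_subtractf r_def algebra_simps flip: sum_distrib_left)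
  finally have sum: "(\<Sum>j\<le>d. shifted d x j) = s * r" .
  show ?thesis
  proof (rule that[of x])
    show "disc_norm d x < 1"
      using norm r by simp
    show "x i = 0" if "d \<le> i" for i
      using that by (simp add: x_def x0_def)
    show "disc_to_simplex d x i = y i" if i: "i \<le> d" for i
    proof (cases "r = 0")
      case True
      then have m1: "m = 1 / (real d + 1)"
        by (simp add: r_def field_simps)
      have "(\<Sum>j\<le>d. y j - m) = 0"
        using y(2) m1 by (simp add: sum_subtractf)
      then have "y i - m = 0"
        using sum_nonneg_eq_0_iff[of "{..d}" "\<lambda>j. y j - m"] m(1) i by simp
      then show ?thesis
        using True m1 by (simp add: disc_to_simplex_def norm)
    next
      case False
      then have "s \<noteq> 0"
        using n0 by (simp add: s_def)
      then have "disc_to_simplex d x i = (1 - r) / (real d + 1) + (y i - m)"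
        using False sh[OF i] by (simp add: disc_to_simplex_def norm sum)
      also have "(1 - r) / (real d + 1) = m"
        by (simp add: r_def)
      finally show ?thesis by simp
    qed
  qed
qed

section \<open>Compactness of the disc and continuity of its map to the simplex\<close>

lemma continuous_map_coord_disc: "continuous_map (disc d) euclideanreal (\<lambda>x. x i)"
  unfolding disc_def Euclidean_space_def
  by (intro continuous_map_from_subtopology) (rule continuous_map_product_projection[of i UNIV "\<lambda>_. euclideanreal", OF UNIV_I])

lemma topspace_disc: "topspace (disc d) = {x. (\<forall>i\<ge>d. x i = 0) \<and> disc_norm d x \<le> 1}"
  by (auto simp: disc_def topspace_Euclidean_space disc_norm_def)

lemma open_disc_eq: "open_disc d = {x \<in> topspace (disc d). disc_norm d x < 1}"
  by (simp add: open_disc_def disc_norm_def)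

text \<open>By Tychonoff: the coordinates of points of the disc lie between -1 and 1, and the disc
  is closed in the product.\<close>

lemma compact_disc: "compact_space (disc d)"
proof -
  let ?P = "powertop_real (UNIV :: nat set)"
  let ?D = "{x :: nat \<Rightarrow> real. (\<forall>i\<ge>d. x i = 0) \<and> (\<Sum>i<d. (x i)\<^sup>2) \<le> 1}"
  have proj: "continuous_map ?P euclideanreal (\<lambda>x. x i)" for i
    by (rule continuous_map_product_projection[of i UNIV "\<lambda>_. euclideanreal", OF UNIV_I])
  have "closedin ?P (topspace (Euclidean_space d))"
    by (rule closedin_Euclidean_space)
  moreover have "closedin ?P {x \<in> topspace ?P. (\<Sum>i<d. (x i)\<^sup>2) \<in> {..1}}"
    by (rule closedin_continuous_map_preimage[where Y = euclideanreal])
      (auto intro!: continuous_map_sum continuous_map_real_pow proj)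
  ultimately have "closedin ?P (topspace (Euclidean_space d) \<inter> {x \<in> topspace ?P. (\<Sum>i<d. (x i)\<^sup>2) \<in> {..1}})"
    by (rule closedin_Int)
  then have cl: "closedin ?P ?D"
    by (simp add: topspace_Euclidean_space Int_def)
  have "compactin ?P (\<Pi>\<^sub>E i\<in>UNIV. {-1..1})"
    by (simp add: compactin_PiE)
  moreover have "?D \<subseteq> (\<Pi>\<^sub>E i\<in>UNIV. {-1..1})"
  proof
    fix x :: "nat \<Rightarrow> real"
    assume x: "x \<in> ?D"
    have "\<bar>x i\<bar> \<le> 1" for i
    proof (cases "i < d")
      case True
      then have "(x i)\<^sup>2 \<le> (\<Sum>i<d. (x i)\<^sup>2)"
        by (intro member_le_sum) auto
      then have "(x i)\<^sup>2 \<le> 1"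
        using x by simp
      then show ?thesis
        by (simp add: abs_square_le_1)
    qed (use x in auto)
    then show "x \<in> (\<Pi>\<^sub>E i\<in>UNIV. {-1..1})"
      by (auto simp: abs_le_iff minus_le_iff)
  qed
  ultimately have "compactin ?P ?D"
    using cl closed_compactin by blast
  moreover have "disc d = subtopology ?P ?D"
    by (simp add: disc_def Euclidean_space_def subtopology_subtopology Int_def)
  ultimately show ?thesis
    by (simp add: compact_space_subtopology)
qed

lemma continuous_map_least_coord:
  assumes "\<And>i. i \<le> n \<Longrightarrow> continuous_map T euclideanreal (\<lambda>x. u x i)"
  shows "continuous_map T euclideanreal (\<lambda>x. least_coord (u x) n)"
  using assms by (induction n) (auto intro: continuous_map_real_min)

text \<open>The quotient \<open>Q\<close> may be discontinuous at the origin, but it is bounded by 1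
  and multiplied by the norm; elsewhere its denominator is positive.\<close>

lemma continuous_map_disc_to_simplex:
  assumes "i \<le> d"
  shows "continuous_map (disc d) euclideanreal (\<lambda>x. disc_to_simplex d x i)"
proof -
  note c = continuous_map_coord_disc[of d]
  have n: "continuous_map (disc d) euclideanreal (disc_norm d)"
    unfolding disc_norm_def[abs_def] using c by (intro continuous_map_sqrt continuous_map_sum continuous_map_real_pow) auto
  have bal: "continuous_map (disc d) euclideanreal (\<lambda>x. balanced d x j)" for j
    unfolding balanced_def using c by (cases "j < d") (auto intro!: continuous_map_sum continuous_intros)
  have sh: "continuous_map (disc d) euclideanreal (\<lambda>x. shifted d x j)" for j
    unfolding shifted_def by (intro continuous_map_diff bal continuous_map_least_coord)
  have S: "continuous_map (disc d) euclideanreal (\<lambda>x. \<Sum>j\<le>d. shifted d x j)"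
    using sh by (intro continuous_map_sum) auto
  define Q where "Q x = shifted d x i / (\<Sum>j\<le>d. shifted d x j)" for x
  have Q: "\<bar>Q x\<bar> \<le> 1" for x
  proof -
    have "shifted d x i \<le> (\<Sum>j\<le>d. shifted d x j)"
      using assms shifted_nonneg by (intro member_le_sum) auto
    then show ?thesis
      using shifted_nonneg[OF assms, of x] sum_shifted_nonneg[of d x] by (cases "(\<Sum>j\<le>d. shifted d x j) = 0") (auto simp: Q_def divide_le_eq_1)
  qed
  have "continuous_map (disc d) euclideanreal (\<lambda>x. disc_norm d x * Q x)"
    unfolding continuous_map_atin
  proof
    fix x assume x: "x \<in> topspace (disc d)"
    have nx: "limitin euclideanreal (disc_norm d) (disc_norm d x) (atin (disc d) x)"
      using n x by (simp add: continuous_map_atin)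
    show "limitin euclideanreal (\<lambda>x. disc_norm d x * Q x) (disc_norm d x * Q x) (atin (disc d) x)"
    proof (cases "disc_norm d x = 0")
      case True
      have "(disc_norm d \<longlongrightarrow> 0) (atin (disc d) x)"
        using nx True by simp
      then have "((\<lambda>x. disc_norm d x * Q x) \<longlongrightarrow> 0) (atin (disc d) x)"
      proof (rule Lim_null_comparison[rotated])
        show "\<forall>\<^sub>F x in atin (disc d) x. norm (disc_norm d x * Q x) \<le> disc_norm d x"
          using Q disc_norm_nonneg by (intro always_eventually) (auto simp: abs_mult intro: mult_left_le)
      qed
      then show ?thesis
        using True by simp
    next
      case False
      have "limitin euclideanreal (\<lambda>x. shifted d x i) (shifted d x i) (atin (disc d) x)"
        "limitin euclideanreal (\<lambda>x. \<Sum>j\<le>d. shifted d x j) (\<Sum>j\<le>d. shifted d x j) (atin (disc d) x)"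
        using sh S x by (auto simp: continuous_map_atin)
      then show ?thesis
        using nx sum_shifted_pos[OF False] by (auto simp: Q_def intro!: tendsto_mult tendsto_divide)
    qed
  qed
  then have "continuous_map (disc d) euclideanreal (\<lambda>x. (1 - disc_norm d x) / (real d + 1) + disc_norm d x * Q x)"
    using n by (intro continuous_map_add continuous_map_real_divide continuous_map_diff) auto
  then show ?thesis
    by (simp add: disc_to_simplex_def Q_def)
qed

section \<open>Open simplices as cells of a polyhedron\<close>

definition cell :: "nat set set \<Rightarrow> nat set \<Rightarrow> 'u cw_universe set" where
  "cell N \<rho> = {z \<in> Inl ` realization N. {v. projl z v \<noteq> 0} = \<rho>}"

text \<open>A CW structure takes the dimension as a function of the set alone. All points of a cell
  have the same nonzero coordinates, so an arbitrary one determines it.\<close>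

definition cell_dim :: "'u cw_universe set \<Rightarrow> nat" where
  "cell_dim e = card {v. projl (SOME z. z \<in> e) v \<noteq> 0} - 1"

lemma cell_nonempty:
  assumes "abstract_complex N" "\<rho> \<in> N"
  shows "cell N \<rho> \<noteq> ({} :: 'u cw_universe set)"
proof -
  have \<rho>: "finite \<rho>" "\<rho> \<noteq> {}"
    using assms by (auto simp: abstract_complex_def)
  define y where "y v = (if v \<in> \<rho> then 1 / real (card \<rho>) else 0)" for v
  have "y \<in> realization N"
    using \<rho> by (intro realizationI[OF assms]) (auto simp: y_def split: if_splits)
  moreover have "{v. y v \<noteq> 0} = \<rho>"
    using \<rho> by (auto simp: y_def)
  ultimately have "(Inl y :: 'u cw_universe) \<in> cell N \<rho>"
    by (simp add: cell_def)
  then show ?thesis by blast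
qed

lemma cell_dim_cell:
  assumes "abstract_complex N" "\<rho> \<in> N"
  shows "cell_dim (cell N \<rho> :: 'u cw_universe set) = card \<rho> - 1"
proof -
  have "(SOME z. z \<in> cell N \<rho>) \<in> (cell N \<rho> :: 'u cw_universe set)"
    using cell_nonempty[OF assms] some_in_eq by blast
  then show ?thesis
    by (simp add: cell_dim_def cell_def)
qed

text \<open>Vanishing of the coordinates outside \<rho> is a closed condition.\<close>

lemma closure_of_cell: "poly_space N closure_of (cell N \<rho>) \<subseteq> {z \<in> Inl ` realization N. {v. projl z v \<noteq> 0} \<subseteq> \<rho>}"
proof (rule closure_of_minimal)
  have cl: "closedin (poly_space N) {z \<in> topspace (poly_space N). projl z v \<in> {0}}" for v
    by (intro closedin_continuous_map_preimage[OF continuous_map_coordinate]) simp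
  have "closedin (poly_space N)
      (\<Inter>(insert (topspace (poly_space N)) ((\<lambda>v. {z \<in> topspace (poly_space N). projl z v \<in> {0}}) ` (-\<rho>))))"
    using cl by (intro closedin_Inter) (auto simp del: topspace_poly_space)
  also have "\<Inter>(insert (topspace (poly_space N)) ((\<lambda>v. {z \<in> topspace (poly_space N). projl z v \<in> {0}}) ` (-\<rho>))) =
      {z \<in> Inl ` realization N. {v. projl z v \<noteq> 0} \<subseteq> \<rho>}"
    by auto
  finally show "closedin (poly_space N) {z \<in> Inl ` realization N. {v. projl z v \<noteq> 0} \<subseteq> \<rho>}" .
qed (auto simp: cell_def)

text \<open>The map is \<open>disc_to_simplex\<close> with the vertices enumerated by
  \<open>g\<close>. It is an embedding because the disc is compact and the polyhedron Hausdorff. The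
  least coordinate is positive exactly for norm below 1, so the open disc fills the cell and the
  sphere goes to cells with fewer vertices.\<close>

lemma characteristic_map_cell:
  assumes N: "abstract_complex N" and \<rho>: "\<rho> \<in> N"
  shows "\<exists>\<Phi>. characteristic_map (poly_space N) (cell N ` N) cell_dim (cell N \<rho> :: 'u cw_universe set) \<Phi>"
proof -
  define d where "d = card \<rho> - 1"
  have fin: "finite \<rho>" "\<rho> \<noteq> {}"
    using N \<rho> by (auto simp: abstract_complex_def)
  then have card: "card \<rho> = Suc d"
    by (simp add: d_def card_gt_0_iff)
  obtain g where g: "bij_betw g {..d} \<rho>"
    using finite_same_card_bij[of "{..d}" \<rho>] fin card by auto
  have inj: "inj_on g {..d}" and img: "g ` {..d} = \<rho>"
    using g by (auto simp: bij_betw_def)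
  define g' where "g' = inv_into {..d} g"
  have g': "g' v \<le> d" "g (g' v) = v" if "v \<in> \<rho>" for v
    using that inv_into_into[of v g "{..d}"] f_inv_into_f[of v g "{..d}"] img by (auto simp: g'_def)
  have gg: "g' (g i) = i" if "i \<le> d" for i
    using that inj by (simp add: g'_def)
  have g\<rho>: "g i \<in> \<rho>" if "i \<le> d" for i
    using that img by auto
  define y where "y x v = (if v \<in> \<rho> then disc_to_simplex d x (g' v) else 0)" for x v
  define \<Phi> where "\<Phi> x = (Inl (y x) :: 'u cw_universe)" for x
  have yg: "y x (g i) = disc_to_simplex d x i" if "i \<le> d" for x i
    using that g\<rho> gg by (simp add: y_def)
  have nonneg: "0 \<le> disc_to_simplex d x i" if "x \<in> topspace (disc d)" "i \<le> d" for x i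
    using order_trans[OF _ disc_to_simplex_ge[OF that(2)]] that(1) by (simp add: topspace_disc)
  have mem: "y x \<in> realization N" if x: "x \<in> topspace (disc d)" for x
  proof (rule realizationI[OF N \<rho>])
    have "sum (y x) \<rho> = (\<Sum>i\<le>d. y x (g i))"
      using sum.reindex_bij_betw[OF g, of "y x"] by simp
    also have "\<dots> = (\<Sum>i\<le>d. disc_to_simplex d x i)"
      by (rule sum.cong) (auto simp: yg)
    finally show "sum (y x) \<rho> = 1"
      by (simp add: sum_disc_to_simplex)
  qed (use nonneg[OF x] g' in \<open>auto simp: y_def split: if_splits\<close>)
  have cont: "continuous_map (disc d) (poly_space N) \<Phi>"
    unfolding continuous_map_poly_space
  proof (intro conjI allI)
    show "\<Phi> ` topspace (disc d) \<subseteq> Inl ` realization N"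
      using mem by (auto simp: \<Phi>_def)
    show "continuous_map (disc d) euclideanreal (\<lambda>x. projl (\<Phi> x) v)" for v
      using g' by (cases "v \<in> \<rho>") (simp_all add: \<Phi>_def y_def continuous_map_disc_to_simplex)
  qed
  have injP: "inj_on \<Phi> (topspace (disc d))"
  proof (rule inj_onI)
    fix x x' assume x: "x \<in> topspace (disc d)" "x' \<in> topspace (disc d)" and "\<Phi> x = \<Phi> x'"
    then have "y x (g i) = y x' (g i)" for i
      by (simp add: \<Phi>_def)
    then have "disc_to_simplex d x i = disc_to_simplex d x' i" if "i \<le> d" for i
      using yg[OF that] by metis
    then have "x i = x' i" for i
      using x disc_to_simplex_inj[of d x x'] by (cases "i < d") (auto simp: topspace_disc)
    then show "x = x'" by blast
  qed
  have open_iff: "\<Phi> x \<in> cell N \<rho> \<longleftrightarrow> x \<in> open_disc d" if x: "x \<in> topspace (disc d)" for x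
  proof
    assume "\<Phi> x \<in> cell N \<rho>"
    then have "{v. y x v \<noteq> 0} = \<rho>"
      by (simp add: cell_def \<Phi>_def)
    moreover obtain i where i: "i \<le> d" "disc_to_simplex d x i = (1 - disc_norm d x) / (real d + 1)"
      using disc_to_simplex_least by blast
    ultimately have "(1 - disc_norm d x) / (real d + 1) \<noteq> 0"
      using g\<rho>[OF i(1)] yg[OF i(1), of x] by auto
    then show "x \<in> open_disc d"
      using x by (auto simp: open_disc_eq topspace_disc)
  next
    assume "x \<in> open_disc d"
    then have "0 < (1 - disc_norm d x) / (real d + 1)"
      by (simp add: open_disc_eq)
    then have "0 < disc_to_simplex d x i" if "i \<le> d" for i
      using disc_to_simplex_ge[OF that, of x] by linarith
    then have "y x v \<noteq> 0 \<longleftrightarrow> v \<in> \<rho>" for v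
      using g' by (auto simp: y_def less_le)
    then show "\<Phi> x \<in> cell N \<rho>"
      using mem[OF x] by (simp add: cell_def \<Phi>_def)
  qed
  have surj: "cell N \<rho> \<subseteq> \<Phi> ` topspace (disc d)"
  proof
    fix z :: "'u cw_universe" assume "z \<in> cell N \<rho>"
    then obtain w where w: "z = Inl w" "w \<in> realization N" "{v. w v \<noteq> 0} = \<rho>"
      by (auto simp: cell_def)
    have "0 < w (g i)" if "i \<le> d" for i
      using w(3) g\<rho>[OF that] realization_nonneg[OF w(2), of "g i"] by (auto simp: less_le)
    moreover have "(\<Sum>i\<le>d. w (g i)) = 1"
      using sum.reindex_bij_betw[OF g, of w] realization_sum[OF w(2) fin(1)] w(3) by simp
    ultimately obtain x where x: "\<And>i. d \<le> i \<Longrightarrow> x i = 0" "disc_norm d x < 1"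
      "\<And>i. i \<le> d \<Longrightarrow> disc_to_simplex d x i = w (g i)"
      using disc_to_simplex_surj[of d "\<lambda>i. w (g i)"] by blast
    have "y x v = w v" for v
      using x(3)[OF g'(1)] g'(2) w(3) by (auto simp: y_def)
    then have "z = \<Phi> x"
      by (simp add: \<Phi>_def w(1) fun_eq_iff)
    then show "z \<in> \<Phi> ` topspace (disc d)"
      using x(1,2) by (auto simp: topspace_disc)
  qed
  have "embedding_map (disc d) (poly_space N) \<Phi>"
    by (rule continuous_imp_embedding_map[OF cont compact_disc Hausdorff_poly_space injP])
  then have "homeomorphic_map (disc d) (subtopology (poly_space N) (\<Phi> ` topspace (disc d))) \<Phi>"
    by (simp add: embedding_map_def)
  then have "homeomorphic_map (subtopology (disc d) (open_disc d))
      (subtopology (subtopology (poly_space N) (\<Phi> ` topspace (disc d))) (cell N \<rho>)) \<Phi>"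
    using open_iff by (rule homeomorphic_map_subtopologies_alt) blast
  then have homeo: "homeomorphic_map (subtopology (disc d) (open_disc d)) (subtopology (poly_space N) (cell N \<rho>)) \<Phi>"
    using surj by (simp add: subtopology_subtopology inf_absorb2)
  have bd: "\<Phi> ` (topspace (disc d) - open_disc d) \<subseteq> \<Union>{e' \<in> cell N ` N. cell_dim e' < cell_dim (cell N \<rho> :: 'u cw_universe set)}"
  proof
    fix z assume "z \<in> \<Phi> ` (topspace (disc d) - open_disc d)"
    then obtain x where x: "x \<in> topspace (disc d)" "x \<notin> open_disc d" "z = \<Phi> x" by blast
    let ?s = "{v. y x v \<noteq> 0}"
    have s: "?s \<in> N"
      using mem[OF x(1)] realization_support by blast
    have z: "z \<in> cell N ?s"
      using mem[OF x(1)] by (simp add: cell_def x(3) \<Phi>_def)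
    have "?s \<subseteq> \<rho>"
      by (auto simp: y_def)
    moreover have "?s \<noteq> \<rho>"
      using open_iff[OF x(1)] x(2,3) z by metis
    ultimately have "card ?s < card \<rho>"
      using fin(1) by (simp add: psubset_card_mono psubset_eq)
    moreover have "0 < card ?s"
      using N s abstract_complex_not_empty[OF N] unfolding abstract_complex_def card_gt_0_iff by metis
    ultimately have "cell_dim (cell N ?s :: 'u cw_universe set) < cell_dim (cell N \<rho> :: 'u cw_universe set)"
      by (simp add: cell_dim_cell[OF N s] cell_dim_cell[OF N \<rho>])
    then show "z \<in> \<Union>{e' \<in> cell N ` N. cell_dim e' < cell_dim (cell N \<rho> :: 'u cw_universe set)}"
      using z s by blast
  qed
  have "cell_dim (cell N \<rho> :: 'u cw_universe set) = d"
    by (simp add: cell_dim_cell[OF N \<rho>] d_def)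
  then have "characteristic_map (poly_space N) (cell N ` N) cell_dim (cell N \<rho>) \<Phi>"
    unfolding characteristic_map_def using cont homeo bd by simp
  then show ?thesis by blast
qed

text \<open>With finitely many cells, closure finiteness and the weak topology are automatic. The
  result allows shape maps to be evaluated at finite polyhedral pairs.\<close>

lemma cw_type_poly_pair:
  assumes NM: "simplicial_pair NM" and fin: "finite (fst NM)"
  shows "cw_type (poly_pair NM :: 'u cw_universe spair)"
proof -
  let ?N = "fst NM" and ?M = "snd NM"
  let ?X = "poly_space ?N :: 'u cw_universe topology"
  let ?E = "cell ?N ` ?N :: 'u cw_universe set set"
  have N: "abstract_complex ?N" "abstract_complex ?M" "?M \<subseteq> ?N"
    using NM by (auto simp: simplicial_pair_def)
  have UE: "\<Union>(cell ?N ` M) = (Inl ` realization M :: 'u cw_universe set)" if "M \<subseteq> ?N" for M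
    using that realization_mono[OF that] by (auto simp: cell_def realization_support, auto simp: realization_def)
  have cl: "?X closure_of e \<subseteq> topspace ?X" for e
    by (rule closure_of_subset_topspace)
  have cw: "cw_structure ?X ?E cell_dim"
    unfolding cw_structure_def
  proof (intro conjI ballI allI impI)
    show "Hausdorff_space ?X"
      by (rule Hausdorff_poly_space)
    show "pairwise disjnt ?E"
      by (auto simp: pairwise_def disjnt_def cell_def)
    show "\<Union>?E = topspace ?X"
      using UE by simp
    show "\<exists>\<Phi>. characteristic_map ?X ?E cell_dim e \<Phi>" if "e \<in> ?E" for e
      using that characteristic_map_cell[OF N(1)] by auto
    show "finite {e' \<in> ?E. e' \<inter> ?X closure_of e \<noteq> {}}" for e
      using fin by simp
    fix A assume A: "A \<subseteq> topspace ?X" "\<forall>e\<in>?E. closedin ?X (A \<inter> ?X closure_of e)"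
    have "A = (\<Union>e\<in>?E. A \<inter> ?X closure_of e)"
    proof
      show "A \<subseteq> (\<Union>e\<in>?E. A \<inter> ?X closure_of e)"
      proof
        fix z assume z: "z \<in> A"
        then have "z \<in> \<Union>?E"
          using A(1) \<open>\<Union>?E = topspace ?X\<close> by blast
        then obtain e where e: "e \<in> ?E" "z \<in> e" by blast
        have "e \<subseteq> topspace ?X"
          using e(1) by (auto simp: cell_def)
        then have "z \<in> ?X closure_of e"
          using closure_of_subset e(2) by blast
        then show "z \<in> (\<Union>e\<in>?E. A \<inter> ?X closure_of e)"
          using z e(1) by blast
      qed
    qed blast
    also have "closedin ?X \<dots>"
      using A(2) fin by (intro closedin_Union) auto
    finally show "closedin ?X A" .
  qed
  have sub: "?X closure_of e \<subseteq> \<Union>(cell ?N ` ?M)" if "e \<in> cell ?N ` ?M" for e :: "'u cw_universe set"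
  proof -
    obtain \<rho> where \<rho>: "e = cell ?N \<rho>" "\<rho> \<in> ?M"
      using \<open>e \<in> cell ?N ` ?M\<close> by blast
    have "?X closure_of e \<subseteq> {z \<in> Inl ` realization ?N. {v. projl z v \<noteq> 0} \<subseteq> \<rho>}"
      unfolding \<rho>(1) by (rule closure_of_cell)
    also have "\<dots> \<subseteq> Inl ` realization ?M"
    proof
      fix z :: "'u cw_universe"
      assume "z \<in> {z \<in> Inl ` realization ?N. {v. projl z v \<noteq> 0} \<subseteq> \<rho>}"
      then obtain y where y: "z = Inl y" "y \<in> realization ?N" "{v. y v \<noteq> 0} \<subseteq> \<rho>"
        by auto
      then have "{v. y v \<noteq> 0} \<in> ?M"
        using abstract_complex_face[OF N(2) \<rho>(2) y(3)] realization_support[OF y(2)]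
          abstract_complex_not_empty[OF N(1)] by metis
      then show "z \<in> Inl ` realization ?M"
        using y(1,2) by (auto simp: realization_def)
    qed
    finally show ?thesis
      unfolding UE[OF N(3)] .
  qed
  have "cw_pair (poly_pair NM :: 'u cw_universe spair)"
    unfolding cw_pair_def
  proof (intro exI conjI)
    show "cw_structure (fst (poly_pair NM)) ?E cell_dim"
      using cw by (simp add: poly_pair_def)
    show "cell ?N ` ?M \<subseteq> ?E"
      using N(3) by blast
    show "snd (poly_pair NM :: 'u cw_universe spair) = \<Union>(cell ?N ` ?M)"
      unfolding UE[OF N(3)] by (simp add: poly_pair_def)
    show "\<forall>e\<in>cell ?N ` ?M. fst (poly_pair NM :: 'u cw_universe spair) closure_of e \<subseteq> \<Union>(cell ?N ` ?M)"
      using sub by (simp add: poly_pair_def)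
  qed
  moreover have "pair_homotopy_equivalent (poly_pair NM :: 'u cw_universe spair) (poly_pair NM :: 'u cw_universe spair)"
    unfolding pair_homotopy_equivalent_def
    by (intro exI[of _ id]) (simp add: pair_map_def pair_homotopic_def)
  moreover have "hausdorff_pair (poly_pair NM :: 'u cw_universe spair)"
    using Hausdorff_poly_space realization_mono[OF N(3)] by (auto simp: hausdorff_pair_def poly_pair_def)
  ultimately show ?thesis
    unfolding cw_type_def by blast
qed


section \<open>Shape maps and Cech classes\<close>

lemma compact_pairD:
  assumes "compact_pair P"
  shows "snd P \<subseteq> topspace (fst P)" "compact_space (fst P)" "Hausdorff_space (fst P)" "closedin (fst P) (snd P)"
  using assms compactin_imp_closedin by (auto simp: compact_pair_def hausdorff_pair_def)

lemma hclass_memD: "g \<in> hclass P Q f \<Longrightarrow> pair_homotopic P Q f g"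
  by (simp add: hclass_def)

lemma pair_homotopicD:
  assumes "pair_homotopic P Q f g"
  shows "pair_map P Q f" "pair_map P Q g"
proof -
  have "(\<lambda>h. h ` snd P \<subseteq> snd Q) f \<and> (\<lambda>h. h ` snd P \<subseteq> snd Q) g"
    using assms unfolding pair_homotopic_def by (rule homotopic_with_imp_property)
  then show "pair_map P Q f" "pair_map P Q g"
    using homotopic_with_imp_continuous_maps[OF assms[unfolded pair_homotopic_def]] by (auto simp: pair_map_def)
qed

lemma hclasses_memD:
  assumes "\<eta> \<in> hclasses P Q" "g \<in> \<eta>"
  shows "pair_map P Q g" "\<eta> = hclass P Q g"
proof -
  obtain f where f: "pair_map P Q f" "\<eta> = hclass P Q f"
    using assms(1) by (auto simp: hclasses_def)
  then have h: "pair_homotopic P Q f g"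
    using assms(2) by (simp add: hclass_memD)
  show "pair_map P Q g" "\<eta> = hclass P Q g"
    using pair_homotopicD[OF h] f hclass_eq_iff[OF f(1), of g] h by auto
qed

lemma hclasses_nonempty: "\<eta> \<in> hclasses P Q \<Longrightarrow> \<exists>g. g \<in> \<eta>"
  using hclass_self by (fastforce simp: hclasses_def)

text \<open>Outside the domain \<open>g\<close> returns \<open>{}\<close>, which is not a homotopy
  class and is therefore sent to \<open>{}\<close> by \<open>f\<close> as well.\<close>

lemma is_shape_map_comp:
  fixes f :: "('a, 'b, 'q) shape_map" and g :: "('b, 'c, 'q) shape_map"
  assumes "is_shape_map K L f" "is_shape_map L M g"
  shows "is_shape_map K M (shape_comp g f)"
  unfolding is_shape_map_def shape_comp_def
proof (intro conjI allI impI)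
  note f = assms(1)[unfolded is_shape_map_def] and g = assms(2)[unfolded is_shape_map_def]
  have ne: "{} \<notin> hclasses L Q" for Q :: "'q spair"
    using hclasses_nonempty by blast
  fix Q :: "'q spair" and \<eta>
  show "f Q (g Q \<eta>) \<in> hclasses K Q" if "cw_type Q \<and> \<eta> \<in> hclasses M Q"
    using that conjunct1[OF f, rule_format, of Q "g Q \<eta>"] conjunct1[OF g, rule_format, of Q \<eta>] by simp
  show "f Q (g Q \<eta>) = {}" if "\<not> (cw_type Q \<and> \<eta> \<in> hclasses M Q)"
  proof -
    have "g Q \<eta> = {}"
      using that conjunct1[OF conjunct2[OF g], rule_format, of Q \<eta>] by simp
    then show ?thesis
      using conjunct1[OF conjunct2[OF f], rule_format, of Q "{}"] ne[of Q] by simp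
  qed
  fix Q' :: "'q spair" and \<eta>' \<xi>
  assume "cw_type Q \<and> cw_type Q' \<and> \<eta> \<in> hclasses M Q \<and> \<eta>' \<in> hclasses M Q' \<and> \<xi> \<in> hclasses Q Q' \<and>
    hcomp M Q' \<xi> \<eta> = \<eta>'"
  then have a: "cw_type Q" "cw_type Q'" "\<eta> \<in> hclasses M Q" "\<eta>' \<in> hclasses M Q'" "\<xi> \<in> hclasses Q Q'"
    "hcomp M Q' \<xi> \<eta> = \<eta>'"
    by auto
  have "g Q \<eta> \<in> hclasses L Q" "g Q' \<eta>' \<in> hclasses L Q'"
    using a conjunct1[OF g, rule_format, of Q \<eta>] conjunct1[OF g, rule_format, of Q' \<eta>'] by simp_all
  moreover have "hcomp L Q' \<xi> (g Q \<eta>) = g Q' \<eta>'"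
    using conjunct2[OF conjunct2[OF g], rule_format, of Q Q' \<eta> \<eta>' \<xi>] a by simp
  ultimately show "hcomp K Q' \<xi> (f Q (g Q \<eta>)) = f Q' (g Q' \<eta>')"
    using conjunct2[OF conjunct2[OF f], rule_format, of Q Q' "g Q \<eta>" "g Q' \<eta>'" \<xi>] a by simp
qed

section \<open>Polyhedral representatives of Cech classes and their transport\<close>

lemma poly_support: "z \<in> Inl ` realization N \<Longrightarrow> {v. projl z v \<noteq> 0} \<in> N"
  by (auto simp: realization_support)

lemma finite_inerve: "finite I \<Longrightarrow> finite (inerve I W S)"
  by (rule finite_subset[of _ "Pow I"]) (auto simp: inerve_def)

lemma simplicial_pair_inerve:
  "snd P \<subseteq> topspace (fst P) \<Longrightarrow> simplicial_pair (inerve I W (topspace (fst P)), inerve I W (snd P))"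
  by (simp add: simplicial_pair_def abstract_complex_inerve inerve_mono)

lemma simplicial_map_index:
  assumes "e ` I \<subseteq> \<gamma>"
  shows "simplicial_map (inerve I e (topspace (fst P)), inerve I e (snd P)) (nerve_pair P \<gamma>) e"
  using assms unfolding simplicial_map_def nerve_pair_def nerve_eq_inerve inerve_def by auto

lemma simplicial_map_comp:
  "simplicial_map NM NM' p \<Longrightarrow> simplicial_map NM' NM'' r \<Longrightarrow> simplicial_map NM NM'' (r \<circ> p)"
  unfolding simplicial_map_def by (metis image_comp)

text \<open>A finite cover is enumerated by natural numbers, and \<tau> is a canonical map into its
  nerve. On the space the star of \<open>i\<close> lies in the set with number \<open>i\<close>, so
  the cocycle pulls back to the given class. The complex is that of the whole pair even if the class
  lives on a part, so that \<tau> is a map of pairs.\<close>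

lemma cech_class_polyhedral:
  fixes A :: "('a, 'g::ab_group_add) cech_class"
  assumes P: "compact_pair P" and A: "A \<in> carrier (cech_cohomology q (part_pair k P))"
  obtains NM c and \<tau> :: "'a \<Rightarrow> 'u cw_universe" where "simplicial_pair NM" "finite (fst NM)"
    "pair_map P (poly_pair NM) \<tau>" "c \<in> cocycles (part_complex k NM) q"
    "A = cech_pull q (part_pair k P) UNIV (star \<tau>) c"
proof -
  note sub = compact_pairD(1)[OF P]
  obtain \<gamma>\<^sub>1 c where \<gamma>\<^sub>1: "open_cover (fst P) \<gamma>\<^sub>1" and c: "c \<in> cocycles (part_complex k (nerve_pair P \<gamma>\<^sub>1)) q"
    and Ac: "A = cech_pull q (part_pair k P) \<gamma>\<^sub>1 id c"
    using cech_part_cases[OF sub closed_part[OF compact_pairD(4)[OF P]] open_cover_whole A] by metis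
  obtain \<gamma> where \<gamma>: "\<gamma> \<subseteq> \<gamma>\<^sub>1" "finite \<gamma>" "open_cover (fst P) \<gamma>"
    using finite_subcover[OF compact_pairD(2)[OF P] \<gamma>\<^sub>1] .
  obtain e where e: "bij_betw e {..<card \<gamma>} \<gamma>"
    using ex_bij_betw_nat_finite[OF \<gamma>(2)] by (auto simp: lessThan_atLeast0)
  let ?n = "card \<gamma>"
  have img: "e ` {..<?n} = \<gamma>"
    using e by (simp add: bij_betw_def)
  let ?NM = "(inerve {..<?n} e (topspace (fst P)), inerve {..<?n} e (snd P))"
  have op: "openin (fst P) (e i)" if "i < ?n" for i
    using that img \<gamma>(3) by (auto simp: open_cover_def)
  have cov: "topspace (fst P) \<subseteq> (\<Union>i<?n. e i)"
    using img \<gamma>(3) by (auto simp: open_cover_def)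
  obtain \<tau> :: "'a \<Rightarrow> 'u cw_universe" where \<tau>: "pair_map P (poly_pair ?NM) \<tau>"
    "\<And>z i. \<lbrakk>z \<in> topspace (fst P); projl (\<tau> z) i \<noteq> 0\<rbrakk> \<Longrightarrow> i < ?n \<and> z \<in> e i"
    using canonical_map[OF compact_pairD(2,3,1)[OF P] op cov] by blast
  note sp = simplicial_pair_inerve[OF sub, of "{..<?n}" e]
  have sm: "simplicial_map (part_complex k ?NM) (part_complex k (nerve_pair P \<gamma>\<^sub>1)) e"
    by (rule simplicial_map_part[OF simplicial_map_index]) (use img \<gamma>(1) in simp)
  note car = carried_part[OF carried_star[OF \<tau>(1) sub sp], of k]
    carried_part[OF carried_nerve_pair[OF sub \<gamma>\<^sub>1], of k]
  have top: "topspace (fst (part_pair k P)) \<subseteq> topspace (fst P)"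
    by (cases k) auto
  have "A = cech_pull q (part_pair k P) UNIV (star \<tau>) (pull_cochain (part_complex k ?NM) e c)"
    unfolding Ac
  proof (rule cech_pull_natural[OF car sm c, symmetric])
    fix i
    assume i: "star \<tau> i \<inter> topspace (fst (part_pair k P)) \<noteq> {}"
    have *: "i < ?n \<and> z \<in> e i" if "z \<in> star \<tau> i \<inter> topspace (fst (part_pair k P))" for z
      using that top \<tau>(2)[of z i] by (auto simp: star_def)
    then show "e i \<in> \<gamma>\<^sub>1 \<and> star \<tau> i \<inter> topspace (fst (part_pair k P)) \<subseteq> id (e i)"
      using i img \<gamma>(1) by auto
  qed
  moreover have "pull_cochain (part_complex k ?NM) e c \<in> cocycles (part_complex k ?NM) q"
    by (rule pull_cocycles[OF carriedD(2)[OF car(1)] carriedD(2)[OF car(2)] sm c])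
  moreover have "finite (fst ?NM)"
    by (simp add: finite_inerve)
  ultimately show ?thesis
    using that[OF sp _ \<tau>(1)] by blast
qed

text \<open>Both classes are compared on the nerve of a fine cover of \<open>L\<close>. The shape map sends the canonical
  map into this nerve to a map \<open>\<sigma>\<close>, through which both \<open>g\<close> and \<open>g'\<close> then factor up to homotopy.\<close>

lemma shape_map_cech_cong:
  fixes s :: "('a, 'b, 'u cw_universe) shape_map"
  assumes s: "is_shape_map K L s" and K: "compact_pair K" and L: "compact_pair L"
    and NM: "simplicial_pair NM" "finite (fst NM)" and NM': "simplicial_pair NM'" "finite (fst NM')"
    and f: "pair_map L (poly_pair NM) f" and f': "pair_map L (poly_pair NM') f'"
    and c: "c \<in> cocycles (part_complex k NM) q" and c': "c' \<in> cocycles (part_complex k NM') q"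
    and eq: "cech_pull q (part_pair k L) UNIV (star f) c = cech_pull q (part_pair k L) UNIV (star f') c'"
    and g: "g \<in> s (poly_pair NM) (hclass L (poly_pair NM) f)"
    and g': "g' \<in> s (poly_pair NM') (hclass L (poly_pair NM') f')"
  shows "cech_pull q (part_pair k K) UNIV (star g) c = cech_pull q (part_pair k K) UNIV (star g') c'"
proof -
  note subL = compact_pairD(1)[OF L] and subK = compact_pairD(1)[OF K]
  note carf = carried_star[OF f subL NM(1)] and carf' = carried_star[OF f' subL NM'(1)]
  obtain \<gamma> v v' where \<gamma>: "finite \<gamma>" "open_cover (fst L) \<gamma>"
    and v: "subordinate \<gamma> UNIV (star f) v" and v': "subordinate \<gamma> UNIV (star f') v'"
    and d: "(\<lambda>s. pull_cochain (part_complex k (nerve_pair L \<gamma>)) v c s - pull_cochain (part_complex k (nerve_pair L \<gamma>)) v' c' s)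
      \<in> coboundaries (part_complex k (nerve_pair L \<gamma>)) q"
    using cech_pull_part_eqD[OF compact_pairD(4,2)[OF L] carf carf' c c' eq] .
  obtain e where e: "bij_betw e {..<card \<gamma>} \<gamma>"
    using ex_bij_betw_nat_finite[OF \<gamma>(1)] by (auto simp: lessThan_atLeast0)
  let ?n = "card \<gamma>"
  have img: "e ` {..<?n} = \<gamma>"
    using e by (simp add: bij_betw_def)
  define N where "N = (inerve {..<?n} e (topspace (fst L)), inerve {..<?n} e (snd L))"
  have op: "openin (fst L) (e i)" if "i < ?n" for i
    using that img \<gamma>(2) by (auto simp: open_cover_def)
  have cov: "topspace (fst L) \<subseteq> (\<Union>i<?n. e i)"
    using img \<gamma>(2) by (auto simp: open_cover_def)
  obtain \<tau> :: "'b \<Rightarrow> 'u cw_universe" where \<tau>: "pair_map L (poly_pair N) \<tau>"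
    "\<And>z i. \<lbrakk>z \<in> topspace (fst L); projl (\<tau> z) i \<noteq> 0\<rbrakk> \<Longrightarrow> i < ?n \<and> z \<in> e i"
    using canonical_map[OF compact_pairD(2,3,1)[OF L] op cov] unfolding N_def by blast
  have N: "simplicial_pair N" "finite (fst N)" "\<Union>(fst N) \<subseteq> {..<?n}"
    using simplicial_pair_inerve[OF subL] by (auto simp: N_def finite_inerve, auto simp: inerve_def)
  have sme: "simplicial_map N (nerve_pair L \<gamma>) e"
    unfolding N_def by (rule simplicial_map_index) (use img in simp)
  have \<tau>cl: "hclass L (poly_pair N) \<tau> \<in> hclasses L (poly_pair N)"
    using \<tau>(1) by (auto simp: hclasses_def)
  note cwN = cw_type_poly_pair[OF N(1,2), where 'u = 'u]
  have "s (poly_pair N) (hclass L (poly_pair N) \<tau>) \<in> hclasses K (poly_pair N)"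
    using s \<tau>cl cwN unfolding is_shape_map_def by blast
  then obtain \<sigma> where \<sigma>: "pair_map K (poly_pair N) \<sigma>" "s (poly_pair N) (hclass L (poly_pair N) \<tau>) = hclass K (poly_pair N) \<sigma>"
    unfolding hclasses_def by blast
  note car\<sigma> = carried_part[OF carried_star[OF \<sigma>(1) subK N(1)], of k]
  \<comment> \<open>Proved for arbitrary data because it is applied to both \<open>f\<close> and
    \<open>f'\<close>. The map \<open>?r\<close> realizes the vertex map \<open>v \<circ> e\<close>
    from the nerve into the complex of \<open>f\<close>.\<close>
  have factor: "cech_pull q (part_pair k K) UNIV (star g) c =
      cech_pull q (part_pair k K) UNIV (star \<sigma>) (pull_cochain (part_complex k N) (v \<circ> e) c) \<and>
      pull_cochain (part_complex k N) (v \<circ> e) c \<in> cocycles (part_complex k N) q"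
    if NM: "simplicial_pair NM" "finite (fst NM)" and f: "pair_map L (poly_pair NM) f"
      and c: "c \<in> cocycles (part_complex k NM) q" and v: "subordinate \<gamma> UNIV (star f) v"
      and g: "g \<in> s (poly_pair NM) (hclass L (poly_pair NM) f)" for NM f c v g
  proof -
    let ?p = "v \<circ> e" and ?Q = "poly_pair NM :: 'u cw_universe spair"
    have sm: "simplicial_map N NM ?p"
      by (rule simplicial_map_comp[OF sme trace_subordinate_simplicial[OF carried_star[OF f subL NM(1)]
              subordinate_trace[OF v]]])
    let ?r = "simplicial_realization ?n ?p :: 'u cw_universe \<Rightarrow> 'u cw_universe"
    have r: "pair_map (poly_pair N) ?Q ?r"
      by (rule pair_map_simplicial_realization[OF sm N(1) NM(1) N(3)])
    have pos: "0 \<le> projl (\<tau> z) u" if "z \<in> topspace (fst L)" for z u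
      using pair_map_poly(1)[OF \<tau>(1) that] realization_nonneg by auto
    \<comment> \<open>A member of the cover that contains \<open>z\<close> is sent by
      \<open>v\<close> to a vertex at which \<open>f z\<close> is positive. Hence both images of
      \<open>z\<close> lie in one closed simplex, and \<open>?r \<circ> \<tau>\<close> is homotopic
      to \<open>f\<close> along straight lines.\<close>
    have supp: "{w. projl ((?r \<circ> \<tau>) z) w \<noteq> 0} \<subseteq> {w. projl (f z) w \<noteq> 0}" if z: "z \<in> topspace (fst L)" for z
    proof clarify
      fix w assume w: "projl ((?r \<circ> \<tau>) z) w \<noteq> 0" "projl (f z) w = 0"
      then obtain u where u: "u < ?n" "projl (\<tau> z) u \<noteq> 0" "?p u = w"
        using simplicial_realization_support(2)[OF pos[OF z], where n = ?n and p = ?p and w = w] by auto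
      then have "z \<in> e u" "e u \<in> \<gamma>"
        using \<tau>(2)[OF z] img by auto
      then have "0 < projl (f z) w"
        using v u(3) by (auto simp: subordinate_def star_def)
      then show False
        using w(2) by simp
    qed
    have "pair_homotopic L ?Q (?r \<circ> \<tau>) f"
    proof (rule straight_line_homotopic[OF pair_map_comp[OF \<tau>(1) r] f NM(1) _ _ subL])
      fix z
      show "\<exists>\<rho>\<in>fst NM. {w. projl ((?r \<circ> \<tau>) z) w \<noteq> 0} \<subseteq> \<rho> \<and> {w. projl (f z) w \<noteq> 0} \<subseteq> \<rho>"
        if z: "z \<in> topspace (fst L)"
        using supp[OF z] poly_support[OF pair_map_poly(1)[OF f z]] by blast
      show "\<exists>\<rho>\<in>snd NM. {w. projl ((?r \<circ> \<tau>) z) w \<noteq> 0} \<subseteq> \<rho> \<and> {w. projl (f z) w \<noteq> 0} \<subseteq> \<rho>"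
        if z: "z \<in> snd L"
        using supp[OF subsetD[OF subL z]] poly_support[OF pair_map_poly(2)[OF f z]] by blast
    qed
    then have "hclass L ?Q (?r \<circ> \<tau>) = hclass L ?Q f"
      using hclass_eq_iff[OF pair_map_comp[OF \<tau>(1) r]] by blast
    then have "hcomp L ?Q (hclass (poly_pair N) ?Q ?r) (hclass L (poly_pair N) \<tau>) = hclass L ?Q f"
      using hcomp_hclass[OF \<tau>(1) r] by simp
    moreover have "hclass L ?Q f \<in> hclasses L ?Q" "hclass (poly_pair N) ?Q ?r \<in> hclasses (poly_pair N) ?Q"
      using f r by (auto simp: hclasses_def)
    \<comment> \<open>The defining property of a shape map, with \<xi> the class of
      \<open>?r\<close>.\<close>
    ultimately have "hcomp K ?Q (hclass (poly_pair N) ?Q ?r) (s (poly_pair N) (hclass L (poly_pair N) \<tau>)) = s ?Q (hclass L ?Q f)"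
      using s cwN cw_type_poly_pair[OF NM, where 'u = 'u] \<tau>cl unfolding is_shape_map_def by blast
    then have "s ?Q (hclass L ?Q f) = hclass K ?Q (?r \<circ> \<sigma>)"
      using hcomp_hclass[OF \<sigma>(1) r] \<sigma>(2) by simp
    then have hom: "pair_homotopic K ?Q (?r \<circ> \<sigma>) g"
      using g hclass_memD by metis
    have smk: "simplicial_map (part_complex k N) (part_complex k NM) ?p"
      by (rule simplicial_map_part[OF sm])
    have top: "topspace (fst (part_pair k K)) \<subseteq> topspace (fst K)"
      by (cases k) auto
    have "cech_pull q (part_pair k K) UNIV (star g) c = cech_pull q (part_pair k K) UNIV (star (?r \<circ> \<sigma>)) c"
      by (rule cech_pull_homotopic[OF compact_pairD(2)[OF K] subK NM(1) c hom, symmetric])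
    also have "\<dots> = cech_pull q (part_pair k K) UNIV (star \<sigma>) (pull_cochain (part_complex k N) ?p c)"
    proof (rule cech_pull_natural[OF car\<sigma> carried_part[OF carried_star[OF pair_map_comp[OF \<sigma>(1) r] subK NM(1)]] smk c, symmetric])
      fix i
      have "z \<in> star (?r \<circ> \<sigma>) (?p i)" if z: "z \<in> star \<sigma> i \<inter> topspace (fst (part_pair k K))" for z
      proof -
        have zK: "z \<in> topspace (fst K)" and pi: "0 < projl (\<sigma> z) i"
          using z top by (auto simp: star_def)
        obtain y where y: "\<sigma> z = Inl y" "y \<in> realization (fst N)"
          using pair_map_poly(1)[OF \<sigma>(1) zK] by blast
        have "i \<in> {v. y v \<noteq> 0}"
          using pi y(1) by simp
        then have "i < ?n"
          using realization_support[OF y(2)] N(3) by blast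
        then show ?thesis
          using simplicial_realization_support(1)[of "\<sigma> z" i ?n ?p] realization_nonneg[OF y(2)] y(1) pi
          by (simp add: star_def)
      qed
      then show "?p i \<in> UNIV \<and> star \<sigma> i \<inter> topspace (fst (part_pair k K)) \<subseteq> star (?r \<circ> \<sigma>) (?p i)"
        by blast
    qed
    finally show ?thesis
      using pull_cocycles[OF simplicial_pair_part[OF N(1)] simplicial_pair_part[OF NM(1)] smk c] by blast
  qed
  note F = factor[OF NM f c v g] and F' = factor[OF NM' f' c' v' g']
  have smk: "simplicial_map (part_complex k N) (part_complex k (nerve_pair L \<gamma>)) e"
    by (rule simplicial_map_part[OF sme])
  have "(\<lambda>s. pull_cochain (part_complex k N) (v \<circ> e) c s - pull_cochain (part_complex k N) (v' \<circ> e) c' s)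
      \<in> coboundaries (part_complex k N) q"
    using pull_coboundaries[OF simplicial_pair_part[OF N(1)] simplicial_pair_part[OF simplicial_pair_nerve_pair[OF subL]] smk d]
    unfolding pull_diff pull_pull[OF smk] .
  from cech_pull_cohomologous[OF car\<sigma> _ _ this] show ?thesis
    using F F' by simp
qed

section \<open>Pairs with the H-shape of a compact pair\<close>

abbreviation bond :: "'a spair \<Rightarrow> 'a set \<times> 'a set \<Rightarrow> 'a set \<times> 'a set \<Rightarrow> ('a, 'a, 'q) shape_map" where
  "bond P C D \<equiv> shape_of_map (subpair P C) (subpair P D) id"

lemma shape_comp_assoc: "shape_comp h (shape_comp g f) = shape_comp (shape_comp h g) f"
  by (simp add: shape_comp_def)

lemma subpair_le_trans: "subpair_le C D \<Longrightarrow> subpair_le D E \<Longrightarrow> subpair_le C E"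
  by (auto simp: subpair_le_def)

lemma subpair_le_refl [simp]: "subpair_le C C"
  by (simp add: subpair_le_def)

lemma compact_subpairs_upper:
  assumes "C \<in> compact_subpairs P" "D \<in> compact_subpairs P"
  obtains E where "E \<in> compact_subpairs P" "subpair_le C E" "subpair_le D E"
proof (rule that[of "(fst C \<union> fst D, snd C \<union> snd D)"])
  show "(fst C \<union> fst D, snd C \<union> snd D) \<in> compact_subpairs P"
    using assms by (auto simp: compact_subpairs_def compactin_Un)
qed (simp_all add: subpair_le_def)

lemma bond_comp:
  "subpair_le C D \<Longrightarrow> subpair_le D E \<Longrightarrow> shape_comp (bond P D E) (bond P C D) = bond P C E"
  using shape_of_map_comp[OF subpair_incl subpair_incl] by fastforce

lemma compact_pair_subpair:
  assumes "hausdorff_pair P" "C \<in> compact_subpairs P"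
  shows "compact_pair (subpair P C)"
  using cs2_system_C_system[OF assms(1)] assms(2) unfolding cs2_system_def C_system_def cs2.simps
  by (elim conjE) blast

text \<open>The system of \<open>R\<close> has the largest member \<open>top\<close>, and
  \<open>L\<close> is its image under the index map of \<open>G\<close>. The composite of
  \<open>F\<close> and \<open>G\<close> at \<open>C\<close> ends in a compact pair below
  \<open>L\<close>, so an inclusion can be added to give all composites the same target.\<close>

lemma H_shape_compact_retract:
  fixes P :: "'a spair" and R :: "'k spair"
  assumes "compact_pair R" "same_H_shape TYPE('q) P R"
  obtains L and e :: "'a set \<times> 'a set \<Rightarrow> ('a, 'a, 'q) shape_map" where "L \<in> compact_subpairs P"
    "\<And>C. C \<in> compact_subpairs P \<Longrightarrow> is_shape_map (subpair P C) (subpair P L) (e C)"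
    "\<And>C D. \<lbrakk>C \<in> compact_subpairs P; D \<in> compact_subpairs P; subpair_le C D\<rbrakk> \<Longrightarrow> shape_comp (e D) (bond P C D) = e C"
    "\<And>C. C \<in> compact_subpairs P \<Longrightarrow>
      \<exists>m\<in>compact_subpairs P. subpair_le C m \<and> subpair_le L m \<and> shape_comp (bond P L m) (e C) = bond P C m"
proof -
  let ?S = "C_system P :: ('a set \<times> 'a set, 'a, 'q) cs2" and ?T = "C_system R :: ('k set \<times> 'k set, 'k, 'q) cs2"
  have sel: "cs2_index ?S = compact_subpairs P" "cs2_le ?S = subpair_le" "cs2_pair ?S = subpair P" "cs2_bond ?S = bond P"
    "cs2_index ?T = compact_subpairs R" "cs2_le ?T = subpair_le" "cs2_pair ?T = subpair R" "cs2_bond ?T = bond R"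
    by (simp_all add: C_system_def)
  obtain F G where F: "cs2_morphism ?S ?T F" and G: "cs2_morphism ?T ?S G"
    and GF: "cs2_homotopic ?S ?S (cs2_comp G F) (cs2_id ?S)"
    using assms(2) unfolding same_H_shape_def cs2_homotopy_type_eq_def by blast
  define top where "top = (topspace (fst R), snd R)"
  have top: "top \<in> compact_subpairs R" "\<And>C. C \<in> compact_subpairs R \<Longrightarrow> subpair_le C top"
    using assms(1) compactin_subset_topspace
    by (fastforce simp: top_def compact_subpairs_def compact_pair_def hausdorff_pair_def compact_space_def subpair_le_def)+
  define L where "L = fst G top"
  define GFi where "GFi C = fst G (fst F C)" for C
  define GFm where "GFm C = shape_comp (snd G (fst F C)) (snd F C)" for C
  have Fi: "fst F C \<in> compact_subpairs R" if "C \<in> compact_subpairs P" for C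
    using F that by (auto simp: cs2_morphism_def sel)
  have Gi: "fst G C \<in> compact_subpairs P" if "C \<in> compact_subpairs R" for C
    using G that by (auto simp: cs2_morphism_def sel)
  have L: "L \<in> compact_subpairs P"
    using Gi top by (simp add: L_def)
  have GFi: "GFi C \<in> compact_subpairs P" "subpair_le (GFi C) L" if "C \<in> compact_subpairs P" for C
    using Gi Fi[OF that] top G by (auto simp: GFi_def L_def cs2_morphism_def sel)
  have GFs: "is_shape_map (subpair P C) (subpair P (GFi C)) (GFm C)" if "C \<in> compact_subpairs P" for C
    unfolding GFm_def GFi_def
    by (rule is_shape_map_comp) (use F G that Fi[OF that] in \<open>auto simp: cs2_morphism_def sel\<close>)
  have GFn: "subpair_le (GFi C) (GFi D)"
      "shape_comp (bond P (GFi C) (GFi D)) (GFm C) = shape_comp (GFm D) (bond P C D)"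
    if "C \<in> compact_subpairs P" "D \<in> compact_subpairs P" "subpair_le C D" for C D
  proof -
    have f: "subpair_le (fst F C) (fst F D)"
      "shape_comp (bond R (fst F C) (fst F D)) (snd F C) = shape_comp (snd F D) (bond P C D)"
      using F that unfolding cs2_morphism_def sel by blast+
    have g: "subpair_le (fst G (fst F C)) (fst G (fst F D))"
      "shape_comp (bond P (fst G (fst F C)) (fst G (fst F D))) (snd G (fst F C)) =
        shape_comp (snd G (fst F D)) (bond R (fst F C) (fst F D))"
      using G f(1) Fi that unfolding cs2_morphism_def sel by blast+
    show "subpair_le (GFi C) (GFi D)"
      using g(1) by (simp add: GFi_def)
    show "shape_comp (bond P (GFi C) (GFi D)) (GFm C) = shape_comp (GFm D) (bond P C D)"
      unfolding GFi_def GFm_def shape_comp_assoc g(2) by (simp only: f(2) shape_comp_assoc[symmetric])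
  qed
  define e where "e C = shape_comp (bond P (GFi C) L) (GFm C)" for C
  show ?thesis
  proof (rule that[OF L, of e])
    fix C assume C: "C \<in> compact_subpairs P"
    show "is_shape_map (subpair P C) (subpair P L) (e C)"
      unfolding e_def by (rule is_shape_map_comp[OF GFs[OF C] shape_of_map_shape_map[OF subpair_incl[OF GFi(2)[OF C]]]])
    obtain m where m: "m \<in> compact_subpairs P" "subpair_le (GFi C) m" "subpair_le C m"
      "shape_comp (bond P (GFi C) m) (GFm C) = shape_comp (bond P C m) (shape_id (subpair P C))"
      using GF C unfolding cs2_homotopic_def sel cs2_comp_def cs2_id_def GFi_def GFm_def by auto
    \<comment> \<open>The pair \<open>m\<close>, on which the composite of \<open>F\<close> and
      \<open>G\<close> becomes an inclusion, is enlarged so as to contain \<open>L\<close>.\<close>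
    obtain m' where m': "m' \<in> compact_subpairs P" "subpair_le m m'" "subpair_le L m'"
      using compact_subpairs_upper[OF m(1) L] .
    have "shape_comp (bond P L m') (e C) = shape_comp (bond P (GFi C) m') (GFm C)"
      unfolding e_def shape_comp_assoc bond_comp[OF GFi(2)[OF C] m'(3)] ..
    also have "\<dots> = shape_comp (bond P m m') (shape_comp (bond P (GFi C) m) (GFm C))"
      unfolding shape_comp_assoc bond_comp[OF m(2) m'(2)] ..
    also have "\<dots> = bond P C m'"
      unfolding m(4) shape_of_map_id[symmetric] bond_comp[OF subpair_le_refl m(3)] bond_comp[OF m(3) m'(2)] ..
    finally show "\<exists>m\<in>compact_subpairs P. subpair_le C m \<and> subpair_le L m \<and> shape_comp (bond P L m) (e C) = bond P C m"
      using m' subpair_le_trans[OF m(3) m'(2)] by blast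
  next
    fix C D assume CD: "C \<in> compact_subpairs P" "D \<in> compact_subpairs P" "subpair_le C D"
    show "shape_comp (e D) (bond P C D) = e C"
      unfolding e_def shape_comp_assoc[symmetric] GFn(2)[OF CD, symmetric]
      unfolding shape_comp_assoc bond_comp[OF GFn(1)[OF CD] GFi(2)[OF CD(2)]] ..
  qed
qed


section \<open>Limits over the compact subpairs\<close>

lemma cech_induced_id:
  assumes "snd P \<subseteq> topspace (fst P)" "A \<in> carrier (cech_cohomology q P)"
  shows "cech_induced q P P id A = A"
proof -
  obtain \<alpha> c where \<alpha>: "open_cover (fst P) \<alpha>" "c \<in> cocycles (nerve_pair P \<alpha>) q" "A = cech_pull q P \<alpha> id c"
    using cech_class_cases[OF assms] .
  have "pair_map P P id"
    by (simp add: pair_map_def)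
  then show ?thesis
    unfolding \<alpha>(3) by (rule cech_induced_pull[OF _ assms(1) carried_nerve_pair[OF assms(1) \<alpha>(1)] \<alpha>(2)])
qed

text \<open>By the rules for pulled back classes, both sides come from the coboundary of one cochain
  on the nerve of a cover of \<open>R\<close>.\<close>

lemma cech_delta_natural:
  assumes "pair_map P R id" "closedin (fst P) (snd P)" "closedin (fst R) (snd R)"
    and "y \<in> carrier (cech_cohomology q (part_pair Subspace R))"
  shows "cech_induced (q + 1) P R id (cech_delta q R y) =
    cech_delta q P (cech_induced q (part_pair Subspace P) (part_pair Subspace R) id y)"
proof -
  have sub: "snd P \<subseteq> topspace (fst P)" "snd R \<subseteq> topspace (fst R)"
    using assms(2,3) closedin_subset by blast+
  obtain \<gamma> c where \<gamma>: "open_cover (fst R) \<gamma>" and c: "c \<in> cocycles (snd (nerve_pair R \<gamma>), {}) q"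
    and y: "y = cech_pull q (part_pair Subspace R) \<gamma> id c"
    using cech_part_cases[OF sub(2) closed_part[OF assms(3)] open_cover_whole assms(4)] by (metis part_complex.simps(3))
  note carR = carried_nerve_pair[OF sub(2) \<gamma>]
  note carP = carried_pair_map[OF assms(1) sub(1) carR]
  note carRS = carried_part[OF carR, of Subspace, unfolded part_complex.simps]
  show ?thesis
    unfolding y cech_delta_pull[OF assms(3) carR c] cech_delta_pull[OF assms(2) carP c]
      cech_induced_pull[OF pair_map_part[OF sub(1) assms(1)] part_pair_subset[OF sub(1)] carRS c]
      cech_induced_pull[OF assms(1) sub(1) carR delta_cocycles[OF carriedD(2)[OF carR] c]] ..
qed

section \<open>The three limits indexed by the compact pairs of one pair\<close>

fun part_index :: "part \<Rightarrow> 'a set \<times> 'a set \<Rightarrow> 'a set \<times> 'a set" where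
  "part_index Relative C = C"
| "part_index Absolute C = (fst C, {})"
| "part_index Subspace C = (snd C, {})"

text \<open>Chooses a compact pair with a prescribed index. For the subspace this is the smallest
  one, a compact set paired with itself, so that by \<open>part_lift_index\<close> it lies below all
  others with that index.\<close>

fun part_lift :: "part \<Rightarrow> 'a set \<times> 'a set \<Rightarrow> 'a set \<times> 'a set" where
  "part_lift Subspace D = (fst D, fst D)"
| "part_lift _ D = D"

lemma part_index_compact:
  "C \<in> compact_subpairs P \<Longrightarrow> part_index k C \<in> compact_subpairs (part_pair k P)"
  by (cases k) (auto simp: compact_subpairs_def compactin_subtopology)

lemma subpair_part_index:
  "C \<in> compact_subpairs P \<Longrightarrow> subpair (part_pair k P) (part_index k C) = part_pair k (subpair P C)"
  by (cases k) (auto simp: compact_subpairs_def subpair_def subtopology_subtopology inf_absorb2)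

lemma part_lift_compact:
  assumes "D \<in> compact_subpairs (part_pair k P)"
  shows "part_lift k D \<in> compact_subpairs P" "part_index k (part_lift k D) = D"
  using assms by (cases k; auto simp: compact_subpairs_def compactin_subtopology)+

lemma part_index_mono: "subpair_le C D \<Longrightarrow> subpair_le (part_index k C) (part_index k D)"
  by (cases k) (auto simp: subpair_le_def)

lemma part_lift_mono: "subpair_le C D \<Longrightarrow> subpair_le (part_lift k C) (part_lift k D)"
  by (cases k) (auto simp: subpair_le_def)

lemma part_lift_index: "C \<in> compact_subpairs P \<Longrightarrow> subpair_le (part_lift k (part_index k C)) C"
  by (cases k) (auto simp: compact_subpairs_def subpair_le_def)

lemma hausdorff_pair_part: "hausdorff_pair P \<Longrightarrow> hausdorff_pair (part_pair k P)"
  by (cases k) (auto simp: hausdorff_pair_def Hausdorff_space_subtopology)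

text \<open>Elements of the limit of a part, but indexed by the compact pairs of \<open>P\<close>.
  The three limits then share one index set, and their families can be compared at each
  \<open>C\<close>.\<close>

definition cech_family ::
    "part \<Rightarrow> int \<Rightarrow> 'a spair \<Rightarrow> ('a set \<times> 'a set \<Rightarrow> ('a, 'g::ab_group_add) cech_class) \<Rightarrow> bool" where
  "cech_family k q P \<phi> \<longleftrightarrow>
     (\<forall>C\<in>compact_subpairs P. \<phi> C \<in> carrier (cech_cohomology q (part_pair k (subpair P C)))) \<and>
     (\<forall>C\<in>compact_subpairs P. \<forall>D\<in>compact_subpairs P. subpair_le C D \<longrightarrow>
        cech_induced q (part_pair k (subpair P C)) (part_pair k (subpair P D)) id (\<phi> D) = \<phi> C)"

lemma H_cohomology_carrier:
  "\<phi> \<in> carrier (H_cohomology q P) \<longleftrightarrow> \<phi> \<in> extensional (compact_subpairs P) \<and>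
     (\<forall>C\<in>compact_subpairs P. \<phi> C \<in> carrier (cech_cohomology q (subpair P C))) \<and>
     (\<forall>C\<in>compact_subpairs P. \<forall>D\<in>compact_subpairs P. subpair_le C D \<longrightarrow>
        cech_induced q (subpair P C) (subpair P D) id (\<phi> D) = \<phi> C)"
  by (auto simp: H_cohomology_def PiE_iff)

lemma cech_family_of_limit:
  assumes "\<phi> \<in> carrier (H_cohomology q (part_pair k P))"
  shows "cech_family k q P (\<lambda>C. \<phi> (part_index k C))"
  using assms unfolding H_cohomology_carrier cech_family_def
  by (metis part_index_compact part_index_mono subpair_part_index)

text \<open>The value at \<open>C\<close> depends only on the index of \<open>C\<close>: the
  smallest compact pair with that index has the same part, and the map induced between them is the
  identity.\<close>

lemma limit_of_cech_family:
  assumes P: "hausdorff_pair P" and \<psi>: "cech_family k q P \<psi>"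
  obtains \<Psi> where "\<Psi> \<in> carrier (H_cohomology q (part_pair k P))"
    "\<And>C. C \<in> compact_subpairs P \<Longrightarrow> \<Psi> (part_index k C) = \<psi> C"
proof
  let ?\<Psi> = "\<lambda>D\<in>compact_subpairs (part_pair k P). \<psi> (part_lift k D)"
  have eq: "part_pair k (subpair P (part_lift k D)) = subpair (part_pair k P) D"
    if "D \<in> compact_subpairs (part_pair k P)" for D
    using subpair_part_index[OF part_lift_compact(1)[OF that], of k] part_lift_compact(2)[OF that] by simp
  show "?\<Psi> \<in> carrier (H_cohomology q (part_pair k P))"
    using \<psi> part_lift_compact(1) part_lift_mono
    unfolding H_cohomology_carrier cech_family_def by (simp add: eq[symmetric]) blast
  fix C assume C: "C \<in> compact_subpairs P"
  let ?D = "part_lift k (part_index k C)"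
  note D = part_lift_compact[OF part_index_compact[OF C, of k]]
  have same: "part_pair k (subpair P ?D) = part_pair k (subpair P C)"
    using eq[OF part_index_compact[OF C]] subpair_part_index[OF C, of k] by simp
  have "cech_induced q (part_pair k (subpair P ?D)) (part_pair k (subpair P C)) id (\<psi> C) = \<psi> ?D"
    using \<psi> C D(1) part_lift_index[OF C] unfolding cech_family_def by blast
  then have "\<psi> ?D = \<psi> C"
    unfolding same using cech_induced_id[OF part_pair_subset[OF compact_pairD(1)[OF compact_pair_subpair[OF P C]]]]
      \<psi> C unfolding cech_family_def by metis
  then show "?\<Psi> (part_index k C) = \<psi> C"
    using part_index_compact[OF C] by simp
qed

section \<open>The limit groups and the homomorphisms between them\<close>

lemma H_cohomology_group:
  fixes P :: "'a spair"
  assumes P: "hausdorff_pair P"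
  shows "group (H_cohomology q P :: ('a, 'g::ab_group_add) H_class monoid)"
proof -
  let ?I = "compact_subpairs P"
  let ?G = "\<lambda>C. cech_cohomology q (subpair P C) :: ('a, 'g) cech_class monoid"
  let ?H = "H_cohomology q P :: ('a, 'g) H_class monoid"
  have sub: "snd (subpair P C) \<subseteq> topspace (fst (subpair P C))" if "C \<in> ?I" for C
    by (rule compact_pairD(1)[OF compact_pair_subpair[OF P that]])
  have G: "group (?G C)" if "C \<in> ?I" for C
    by (rule cech_group[OF sub[OF that]])
  have hom: "group_hom (?G D) (?G C) (cech_induced q (subpair P C) (subpair P D) id)"
    if "C \<in> ?I" "D \<in> ?I" "subpair_le C D" for C D
    using G cech_induced_hom[OF subpair_incl[OF that(3)] sub[OF that(1)] sub[OF that(2)]] that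
    by (simp add: group_hom_def group_hom_axioms_def)
  interpret prod: group "product_group ?I ?G"
    by (rule product_group) (rule G)
  have sg: "subgroup (carrier ?H) (product_group ?I ?G)"
  proof (rule prod.subgroupI)
    show "carrier ?H \<subseteq> carrier (product_group ?I ?G)"
      by (auto simp: H_cohomology_def)
    have "\<one>\<^bsub>product_group ?I ?G\<^esub> \<in> carrier ?H"
      using G group_hom.hom_one[OF hom] by (auto simp: H_cohomology_carrier group.is_monoid monoid.one_closed)
    then show "carrier ?H \<noteq> {}" by blast
  next
    fix \<phi> assume \<phi>: "\<phi> \<in> carrier ?H"
    have mem: "\<phi> C \<in> carrier (?G C)" if "C \<in> ?I" for C
      using \<phi> that by (simp add: H_cohomology_carrier)
    have "inv\<^bsub>product_group ?I ?G\<^esub> \<phi> = (\<lambda>C\<in>?I. inv\<^bsub>?G C\<^esub> \<phi> C)"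
      using \<phi> G by (intro inv_product_group) (auto simp: H_cohomology_def)
    moreover have "cech_induced q (subpair P C) (subpair P D) id (inv\<^bsub>?G D\<^esub> \<phi> D) = inv\<^bsub>?G C\<^esub> \<phi> C"
      if "C \<in> ?I" "D \<in> ?I" "subpair_le C D" for C D
      using group_hom.hom_inv[OF hom[OF that] mem[OF that(2)]] \<phi> that by (simp add: H_cohomology_carrier)
    ultimately show "inv\<^bsub>product_group ?I ?G\<^esub> \<phi> \<in> carrier ?H"
      using G mem by (auto simp: H_cohomology_carrier group.inv_closed)
  next
    fix \<phi> \<psi> assume \<phi>: "\<phi> \<in> carrier ?H" and \<psi>: "\<psi> \<in> carrier ?H"
    have mem: "\<phi> C \<in> carrier (?G C)" "\<psi> C \<in> carrier (?G C)" if "C \<in> ?I" for C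
      using \<phi> \<psi> that by (simp_all add: H_cohomology_carrier)
    have "cech_induced q (subpair P C) (subpair P D) id (\<phi> D \<otimes>\<^bsub>?G D\<^esub> \<psi> D) = \<phi> C \<otimes>\<^bsub>?G C\<^esub> \<psi> C"
      if "C \<in> ?I" "D \<in> ?I" "subpair_le C D" for C D
      using group_hom.hom_mult[OF hom[OF that] mem[OF that(2)]] \<phi> \<psi> that by (simp add: H_cohomology_carrier)
    then show "\<phi> \<otimes>\<^bsub>product_group ?I ?G\<^esub> \<psi> \<in> carrier ?H"
      using G mem by (auto simp: H_cohomology_carrier group.is_monoid monoid.m_closed)
  qed
  have "?H = (product_group ?I ?G)\<lparr>carrier := carrier ?H\<rparr>"
    by (simp add: H_cohomology_def)
  then show ?thesis
    using prod.subgroup_imp_group[OF sg] by simp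
qed

lemma H_cohomology_mult: "\<phi> \<otimes>\<^bsub>H_cohomology q P\<^esub> \<psi> = (\<lambda>C\<in>compact_subpairs P. \<phi> C \<otimes>\<^bsub>cech_cohomology q (subpair P C)\<^esub> \<psi> C)"
  by (simp add: H_cohomology_def)

lemma H_cohomology_one: "\<one>\<^bsub>H_cohomology q P\<^esub> = (\<lambda>C\<in>compact_subpairs P. \<one>\<^bsub>cech_cohomology q (subpair P C)\<^esub>)"
  by (simp add: H_cohomology_def)

lemma H_restrict_hom:
  fixes P :: "'a spair"
  assumes "compact_subpairs R \<subseteq> compact_subpairs P" "\<And>C. C \<in> compact_subpairs R \<Longrightarrow> subpair R C = subpair P C"
  shows "H_restrict R \<in> hom (H_cohomology q P :: ('a, 'g::ab_group_add) H_class monoid) (H_cohomology q R)"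
proof (rule homI)
  fix \<phi> :: "('a, 'g) H_class" assume "\<phi> \<in> carrier (H_cohomology q P)"
  then show "H_restrict R \<phi> \<in> carrier (H_cohomology q R)"
    using assms by (auto simp: H_cohomology_carrier H_restrict_def subset_iff)
next
  fix \<phi> \<psi> :: "('a, 'g) H_class"
  show "H_restrict R (\<phi> \<otimes>\<^bsub>H_cohomology q P\<^esub> \<psi>) = H_restrict R \<phi> \<otimes>\<^bsub>H_cohomology q R\<^esub> H_restrict R \<psi>"
    unfolding H_cohomology_mult H_restrict_def
    by (rule ext) (use assms in \<open>auto simp: restrict_def\<close>)
qed

lemma compact_subpairs_absolute: "compact_subpairs (part_pair Absolute P) \<subseteq> compact_subpairs P"
  by (auto simp: compact_subpairs_def)

lemma compact_subpairs_subspace: "compact_subpairs (part_pair Subspace P) \<subseteq> compact_subpairs (part_pair Absolute P)"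
  by (auto simp: compact_subpairs_def compactin_subtopology)

lemma subpair_absolute: "subpair (part_pair Absolute P) C = subpair P C"
  by (simp add: subpair_def)

lemma subpair_subspace:
  "C \<in> compact_subpairs (part_pair Subspace P) \<Longrightarrow> subpair (part_pair Subspace P) C = subpair (part_pair Absolute P) C"
  by (auto simp: compact_subpairs_def compactin_subtopology subpair_def subtopology_subtopology inf_absorb2)

lemma subspace_index:
  assumes "C \<in> compact_subpairs P"
  shows "(snd C, {}) \<in> compact_subpairs (part_pair Subspace P)"
    "subpair (part_pair Subspace P) (snd C, {}) = part_pair Subspace (subpair P C)"
  using part_index_compact[OF assms, of Subspace] subpair_part_index[OF assms, of Subspace] by simp_all

lemma absolute_index:
  assumes "C \<in> compact_subpairs P"
  shows "(fst C, {}) \<in> compact_subpairs (part_pair Absolute P)"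
    "subpair (part_pair Absolute P) (fst C, {}) = part_pair Absolute (subpair P C)"
  using part_index_compact[OF assms, of Absolute] subpair_part_index[OF assms, of Absolute] by simp_all

lemma H_delta_hom:
  fixes P :: "'a spair"
  assumes P: "hausdorff_pair P"
  shows "H_delta q P \<in> hom (H_cohomology q (part_pair Subspace P) :: ('a, 'g::ab_group_add) H_class monoid) (H_cohomology (q + 1) P)"
proof (rule homI)
  note cl = compact_pairD(4)[OF compact_pair_subpair[OF P]]
  fix \<psi> :: "('a, 'g) H_class" assume "\<psi> \<in> carrier (H_cohomology q (part_pair Subspace P))"
  from cech_family_of_limit[OF this]
  have \<psi>: "cech_family Subspace q P (\<lambda>C. \<psi> (snd C, {}))"
    by simp
  then have mem: "\<psi> (snd C, {}) \<in> carrier (cech_cohomology q (part_pair Subspace (subpair P C)))" if "C \<in> compact_subpairs P" for C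
    using that by (simp add: cech_family_def)
  have "cech_delta q (subpair P C) (\<psi> (snd C, {})) \<in> carrier (cech_cohomology (q + 1) (subpair P C))" if "C \<in> compact_subpairs P" for C
    using cech_delta_hom[OF cl[OF that]] mem[OF that] by (rule hom_in_carrier)
  moreover have "cech_induced (q + 1) (subpair P C) (subpair P D) id (cech_delta q (subpair P D) (\<psi> (snd D, {}))) =
      cech_delta q (subpair P C) (\<psi> (snd C, {}))"
    if "C \<in> compact_subpairs P" "D \<in> compact_subpairs P" "subpair_le C D" for C D
    using cech_delta_natural[OF subpair_incl[OF that(3)] cl[OF that(1)] cl[OF that(2)] mem[OF that(2)]] \<psi> that
    by (simp add: cech_family_def)
  ultimately show "H_delta q P \<psi> \<in> carrier (H_cohomology (q + 1) P)"
    by (simp add: H_cohomology_carrier H_delta_def)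
next
  note cl = compact_pairD(4)[OF compact_pair_subpair[OF P]]
  fix \<phi> \<psi> :: "('a, 'g) H_class"
  assume "\<phi> \<in> carrier (H_cohomology q (part_pair Subspace P))" "\<psi> \<in> carrier (H_cohomology q (part_pair Subspace P))"
  note cech_family_of_limit[OF this(1)] cech_family_of_limit[OF this(2)]
  then have mem: "\<phi> (snd C, {}) \<in> carrier (cech_cohomology q (part_pair Subspace (subpair P C)))"
      "\<psi> (snd C, {}) \<in> carrier (cech_cohomology q (part_pair Subspace (subpair P C)))" if "C \<in> compact_subpairs P" for C
    using that by (simp_all add: cech_family_def)
  have "cech_delta q (subpair P C) ((\<phi> \<otimes>\<^bsub>H_cohomology q (part_pair Subspace P)\<^esub> \<psi>) (snd C, {})) =
      cech_delta q (subpair P C) (\<phi> (snd C, {})) \<otimes>\<^bsub>cech_cohomology (q + 1) (subpair P C)\<^esub> cech_delta q (subpair P C) (\<psi> (snd C, {}))"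
    if C: "C \<in> compact_subpairs P" for C
    using hom_mult[OF cech_delta_hom[OF cl[OF C]] mem[OF C]] subspace_index[OF C]
    by (simp only: H_cohomology_mult restrict_apply' if_True)
  then show "H_delta q P (\<phi> \<otimes>\<^bsub>H_cohomology q (part_pair Subspace P)\<^esub> \<psi>) =
      H_delta q P \<phi> \<otimes>\<^bsub>H_cohomology (q + 1) P\<^esub> H_delta q P \<psi>"
    unfolding H_delta_def H_cohomology_mult[where q = "q + 1"] by (auto intro!: restrict_ext)
qed


section \<open>Lifting classes along the shape retraction\<close>

lemma cocycles_absolute:
  assumes "c \<in> cocycles NM q"
  shows "c \<in> cocycles (fst NM, {}) q"
  using assms by (auto simp: cocycles_iff cochains_def)

text \<open>The maps \<open>\<sigma> C\<close> do not depend on the part \<open>k\<close>: one choice serves the pair, the space and the subspace.\<close>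

definition cohomology_lift ::
    "'g::ab_group_add itself \<Rightarrow> 'a spair \<Rightarrow> 'a set \<times> 'a set \<Rightarrow> nat set set \<times> nat set set \<Rightarrow>
     ('a \<Rightarrow> 'u cw_universe) \<Rightarrow> ('a set \<times> 'a set \<Rightarrow> 'a \<Rightarrow> 'u cw_universe) \<Rightarrow> bool" where
  "cohomology_lift _ P L NM \<tau> \<sigma> \<longleftrightarrow>
     (\<forall>C\<in>compact_subpairs P. pair_map (subpair P C) (poly_pair NM) (\<sigma> C)) \<and>
     (\<forall>k q. \<forall>c \<in> cocycles (part_complex k NM) q :: (nat list \<Rightarrow> 'g) set.
        cech_family k q P (\<lambda>C. cech_pull q (part_pair k (subpair P C)) UNIV (star (\<sigma> C)) c) \<and>
        (\<forall>\<phi>. cech_family k q P \<phi> \<and> \<phi> L = cech_pull q (part_pair k (subpair P L)) UNIV (star \<tau>) c \<longrightarrow>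
          (\<forall>C\<in>compact_subpairs P. \<phi> C = cech_pull q (part_pair k (subpair P C)) UNIV (star (\<sigma> C)) c)))"

lemma cohomology_liftD:
  fixes c :: "nat list \<Rightarrow> 'g::ab_group_add"
  assumes "cohomology_lift TYPE('g) P L NM \<tau> \<sigma>"
  shows "C \<in> compact_subpairs P \<Longrightarrow> pair_map (subpair P C) (poly_pair NM) (\<sigma> C)"
    and "c \<in> cocycles (part_complex k NM) q \<Longrightarrow>
      cech_family k q P (\<lambda>C. cech_pull q (part_pair k (subpair P C)) UNIV (star (\<sigma> C)) c)"
    and "\<lbrakk>c \<in> cocycles (part_complex k NM) q; cech_family k q P \<phi>;
        \<phi> L = cech_pull q (part_pair k (subpair P L)) UNIV (star \<tau>) c; C \<in> compact_subpairs P\<rbrakk> \<Longrightarrow>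
      \<phi> C = cech_pull q (part_pair k (subpair P C)) UNIV (star (\<sigma> C)) c"
  using assms unfolding cohomology_lift_def by blast+

text \<open>Naturality of \<open>e\<close> makes the restriction of \<open>\<sigma> D\<close> to
  \<open>C\<close> homotopic to \<open>\<sigma> C\<close>, whence compatibility. For recovery,
  \<tau> is compared on \<open>L\<close> with a map \<tau>' representing the family on a larger pair
  \<open>m\<close>, and \<open>shape_map_cech_cong\<close> carries the equality of classes on
  \<open>L\<close> over to \<open>C\<close>.\<close>

lemma H_shape_compact_lift:
  fixes P :: "'a spair" and R :: "'k spair"
  assumes P: "hausdorff_pair P" and R: "compact_pair R" and shape: "same_H_shape TYPE('u cw_universe) P R"
  obtains L where "L \<in> compact_subpairs P"
    "\<And>NM (\<tau> :: 'a \<Rightarrow> 'u cw_universe). \<lbrakk>simplicial_pair NM; finite (fst NM); pair_map (subpair P L) (poly_pair NM) \<tau>\<rbrakk> \<Longrightarrow>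
      \<exists>\<sigma>. cohomology_lift TYPE('g::ab_group_add) P L NM \<tau> \<sigma>"
proof -
  obtain L and e :: "'a set \<times> 'a set \<Rightarrow> ('a, 'a, 'u cw_universe) shape_map" where L: "L \<in> compact_subpairs P"
    and e: "\<And>C. C \<in> compact_subpairs P \<Longrightarrow> is_shape_map (subpair P C) (subpair P L) (e C)"
    and ebond: "\<And>C D. \<lbrakk>C \<in> compact_subpairs P; D \<in> compact_subpairs P; subpair_le C D\<rbrakk> \<Longrightarrow> shape_comp (e D) (bond P C D) = e C"
    and emid: "\<And>C. C \<in> compact_subpairs P \<Longrightarrow>
      \<exists>m\<in>compact_subpairs P. subpair_le C m \<and> subpair_le L m \<and> shape_comp (bond P L m) (e C) = bond P C m"
    using H_shape_compact_retract[OF R shape] by blast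
  note cp = compact_pair_subpair[OF P]
  have bond_class: "bond P C D Q (hclass (subpair P D) Q h) = hclass (subpair P C) Q h"
    if "subpair_le C D" "pair_map (subpair P D) Q h" "cw_type Q" for C D h and Q :: "'u cw_universe spair"
    using that hcomp_hclass[OF subpair_incl[OF that(1)] that(2)] by (auto simp: shape_of_map_def hclasses_def)
  show ?thesis
  proof (rule that[OF L])
    fix NM and \<tau> :: "'a \<Rightarrow> 'u cw_universe"
    assume NM: "simplicial_pair NM" "finite (fst NM)" and \<tau>: "pair_map (subpair P L) (poly_pair NM) \<tau>"
    let ?Q = "poly_pair NM :: 'u cw_universe spair"
    let ?\<eta> = "hclass (subpair P L) ?Q \<tau>"
    note cwQ = cw_type_poly_pair[OF NM, where 'u = 'u]
    have \<eta>: "?\<eta> \<in> hclasses (subpair P L) ?Q"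
      using \<tau> by (auto simp: hclasses_def)
    have ecl: "e C ?Q ?\<eta> \<in> hclasses (subpair P C) ?Q" if "C \<in> compact_subpairs P" for C
      using conjunct1[OF e[OF that, unfolded is_shape_map_def], rule_format, of ?Q ?\<eta>] cwQ \<eta> by simp
    have "\<forall>C\<in>compact_subpairs P. \<exists>g. g \<in> e C ?Q ?\<eta>"
      using hclasses_nonempty[OF ecl] by blast
    then obtain \<sigma> where \<sigma>: "\<And>C. C \<in> compact_subpairs P \<Longrightarrow> \<sigma> C \<in> e C ?Q ?\<eta>"
      by metis
    have \<sigma>m: "pair_map (subpair P C) ?Q (\<sigma> C)" and \<sigma>c: "e C ?Q ?\<eta> = hclass (subpair P C) ?Q (\<sigma> C)"
      if "C \<in> compact_subpairs P" for C
      using hclasses_memD[OF ecl[OF that] \<sigma>[OF that]] by auto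
    have \<sigma>h: "pair_homotopic (subpair P C) ?Q (\<sigma> D) (\<sigma> C)"
      if CD: "C \<in> compact_subpairs P" "D \<in> compact_subpairs P" "subpair_le C D" for C D
    proof -
      have "e C ?Q ?\<eta> = bond P C D ?Q (e D ?Q ?\<eta>)"
        using ebond[OF CD] by (metis shape_comp_def)
      also have "\<dots> = hclass (subpair P C) ?Q (\<sigma> D)"
        unfolding \<sigma>c[OF CD(2)] by (rule bond_class[OF CD(3) \<sigma>m[OF CD(2)] cwQ])
      finally show ?thesis
        using \<sigma>[OF CD(1)] hclass_memD by metis
    qed
    have fam: "cech_family k q P (\<lambda>C. cech_pull q (part_pair k (subpair P C)) UNIV (star (\<sigma> C)) c)"
      if c: "c \<in> cocycles (part_complex k NM) q" for k q and c :: "nat list \<Rightarrow> 'g"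
      unfolding cech_family_def
    proof (intro conjI ballI impI)
      note car = carried_part[OF carried_star[OF \<sigma>m compact_pairD(1)[OF cp] NM(1)]]
      show "cech_pull q (part_pair k (subpair P C)) UNIV (star (\<sigma> C)) c \<in> carrier (cech_cohomology q (part_pair k (subpair P C)))"
        if "C \<in> compact_subpairs P" for C
        by (rule cech_pull_carrier[OF car[OF that that] c])
      fix C D assume CD: "C \<in> compact_subpairs P" "D \<in> compact_subpairs P" "subpair_le C D"
      note subC = compact_pairD(1)[OF cp[OF CD(1)]]
      show "cech_induced q (part_pair k (subpair P C)) (part_pair k (subpair P D)) id
          (cech_pull q (part_pair k (subpair P D)) UNIV (star (\<sigma> D)) c) =
        cech_pull q (part_pair k (subpair P C)) UNIV (star (\<sigma> C)) c"
        unfolding cech_induced_pull[OF pair_map_part[OF subC subpair_incl[OF CD(3)]] part_pair_subset[OF subC] car[OF CD(2) CD(2)] c]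
        by (rule cech_pull_homotopic[OF compact_pairD(2)[OF cp[OF CD(1)]] subC NM(1) c \<sigma>h[OF CD]])
    qed
    have uniq: "\<phi> C = cech_pull q (part_pair k (subpair P C)) UNIV (star (\<sigma> C)) c"
      if c: "c \<in> cocycles (part_complex k NM) q" and \<phi>: "cech_family k q P \<phi>"
        and \<phi>L: "\<phi> L = cech_pull q (part_pair k (subpair P L)) UNIV (star \<tau>) c" and C: "C \<in> compact_subpairs P"
      for k q \<phi> C and c :: "nat list \<Rightarrow> 'g"
    proof -
      obtain m where m: "m \<in> compact_subpairs P" "subpair_le C m" "subpair_le L m"
        "shape_comp (bond P L m) (e C) = bond P C m"
        using emid[OF C] by blast
      have \<phi>mem: "\<phi> m \<in> carrier (cech_cohomology q (part_pair k (subpair P m)))"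
        using \<phi> m(1) by (simp add: cech_family_def)
      \<comment> \<open>The value on \<open>m\<close> gets a polyhedral pair of its own;
        \<open>NM\<close> is known to represent the family on \<open>L\<close> only.\<close>
      obtain NM' c' and \<tau>' :: "'a \<Rightarrow> 'u cw_universe" where NM': "simplicial_pair NM'" "finite (fst NM')"
        and \<tau>': "pair_map (subpair P m) (poly_pair NM') \<tau>'" and c': "c' \<in> cocycles (part_complex k NM') q"
        and \<phi>m: "\<phi> m = cech_pull q (part_pair k (subpair P m)) UNIV (star \<tau>') c'"
        by (rule cech_class_polyhedral[OF cp[OF m(1)] \<phi>mem, where 'u = 'u])
      let ?Q' = "poly_pair NM' :: 'u cw_universe spair"
      note cwQ' = cw_type_poly_pair[OF NM', where 'u = 'u]
      note car = carried_part[OF carried_star[OF \<tau>' compact_pairD(1)[OF cp[OF m(1)]] NM'(1)]]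
      have restr: "\<phi> D = cech_pull q (part_pair k (subpair P D)) UNIV (star \<tau>') c'"
        if D: "D \<in> compact_subpairs P" "subpair_le D m" for D
      proof -
        note subD = compact_pairD(1)[OF cp[OF D(1)]]
        have "\<phi> D = cech_induced q (part_pair k (subpair P D)) (part_pair k (subpair P m)) id (\<phi> m)"
          using \<phi> D m(1) by (simp add: cech_family_def)
        then show ?thesis
          unfolding \<phi>m cech_induced_pull[OF pair_map_part[OF subD subpair_incl[OF D(2)]] part_pair_subset[OF subD] car c'] .
      qed
      have \<tau>'D: "pair_map (subpair P D) ?Q' \<tau>'" if "subpair_le D m" for D
        using pair_map_comp[OF subpair_incl[OF that] \<tau>'] by simp
      \<comment> \<open>Followed by the inclusion of \<open>L\<close> in \<open>m\<close>, the shape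
        map \<open>e C\<close> is the inclusion of \<open>C\<close>, so it sends the class of
        \<tau>' on \<open>L\<close> to the class of the same function on \<open>C\<close>.\<close>
      have "e C ?Q' (hclass (subpair P L) ?Q' \<tau>') = e C ?Q' (bond P L m ?Q' (hclass (subpair P m) ?Q' \<tau>'))"
        by (simp add: bond_class[OF m(3) \<tau>' cwQ'])
      also have "\<dots> = bond P C m ?Q' (hclass (subpair P m) ?Q' \<tau>')"
        using m(4) by (metis shape_comp_def)
      also have "\<dots> = hclass (subpair P C) ?Q' \<tau>'"
        by (rule bond_class[OF m(2) \<tau>' cwQ'])
      finally have "\<tau>' \<in> e C ?Q' (hclass (subpair P L) ?Q' \<tau>')"
        using hclass_self[OF \<tau>'D[OF m(2)]] by simp
      from shape_map_cech_cong[OF e[OF C] cp[OF C] cp[OF L] NM NM' \<tau> \<tau>'D[OF m(3)] c c' _ \<sigma>[OF C] this]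
      show ?thesis
        using \<phi>L restr[OF L m(3)] restr[OF C m(2)] by simp
    qed
    have "cohomology_lift TYPE('g) P L NM \<tau> \<sigma>"
      unfolding cohomology_lift_def
    proof (intro conjI allI ballI impI, goal_cases)
      case (1 C)
      then show ?case by (rule \<sigma>m)
    next
      case (2 k q c)
      then show ?case by (rule fam)
    next
      case (3 k q c \<phi> C)
      then show ?case using uniq by blast
    qed
    then show "\<exists>\<sigma>. cohomology_lift TYPE('g) P L NM \<tau> \<sigma>" by blast
  qed
qed


section \<open>Exactness\<close>

lemma H_restrict_absolute_hom:
  "H_restrict (part_pair Absolute P) \<in> hom (H_cohomology q P) (H_cohomology q (part_pair Absolute P))"
  by (rule H_restrict_hom[OF compact_subpairs_absolute subpair_absolute])

lemma H_restrict_subspace_hom: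
  "H_restrict (part_pair Subspace P) \<in> hom (H_cohomology q (part_pair Absolute P)) (H_cohomology q (part_pair Subspace P))"
  by (rule H_restrict_hom[OF compact_subpairs_subspace subpair_subspace])

lemma cech_induced_one:
  assumes "pair_map P R id" "snd P \<subseteq> topspace (fst P)" "snd R \<subseteq> topspace (fst R)"
  shows "cech_induced q P R id \<one>\<^bsub>cech_cohomology q R\<^esub> = \<one>\<^bsub>cech_cohomology q P\<^esub>"
  by (rule hom_one[OF cech_induced_hom[OF assms] cech_group[OF assms(3)] cech_group[OF assms(2)]])

lemma H_absolute_restrict:
  assumes "\<phi> \<in> carrier (H_cohomology q (part_pair Absolute P))" "C \<in> compact_subpairs P"
  shows "cech_induced q (part_pair Subspace (subpair P C)) (part_pair Absolute (subpair P C)) id (\<phi> (fst C, {})) = \<phi> (snd C, {})"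
proof -
  have "subpair_le (snd C, {}) (fst C, {})"
    using assms(2) by (auto simp: compact_subpairs_def subpair_le_def)
  moreover have "(snd C, {}) \<in> compact_subpairs (part_pair Absolute P)"
    using subspace_index(1)[OF assms(2)] compact_subpairs_subspace by blast
  ultimately have "cech_induced q (subpair (part_pair Absolute P) (snd C, {})) (subpair (part_pair Absolute P) (fst C, {})) id
      (\<phi> (fst C, {})) = \<phi> (snd C, {})"
    using assms(1) absolute_index(1)[OF assms(2)] unfolding H_cohomology_carrier by blast
  then show ?thesis
    unfolding subpair_subspace[OF subspace_index(1)[OF assms(2)], symmetric] subspace_index(2)[OF assms(2)]
      absolute_index(2)[OF assms(2)] .
qed

section \<open>Exactness at each of the three kinds of limit group\<close>

context
  fixes P :: "'a spair" and R :: "'k spair"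
  assumes P: "hausdorff_pair P" and R: "compact_pair R" and shape: "same_H_shape TYPE('u cw_universe) P R"
begin

text \<open>A relative preimage of the value on \<open>L\<close> is lifted to the limit, and the
  lift of the same cocycle, read as an absolute one, is the given family. Conversely, restriction to
  a compact set \<open>K\<close> in the subspace factors through the cohomology of
  \<open>(K, K)\<close>, which is zero.\<close>

lemma H_exact_absolute:
  "kernel (H_cohomology q (part_pair Absolute P) :: ('a, 'g::ab_group_add) H_class monoid)
      (H_cohomology q (part_pair Subspace P)) (H_restrict (part_pair Subspace P)) =
    H_restrict (part_pair Absolute P) ` carrier (H_cohomology q P)"
proof (intro equalityI subsetI)
  fix \<phi> :: "('a, 'g) H_class"
  assume "\<phi> \<in> H_restrict (part_pair Absolute P) ` carrier (H_cohomology q P)"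
  then obtain \<psi> where \<psi>: "\<psi> \<in> carrier (H_cohomology q P)" and \<phi>: "\<phi> = H_restrict (part_pair Absolute P) \<psi>"
    by blast
  have "\<psi> D = \<one>\<^bsub>cech_cohomology q (subpair (part_pair Subspace P) D)\<^esub>"
    if D: "D \<in> compact_subpairs (part_pair Subspace P)" for D
  proof -
    let ?E = "part_lift Subspace D"
    note E = part_lift_compact(1)[OF D]
    have D': "D \<in> compact_subpairs P" "subpair_le D ?E"
      using D compact_subpairs_subspace compact_subpairs_absolute
      by (blast, auto simp: compact_subpairs_def subpair_le_def)
    have "snd (subpair P ?E) = topspace (fst (subpair P ?E))"
      using compactin_subset_topspace[of "fst P" "fst ?E"] E by (auto simp: subpair_def compact_subpairs_def)
    then have "\<psi> ?E = \<one>\<^bsub>cech_cohomology q (subpair P ?E)\<^esub>"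
      using \<psi> E by (intro cech_trivial_pair) (auto simp: H_cohomology_carrier)
    then have "cech_induced q (subpair P D) (subpair P ?E) id (\<psi> ?E) = \<one>\<^bsub>cech_cohomology q (subpair P D)\<^esub>"
      using cech_induced_one[OF subpair_incl[OF D'(2)] compact_pairD(1)[OF compact_pair_subpair[OF P D'(1)]]
          compact_pairD(1)[OF compact_pair_subpair[OF P E]]] by metis
    moreover have "cech_induced q (subpair P D) (subpair P ?E) id (\<psi> ?E) = \<psi> D"
      using \<psi> E D' by (simp add: H_cohomology_carrier)
    ultimately have "\<psi> D = \<one>\<^bsub>cech_cohomology q (subpair P D)\<^esub>"
      by simp
    then show ?thesis
      unfolding subpair_subspace[OF D] subpair_absolute .
  qed
  then have "H_restrict (part_pair Subspace P) \<phi> = \<one>\<^bsub>H_cohomology q (part_pair Subspace P)\<^esub>"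
    unfolding \<phi> H_restrict_def H_cohomology_one using compact_subpairs_subspace[of P]
    by (intro restrict_ext) auto
  then show "\<phi> \<in> kernel (H_cohomology q (part_pair Absolute P)) (H_cohomology q (part_pair Subspace P)) (H_restrict (part_pair Subspace P))"
    using hom_in_carrier[OF H_restrict_absolute_hom \<psi>] by (simp add: kernel_def \<phi>)
next
  fix \<phi> :: "('a, 'g) H_class"
  assume "\<phi> \<in> kernel (H_cohomology q (part_pair Absolute P)) (H_cohomology q (part_pair Subspace P)) (H_restrict (part_pair Subspace P))"
  then have \<phi>: "\<phi> \<in> carrier (H_cohomology q (part_pair Absolute P))"
    and 0: "H_restrict (part_pair Subspace P) \<phi> = \<one>\<^bsub>H_cohomology q (part_pair Subspace P)\<^esub>"
    by (auto simp: kernel_def)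
  obtain L where L: "L \<in> compact_subpairs P" and lift: "\<And>NM (\<tau> :: 'a \<Rightarrow> 'u cw_universe).
      \<lbrakk>simplicial_pair NM; finite (fst NM); pair_map (subpair P L) (poly_pair NM) \<tau>\<rbrakk> \<Longrightarrow>
      \<exists>\<sigma>. cohomology_lift TYPE('g) P L NM \<tau> \<sigma>"
    using H_shape_compact_lift[OF P R shape, where 'g = 'g] by blast
  note cp = compact_pair_subpair[OF P] note cpL = cp[OF L]
  have famA: "cech_family Absolute q P (\<lambda>C. \<phi> (fst C, {}))"
    using cech_family_of_limit[OF \<phi>] by simp
  have "\<phi> (snd L, {}) = \<one>\<^bsub>cech_cohomology q (part_pair Subspace (subpair P L))\<^esub>"
    using fun_cong[OF 0, of "(snd L, {})"] subspace_index[OF L] by (simp only: H_restrict_def H_cohomology_one restrict_apply' if_True)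
  then have "cech_induced q (part_pair Subspace (subpair P L)) (part_pair Absolute (subpair P L)) id (\<phi> (fst L, {})) =
      \<one>\<^bsub>cech_cohomology q (part_pair Subspace (subpair P L))\<^esub>"
    using H_absolute_restrict[OF \<phi> L] by simp
  moreover have "\<phi> (fst L, {}) \<in> carrier (cech_cohomology q (part_pair Absolute (subpair P L)))"
    using famA L by (simp add: cech_family_def)
  ultimately obtain x where x: "x \<in> carrier (cech_cohomology q (subpair P L))"
    "cech_induced q (part_pair Absolute (subpair P L)) (subpair P L) id x = \<phi> (fst L, {})"
    using cech_exact_total[OF compact_pairD(4)[OF cpL]] by blast
  have x': "x \<in> carrier (cech_cohomology q (part_pair Relative (subpair P L)))"
    using x(1) by simp
  obtain NM c and \<tau> :: "'a \<Rightarrow> 'u cw_universe" where NM: "simplicial_pair NM" "finite (fst NM)"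
    and \<tau>: "pair_map (subpair P L) (poly_pair NM) \<tau>" and cR: "c \<in> cocycles (part_complex Relative NM) q"
    and xc: "x = cech_pull q (part_pair Relative (subpair P L)) UNIV (star \<tau>) c"
    using cech_class_polyhedral[OF cpL x', where 'u = 'u] by blast
  have c: "c \<in> cocycles NM q"
    using cR by simp
  \<comment> \<open>A relative cocycle is also an absolute one, so the same \<sigma> serves the
    preimage and the given family.\<close>
  have cA: "c \<in> cocycles (part_complex Absolute NM) q"
    using cocycles_absolute[OF c] by simp
  note subL = compact_pairD(1)[OF cpL]
  have \<phi>L: "\<phi> (fst L, {}) = cech_pull q (part_pair Absolute (subpair P L)) UNIV (star \<tau>) c"
    unfolding x(2)[symmetric] xc part_pair.simps(1)
    by (rule cech_induced_pull[OF part_pair_incl(2) part_pair_subset[OF subL] carried_star[OF \<tau> subL NM(1)] c])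
  obtain \<sigma> where \<sigma>: "cohomology_lift TYPE('g) P L NM \<tau> \<sigma>"
    using lift[OF NM \<tau>] by blast
  note fam = cohomology_liftD(2)[OF \<sigma> cR] and uniq = cohomology_liftD(3)[OF \<sigma> cA famA \<phi>L]
  obtain \<Psi> where \<Psi>: "\<Psi> \<in> carrier (H_cohomology q (part_pair Relative P))"
    "\<And>C. C \<in> compact_subpairs P \<Longrightarrow> \<Psi> (part_index Relative C) = cech_pull q (part_pair Relative (subpair P C)) UNIV (star (\<sigma> C)) c"
    using limit_of_cech_family[OF P fam] by metis
  have "\<phi> D = \<Psi> D" if D: "D \<in> compact_subpairs (part_pair Absolute P)" for D
  proof -
    have D': "D \<in> compact_subpairs P" "D = (fst D, {})"
      using D compact_subpairs_absolute by (blast, auto simp: compact_subpairs_def)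
    \<comment> \<open>Members of the absolute system have an empty second component, so there the
      relative and the absolute classes are taken on the same pair.\<close>
    have "part_pair Absolute (subpair P D) = subpair P D"
      using D'(2) by (metis part_pair.simps(2) prod.collapse snd_conv subpair_def fst_conv)
    then show ?thesis
      using uniq[OF D'(1)] \<Psi>(2)[OF D'(1)] D'(2) by simp
  qed
  moreover have "\<phi> \<in> extensional (compact_subpairs (part_pair Absolute P))"
    using \<phi> by (simp only: H_cohomology_carrier)
  ultimately have "\<phi> = H_restrict (part_pair Absolute P) \<Psi>"
    unfolding H_restrict_def by (intro extensionalityI[where A = "compact_subpairs (part_pair Absolute P)"]) auto
  then show "\<phi> \<in> H_restrict (part_pair Absolute P) ` carrier (H_cohomology q P)"
    using \<Psi>(1) by simp
qed

text \<open>A preimage on \<open>L\<close> is lifted with its cocycle \<open>c\<close>. The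
  coboundary of \<open>c\<close> represents the given family on \<open>L\<close>, hence on every
  \<open>C\<close>, where it is the image of the lift. Conversely, on pairs with empty subspace the
  connecting homomorphism starts from the cohomology of the empty space, which is zero.\<close>

lemma H_exact_relative:
  "kernel (H_cohomology q P :: ('a, 'g::ab_group_add) H_class monoid)
      (H_cohomology q (part_pair Absolute P)) (H_restrict (part_pair Absolute P)) =
    H_delta (q - 1) P ` carrier (H_cohomology (q - 1) (part_pair Subspace P))"
proof (intro equalityI subsetI)
  note cp = compact_pair_subpair[OF P]
  fix \<phi> :: "('a, 'g) H_class"
  assume "\<phi> \<in> H_delta (q - 1) P ` carrier (H_cohomology (q - 1) (part_pair Subspace P))"
  then obtain \<psi> where \<psi>: "\<psi> \<in> carrier (H_cohomology (q - 1) (part_pair Subspace P))" and \<phi>: "\<phi> = H_delta (q - 1) P \<psi>"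
    by blast
  have "\<phi> \<in> carrier (H_cohomology q P)"
    using hom_in_carrier[OF H_delta_hom[OF P] \<psi>] by (simp add: \<phi>)
  moreover have "\<phi> D = \<one>\<^bsub>cech_cohomology q (subpair (part_pair Absolute P) D)\<^esub>"
    if D: "D \<in> compact_subpairs (part_pair Absolute P)" for D
  proof -
    have D': "D \<in> compact_subpairs P" "snd D = {}"
      using D compact_subpairs_absolute by (blast, auto simp: compact_subpairs_def)
    note cl = compact_pairD(4)[OF cp[OF D'(1)]]
    let ?S = "part_pair Subspace (subpair P D)"
    have "\<psi> (snd D, {}) \<in> carrier (cech_cohomology (q - 1) ?S)"
      using cech_family_of_limit[OF \<psi>] D'(1) by (simp add: cech_family_def)
    moreover have "snd ?S = topspace (fst ?S)"
      using D'(2) by (simp add: subpair_def)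
    ultimately have "\<psi> (snd D, {}) = \<one>\<^bsub>cech_cohomology (q - 1) ?S\<^esub>"
      by (intro cech_trivial_pair)
    then have "\<phi> D = cech_delta (q - 1) (subpair P D) \<one>\<^bsub>cech_cohomology (q - 1) ?S\<^esub>"
      using D'(1) by (simp add: \<phi> H_delta_def)
    also have "\<dots> = \<one>\<^bsub>cech_cohomology (q - 1 + 1) (subpair P D)\<^esub>"
      by (rule hom_one[OF cech_delta_hom[OF cl]])
        (rule cech_group, use compact_pairD(1)[OF cp[OF D'(1)]] in auto)+
    finally show ?thesis
      unfolding subpair_absolute by simp
  qed
  then have "H_restrict (part_pair Absolute P) \<phi> = \<one>\<^bsub>H_cohomology q (part_pair Absolute P)\<^esub>"
    unfolding H_restrict_def H_cohomology_one by (intro restrict_ext)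
  ultimately show "\<phi> \<in> kernel (H_cohomology q P) (H_cohomology q (part_pair Absolute P)) (H_restrict (part_pair Absolute P))"
    by (simp add: kernel_def)
next
  note cp = compact_pair_subpair[OF P]
  fix \<phi> :: "('a, 'g) H_class"
  assume "\<phi> \<in> kernel (H_cohomology q P) (H_cohomology q (part_pair Absolute P)) (H_restrict (part_pair Absolute P))"
  then have \<phi>: "\<phi> \<in> carrier (H_cohomology q P)"
    and 0: "H_restrict (part_pair Absolute P) \<phi> = \<one>\<^bsub>H_cohomology q (part_pair Absolute P)\<^esub>"
    by (auto simp: kernel_def)
  obtain L where L: "L \<in> compact_subpairs P" and lift: "\<And>NM (\<tau> :: 'a \<Rightarrow> 'u cw_universe).
      \<lbrakk>simplicial_pair NM; finite (fst NM); pair_map (subpair P L) (poly_pair NM) \<tau>\<rbrakk> \<Longrightarrow>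
      \<exists>\<sigma>. cohomology_lift TYPE('g) P L NM \<tau> \<sigma>"
    using H_shape_compact_lift[OF P R shape, where 'g = 'g] by blast
  note cpL = cp[OF L] note subL = compact_pairD(1)[OF cpL] and clL = compact_pairD(4)[OF cpL]
  have famR: "cech_family Relative q P \<phi>"
    using cech_family_of_limit[of \<phi> q Relative P] \<phi> by simp
  note AL = absolute_index[OF L]
  have AL': "(fst L, {}) \<in> compact_subpairs P" "subpair_le (fst L, {}) L"
    using AL(1) compact_subpairs_absolute by (blast, auto simp: subpair_le_def)
  have "cech_induced q (subpair P (fst L, {})) (subpair P L) id (\<phi> L) = \<phi> (fst L, {})"
    using \<phi> L AL' unfolding H_cohomology_carrier by blast
  moreover have "\<phi> (fst L, {}) = \<one>\<^bsub>cech_cohomology q (part_pair Absolute (subpair P L))\<^esub>"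
    using fun_cong[OF 0, of "(fst L, {})"] AL by (simp only: H_restrict_def H_cohomology_one restrict_apply' if_True)
  ultimately have "cech_induced q (part_pair Absolute (subpair P L)) (subpair P L) id (\<phi> L) =
      \<one>\<^bsub>cech_cohomology q (part_pair Absolute (subpair P L))\<^esub>"
    unfolding AL(2)[symmetric] subpair_absolute by simp
  moreover have "\<phi> L \<in> carrier (cech_cohomology q (subpair P L))"
    using \<phi> L by (simp add: H_cohomology_carrier)
  ultimately obtain y where y: "y \<in> carrier (cech_cohomology (q - 1) (part_pair Subspace (subpair P L)))"
    "cech_delta (q - 1) (subpair P L) y = \<phi> L"
    using cech_exact_relative[OF clL] by blast
  obtain NM c and \<tau> :: "'a \<Rightarrow> 'u cw_universe" where NM: "simplicial_pair NM" "finite (fst NM)"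
    and \<tau>: "pair_map (subpair P L) (poly_pair NM) \<tau>" and cS: "c \<in> cocycles (part_complex Subspace NM) (q - 1)"
    and yc: "y = cech_pull (q - 1) (part_pair Subspace (subpair P L)) UNIV (star \<tau>) c"
    using cech_class_polyhedral[OF cpL y(1), where 'u = 'u] by blast
  have c: "c \<in> cocycles (snd NM, {}) (q - 1)"
    using cS by simp
  let ?d = "coboundary (fst NM) c"
  have dR: "?d \<in> cocycles (part_complex Relative NM) q"
    using delta_cocycles[OF NM(1) c] by simp
  have \<phi>L: "\<phi> L = cech_pull q (part_pair Relative (subpair P L)) UNIV (star \<tau>) ?d"
    using cech_delta_pull[OF clL carried_star[OF \<tau> subL NM(1)] c] by (simp add: y(2)[symmetric] yc)
  obtain \<sigma> where \<sigma>: "cohomology_lift TYPE('g) P L NM \<tau> \<sigma>"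
    using lift[OF NM \<tau>] by blast
  note uniq = cohomology_liftD(3)[OF \<sigma> dR famR \<phi>L]
  obtain \<Psi> where \<Psi>: "\<Psi> \<in> carrier (H_cohomology (q - 1) (part_pair Subspace P))"
    "\<And>C. C \<in> compact_subpairs P \<Longrightarrow>
      \<Psi> (part_index Subspace C) = cech_pull (q - 1) (part_pair Subspace (subpair P C)) UNIV (star (\<sigma> C)) c"
    using limit_of_cech_family[OF P cohomology_liftD(2)[OF \<sigma> cS]] by metis
  have "\<phi> C = H_delta (q - 1) P \<Psi> C" if C: "C \<in> compact_subpairs P" for C
  proof -
    note cpC = cp[OF C]
    have "H_delta (q - 1) P \<Psi> C = cech_delta (q - 1) (subpair P C)
        (cech_pull (q - 1) (part_pair Subspace (subpair P C)) UNIV (star (\<sigma> C)) c)"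
      using \<Psi>(2)[OF C] C by (simp add: H_delta_def)
    also have "\<dots> = cech_pull q (subpair P C) UNIV (star (\<sigma> C)) ?d"
      using cech_delta_pull[OF compact_pairD(4)[OF cpC] carried_star[OF cohomology_liftD(1)[OF \<sigma> C] compact_pairD(1)[OF cpC] NM(1)] c]
      by simp
    finally show ?thesis
      using uniq[OF C] by simp
  qed
  moreover have "\<phi> \<in> extensional (compact_subpairs P)"
    using \<phi> by (simp add: H_cohomology_carrier)
  ultimately have "\<phi> = H_delta (q - 1) P \<Psi>"
    by (intro extensionalityI[where A = "compact_subpairs P"]) (auto simp: H_delta_def)
  then show "\<phi> \<in> H_delta (q - 1) P ` carrier (H_cohomology (q - 1) (part_pair Subspace P))"
    using \<Psi>(1) by blast
qed

text \<open>The absolute preimage on \<open>L\<close> is lifted with its cocycle \<open>c\<close>,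
  and the truncation of \<open>c\<close> to the subcomplex reproduces the given family. Conversely,
  the composite vanishes on each compact pair by \<open>cech_delta_restrict\<close>.\<close>

lemma H_exact_subspace:
  "kernel (H_cohomology q (part_pair Subspace P) :: ('a, 'g::ab_group_add) H_class monoid)
      (H_cohomology (q + 1) P) (H_delta q P) =
    H_restrict (part_pair Subspace P) ` carrier (H_cohomology q (part_pair Absolute P))"
proof (intro equalityI subsetI)
  note cp = compact_pair_subpair[OF P]
  fix \<phi> :: "('a, 'g) H_class"
  assume "\<phi> \<in> H_restrict (part_pair Subspace P) ` carrier (H_cohomology q (part_pair Absolute P))"
  then obtain \<psi> where \<psi>: "\<psi> \<in> carrier (H_cohomology q (part_pair Absolute P))" and \<phi>: "\<phi> = H_restrict (part_pair Subspace P) \<psi>"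
    by blast
  have "H_delta q P \<phi> = \<one>\<^bsub>H_cohomology (q + 1) P\<^esub>"
    unfolding H_delta_def H_cohomology_one
  proof (rule restrict_ext)
    fix C assume C: "C \<in> compact_subpairs P"
    have "\<psi> (fst C, {}) \<in> carrier (cech_cohomology q (part_pair Absolute (subpair P C)))"
      using cech_family_of_limit[OF \<psi>] C by (simp add: cech_family_def)
    from cech_delta_restrict[OF compact_pairD(4)[OF cp[OF C]] this]
    show "cech_delta q (subpair P C) (\<phi> (snd C, {})) = \<one>\<^bsub>cech_cohomology (q + 1) (subpair P C)\<^esub>"
      unfolding H_absolute_restrict[OF \<psi> C] using subspace_index(1)[OF C]
      by (simp only: \<phi> H_restrict_def restrict_apply' if_True)
  qed
  then show "\<phi> \<in> kernel (H_cohomology q (part_pair Subspace P)) (H_cohomology (q + 1) P) (H_delta q P)"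
    using hom_in_carrier[OF H_restrict_subspace_hom \<psi>] by (simp add: kernel_def \<phi>)
next
  note cp = compact_pair_subpair[OF P]
  fix \<phi> :: "('a, 'g) H_class"
  assume "\<phi> \<in> kernel (H_cohomology q (part_pair Subspace P)) (H_cohomology (q + 1) P) (H_delta q P)"
  then have \<phi>: "\<phi> \<in> carrier (H_cohomology q (part_pair Subspace P))"
    and 0: "H_delta q P \<phi> = \<one>\<^bsub>H_cohomology (q + 1) P\<^esub>"
    by (auto simp: kernel_def)
  obtain L where L: "L \<in> compact_subpairs P" and lift: "\<And>NM (\<tau> :: 'a \<Rightarrow> 'u cw_universe).
      \<lbrakk>simplicial_pair NM; finite (fst NM); pair_map (subpair P L) (poly_pair NM) \<tau>\<rbrakk> \<Longrightarrow>
      \<exists>\<sigma>. cohomology_lift TYPE('g) P L NM \<tau> \<sigma>"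
    using H_shape_compact_lift[OF P R shape, where 'g = 'g] by blast
  note cpL = cp[OF L] note subL = compact_pairD(1)[OF cpL] and clL = compact_pairD(4)[OF cpL]
  have famS: "cech_family Subspace q P (\<lambda>C. \<phi> (snd C, {}))"
    using cech_family_of_limit[OF \<phi>] by simp
  have "cech_delta q (subpair P L) (\<phi> (snd L, {})) = \<one>\<^bsub>cech_cohomology (q + 1) (subpair P L)\<^esub>"
    using fun_cong[OF 0, of L] L by (simp add: H_delta_def H_cohomology_one)
  moreover have "\<phi> (snd L, {}) \<in> carrier (cech_cohomology q (part_pair Subspace (subpair P L)))"
    using famS L by (simp add: cech_family_def)
  ultimately obtain x where x: "x \<in> carrier (cech_cohomology q (part_pair Absolute (subpair P L)))"
    "cech_induced q (part_pair Subspace (subpair P L)) (part_pair Absolute (subpair P L)) id x = \<phi> (snd L, {})"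
    using cech_exact_subspace[OF clL] by blast
  obtain NM c and \<tau> :: "'a \<Rightarrow> 'u cw_universe" where NM: "simplicial_pair NM" "finite (fst NM)"
    and \<tau>: "pair_map (subpair P L) (poly_pair NM) \<tau>" and cA: "c \<in> cocycles (part_complex Absolute NM) q"
    and xc: "x = cech_pull q (part_pair Absolute (subpair P L)) UNIV (star \<tau>) c"
    using cech_class_polyhedral[OF cpL x(1), where 'u = 'u] by blast
  \<comment> \<open>Cocycles for the subspace live on the subcomplex, so \<open>c\<close> is cut off
    outside it. The stars met on the subspace span only simplices of the subcomplex, so its class
    there is unchanged.\<close>
  let ?c = "pull_cochain (part_complex Subspace NM) id c"
  have sm: "simplicial_map (part_complex Subspace NM) (part_complex Absolute NM) id"
    using NM(1) by (auto simp: simplicial_map_def simplicial_pair_def)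
  have cS: "?c \<in> cocycles (part_complex Subspace NM) q"
    by (rule pull_cocycles[OF simplicial_pair_part[OF NM(1)] simplicial_pair_part[OF NM(1)] sm cA])
  have cc: "cech_induced q (part_pair Subspace (subpair P C)) (part_pair Absolute (subpair P C)) id
        (cech_pull q (part_pair Absolute (subpair P C)) UNIV (star f) c) =
      cech_pull q (part_pair Subspace (subpair P C)) UNIV (star f) ?c"
    if C: "C \<in> compact_subpairs P" and f: "pair_map (subpair P C) (poly_pair NM) f" for C and f :: "'a \<Rightarrow> 'u cw_universe"
  proof -
    note sub = compact_pairD(1)[OF cp[OF C]]
    note car = carried_star[OF f sub NM(1)]
    have "cech_induced q (part_pair Subspace (subpair P C)) (part_pair Absolute (subpair P C)) id
        (cech_pull q (part_pair Absolute (subpair P C)) UNIV (star f) c) =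
        cech_pull q (part_pair Subspace (subpair P C)) UNIV (star f) c"
      by (rule cech_induced_pull[OF part_pair_incl(1) part_pair_subset[OF sub] carried_part[OF car] cA])
    also have "\<dots> = cech_pull q (part_pair Subspace (subpair P C)) UNIV (star f) ?c"
      by (rule cech_pull_cong) (use carried_part[OF car, of Subspace] in \<open>auto simp: carried_def pull_cochain_def\<close>)
    finally show ?thesis .
  qed
  have \<phi>L: "\<phi> (snd L, {}) = cech_pull q (part_pair Subspace (subpair P L)) UNIV (star \<tau>) ?c"
    using cc[OF L \<tau>] x(2) xc by simp
  obtain \<sigma> where \<sigma>: "cohomology_lift TYPE('g) P L NM \<tau> \<sigma>"
    using lift[OF NM \<tau>] by blast
  note uniq = cohomology_liftD(3)[OF \<sigma> cS famS \<phi>L]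
  obtain \<Psi> where \<Psi>: "\<Psi> \<in> carrier (H_cohomology q (part_pair Absolute P))"
    "\<And>C. C \<in> compact_subpairs P \<Longrightarrow>
      \<Psi> (part_index Absolute C) = cech_pull q (part_pair Absolute (subpair P C)) UNIV (star (\<sigma> C)) c"
    using limit_of_cech_family[OF P cohomology_liftD(2)[OF \<sigma> cA]] by metis
  have "\<phi> D = \<Psi> D" if D: "D \<in> compact_subpairs (part_pair Subspace P)" for D
  proof -
    \<comment> \<open>A compact set \<open>K\<close> in the subspace is regarded as the pair
      \<open>(K, K)\<close>, which is an index of the lifted family.\<close>
    let ?C = "part_lift Subspace D"
    note C = part_lift_compact[OF D]
    have "\<Psi> (snd ?C, {}) = \<phi> (snd ?C, {})"
      using H_absolute_restrict[OF \<Psi>(1) C(1)] \<Psi>(2)[OF C(1)] cc[OF C(1) cohomology_liftD(1)[OF \<sigma> C(1)]] uniq[OF C(1)]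
      by simp
    then show ?thesis
      using C(2) by simp
  qed
  moreover have "\<phi> \<in> extensional (compact_subpairs (part_pair Subspace P))"
    using \<phi> by (simp only: H_cohomology_carrier)
  ultimately have "\<phi> = H_restrict (part_pair Subspace P) \<Psi>"
    unfolding H_restrict_def by (intro extensionalityI[where A = "compact_subpairs (part_pair Subspace P)"]) auto
  then show "\<phi> \<in> H_restrict (part_pair Subspace P) ` carrier (H_cohomology q (part_pair Absolute P))"
    using \<Psi>(1) by blast
qed

end

theorem theorem5p2:
  fixes X :: "'a topology" and X0 :: "'a set"
    and K :: "'k topology" and K0 :: "'k set"
    and q :: int
  assumes "hausdorff_pair (X, X0)"
    and "compact_pair (K, K0)"
    and "same_H_shape TYPE('u cw_universe) (X, X0) (K, K0)"
  shows "exact_seq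
    ([H_cohomology (q + 1) (X, X0) :: ('a, 'g::ab_group_add) H_class monoid,
      H_cohomology q (subtopology X X0, {}),
      H_cohomology q (X, {}),
      H_cohomology q (X, X0),
      H_cohomology (q - 1) (subtopology X X0, {})],
     [H_delta q (X, X0),
      H_restrict (subtopology X X0, {}),
      H_restrict (X, {}),
      H_delta (q - 1) (X, X0)])"
proof -
  let ?P = "(X, X0)"
  have parts: "part_pair Absolute ?P = (X, {})" "part_pair Subspace ?P = (subtopology X X0, {})"
    by simp_all
  have grp: "group (H_cohomology n (part_pair k ?P) :: ('a, 'g) H_class monoid)" for n k
    by (rule H_cohomology_group[OF hausdorff_pair_part[OF assms(1)]])
  note grps = grp[of _ Relative, unfolded part_pair.simps] grp[of _ Absolute, unfolded parts] grp[of _ Subspace, unfolded parts]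
  note homs = H_delta_hom[OF assms(1), unfolded parts] H_restrict_absolute_hom[of ?P, unfolded parts]
    H_restrict_subspace_hom[of ?P, unfolded parts]
  \<comment> \<open>The general statement ends in degree \<open>q - 1 + 1\<close>, which has to be
    identified with \<open>q\<close>.\<close>
  have \<delta>: "H_delta (q - 1) ?P \<in> hom (H_cohomology (q - 1) (subtopology X X0, {}) :: ('a, 'g) H_class monoid) (H_cohomology q ?P)"
    using homs(1)[of "q - 1"] by simp
  show ?thesis
    by (simp only: exact_seq_cons_iff exact_seq_end_iff group_hom_def group_hom_axioms_def grps homs \<delta> simp_thms
        H_exact_absolute[OF assms, unfolded parts] H_exact_relative[OF assms, unfolded parts]
        H_exact_subspace[OF assms, unfolded parts])
qed

end
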